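(* For any interval $I\subseteq[0,\frac{\pi}{4}]$ and any $r,\alpha,\delta>0$, one has $$\varepsilon^r\int_I R_\varepsilon^r(\omega)\,d\omega=c_r\int_I(1+\tan x)^r\,dx+O_{r,\delta}\big(\varepsilon^{\frac12-2\alpha-\delta}+|I|\,\varepsilon^{\alpha}\big)\qquad\text{as }\varepsilon\to0^+,$$ where $$c_r=\frac{12}{\pi^2}\int_0^{1/2}\left( x\big(x^{r-1}+(1-x)^{r-1}\big)+\frac{1-(1-x)^r}{rx(1-x)}-\frac{1-(1-x)^{r+1}}{(r+1)x(1-x)}\right)dx .$$
   Context: For $0<\varepsilon<\frac12$, let $C_\varepsilon=\big(\{0\}\times[-\varepsilon,\varepsilon]\big)\cup\big([-\varepsilon,\varepsilon]\times\{0\}\big)$ (a cross-like scatterer) and, for a direction (angle) $\omega$, $$l_\varepsilon(\omega)=\inf\{\tau>0:(\tau\cos\omega,\tau\sin\omega)\in C_\varepsilon+(\mathbb{Z}^2\setminus\{(0,0)\})\}.$$ A point-like particle starts at the corner $O=(0,0)$ of the square billiard table $[0,1]^2$ in direction $\omega$, is reflected specularly in the side cushions, and stops at time $l_\varepsilon(\omega)$, when its unfolded (straight) trajectory hits one of the cross-like scatterers $C_\varepsilon+(\mathbb{Z}^2\setminus\{(0,0)\})$. $R_\varepsilon(\omega)$ denotes the number of reflections in the side cushions before it stops; that is, for $\omega\in(0,\frac{\pi}{4}]$, the number of $\tau\in(0,l_\varepsilon(\omega))$ with $\tau\cos\omega\in\mathbb{Z}$ plus the number of $\tau\in(0,l_\varepsilon(\omega))$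 with $\tau\sin\omega\in\mathbb{Z}$. $R_\varepsilon^r(\omega)$ means $(R_\varepsilon(\omega))^r$, and $|I|$ is the length of $I$. The notation $F=O_{r,\delta}(G)$ as $\varepsilon\to0^+$ means $|F|\le C\,G$ for all sufficiently small $\varepsilon>0$, where the constant $C$ depends only on $r$ and $\delta$. *)

theory Defs
  imports "HOL-Analysis.Analysis"
begin

definition cross_scatterer :: "real \<Rightarrow> (real \<times> real) set" where
  "cross_scatterer \<epsilon> = {0} \<times> {-\<epsilon>..\<epsilon>} \<union> {-\<epsilon>..\<epsilon>} \<times> {0}"

definition scatterers :: "real \<Rightarrow> (real \<times> real) set" where
  "scatterers \<epsilon> =
     {p + (of_int m, of_int n) | p (m :: int) (n :: int).
        p \<in> cross_scatterer \<epsilon> \<and> (m, n) \<noteq> (0, 0)}"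

text \<open>
  For \<open>\<epsilon> > 0\<close> every half-line from the origin meets a scatterer, so the infimum is
  over a nonempty set of positive reals.
\<close>

definition free_path_length :: "real \<Rightarrow> real \<Rightarrow> real" where
  "free_path_length \<epsilon> \<omega> =
     Inf {\<tau>. \<tau> > 0 \<and> (\<tau> * cos \<omega>, \<tau> * sin \<omega>) \<in> scatterers \<epsilon>}"

text \<open>
  A reflection in a vertical (horizontal) cushion of the table \<open>[0,1]\<^sup>2\<close> corresponds to
  the unfolded straight trajectory crossing a line with integral abscissa (ordinate).
  The formula is meant for \<open>0 < \<omega> \<le> \<pi>/4\<close>, where both sets are finite. At \<open>\<omega> = 0\<close> the
  second set is infinite and contributes \<open>0\<close>; a single direction does not affect integrals.
\<close>

definition num_reflections :: "real \<Rightarrow> real \<Rightarrow> nat" where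
  "num_reflections \<epsilon> \<omega> =
     card {\<tau> \<in> {0<..<free_path_length \<epsilon> \<omega>}. \<tau> * cos \<omega> \<in> \<int>} +
     card {\<tau> \<in> {0<..<free_path_length \<epsilon> \<omega>}. \<tau> * sin \<omega> \<in> \<int>}"

definition moment_const :: "real \<Rightarrow> real" where
  "moment_const r = 12 / pi\<^sup>2 *
     (LBINT x:{0..1/2}.
        x * (x powr (r - 1) + (1 - x) powr (r - 1))
        + (1 - (1 - x) powr r) / (r * x * (1 - x))
        - (1 - (1 - x) powr (r + 1)) / ((r + 1) * x * (1 - x)))"

end

theory Submission
  imports Defs "HOL-Number_Theory.Number_Theory" "HOL-Real_Asymp.Real_Asymp"
begin

text \<open>
  Unfold the billiard, and let \<open>t = tan \<omega>\<close> be the slope of the trajectory and \<open>q\<close> the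
  first positive integer for which \<open>q t\<close> is within \<open>\<epsilon>\<close> of an integer \<open>a\<close>. For \<open>t \<le> 1\<close> a hit on
  either bar of a scatterer at \<open>(m, n)\<close> forces \<open>\<bar>m t - n\<bar> \<le> \<epsilon>\<close>, so the particle
  stops at the scatterer \<open>(q, a)\<close>, after \<open>q (1 + t) + O(1)\<close> reflections. The theorem is therefore
  about the moments of the first denominator \<open>q\<close>, the weight \<open>(1 + t)\<^sup>r\<close> and the change
  of variables \<open>t = tan \<omega>\<close> being monotone factors, which the second mean value theorem removes.

  The slopes with first denominator \<open>k\<close> form arcs around the fractions \<open>a/k\<close>. On the right of
  \<open>a/k\<close> the arc ends where the next fraction of smaller denominator \<open>s\<close> takes over, and \<open>s\<close> is
  the residue with \<open>a s \<equiv> -1\<close> modulo \<open>k\<close>; its length is an explicit decreasing function of \<open>s\<close>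
  (\<open>measure_right_arc\<close>). Summing over the fractions up to \<open>x\<close> thus asks how evenly modular inverses
  are spread over boxes. Completing the sums turns this into a bound for Kloosterman sums, and
  Kloosterman's own fourth moment argument gives \<open>O(k\<^sup>3\<^sup>/\<^sup>4\<^sup>+\<^sup>\<eta>)\<close> for every modulus
  (\<open>kloosterman_bound_fst\<close>). Here the fourth power mean counts solutions of
  \<open>(x\<^sub>1 + x\<^sub>2) (x\<^sub>3 - x\<^sub>1) (x\<^sub>2 - x\<^sub>3) \<equiv> 0\<close>, which can be done at once for composite moduli.

  Hence the slopes in \<open>[0, x]\<close> with first denominator \<open>k\<close> have measure
  \<open>2 x \<epsilon> \<phi>(k)/k f(\<epsilon> k) + O(\<epsilon> k\<^sup>-\<^sup>1\<^sup>/\<^sup>5)\<close> for an explicit decreasing function \<open>f\<close>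
  (\<open>denominator_measure_asymp\<close>). The average \<open>6/\<pi>\<^sup>2\<close> of \<open>\<phi>(k)/k\<close> and partial summation
  then lead to \<open>12/\<pi>\<^sup>2 \<integral> y\<^sup>r f(y) dy\<close>, which an integration by parts identifies with the
  constant \<open>c\<^sub>r\<close>.

  All errors together are \<open>O(\<epsilon>\<^sup>1\<^sup>/\<^sup>5)\<close>, uniformly in the interval of directions. That is
  enough: if \<open>\<alpha> < 1/5\<close> it is eventually below \<open>\<bar>I\<bar> \<epsilon>\<^sup>\<alpha>\<close>, and if \<open>\<alpha> \<ge> 1/5\<close> then
  \<open>1/2 - 2 \<alpha> - \<delta> < 1/5\<close>.
\<close>

section \<open>Divisors and totients\<close>

definition num_divisors :: "nat \<Rightarrow> nat" where
  "num_divisors n = card {d. d dvd n}"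

lemma num_divisors_pos: "n > 0 \<Longrightarrow> num_divisors n \<ge> 1"
  unfolding num_divisors_def
  by (metis One_nat_def Suc_leI card_gt_0_iff dvd_refl empty_iff finite_divisors_nat mem_Collect_eq)

lemma num_divisors_prime_power_mult_le:
  assumes "prime p" "m > 0"
  shows "num_divisors (p ^ e * m) \<le> (e + 1) * num_divisors m"
proof -
  have sub: "{d. d dvd p ^ e * m} \<subseteq> (\<lambda>(i, d). p ^ i * d) ` ({..e} \<times> {d. d dvd m})"
  proof
    fix d assume "d \<in> {d. d dvd p ^ e * m}"
    then obtain b c where bc: "d = b * c" "b dvd p ^ e" "c dvd m"
      using division_decomp by blast
    then obtain i where "i \<le> e" "b = p ^ i"
      using divides_primepow_nat[OF assms(1)] by blast
    with bc show "d \<in> (\<lambda>(i, d). p ^ i * d) ` ({..e} \<times> {d. d dvd m})" by force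
  qed
  have fin: "finite ({..e} \<times> {d. d dvd m})"
    using assms by (simp add: finite_divisors_nat)
  have "card {d. d dvd p ^ e * m} \<le> card ({..e} \<times> {d. d dvd m})"
    using surj_card_le[OF fin sub] .
  then show ?thesis
    unfolding num_divisors_def by (simp add: card_cartesian_product)
qed

text \<open>
  Writing \<open>n = \<Prod> p\<^sup>e\<close>, the number of divisors is \<open>\<Prod> (e + 1)\<close>. A prime
  \<open>p \<ge> 2\<^sup>1\<^sup>/\<^sup>\<eta>\<close> has \<open>p\<^sup>e\<^sup>\<eta> \<ge> 2\<^sup>e \<ge> e + 1\<close>, so only the boundedly many smaller primes
  cost a constant factor.
\<close>

lemma num_divisors_bound:
  fixes \<eta> :: real
  assumes "\<eta> > 0"
  obtains C where "C \<ge> 1" "\<And>n. n > 0 \<Longrightarrow> real (num_divisors n) \<le> C * real n powr \<eta>"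
proof -
  define B where "B = max 1 (1 / (\<eta> * ln 2))"
  define P where "P = nat \<lceil>2 powr (1 / \<eta>)\<rceil>"
  define small where "small = (\<lambda>n::nat. {p. prime p \<and> p < P \<and> p dvd n})"
  have fin_small: "finite (small n)" for n
    by (rule finite_subset[of _ "{..<P}"]) (auto simp: small_def)
  have B1: "B \<ge> 1" by (simp add: B_def)
  have factor: "real (e + 1) \<le> real p powr (real e * \<eta>) * (if p < P then B else 1)"
    if "prime p" for p e :: nat
  proof (cases "p < P")
    case True
    have p2: "real p \<ge> 2" using prime_ge_2_nat[OF that] by simp
    have "1 + real e * \<eta> * ln 2 \<le> exp (real e * \<eta> * ln 2)"
      by (rule exp_ge_add_one_self)
    also have "\<dots> = 2 powr (real e * \<eta>)" by (simp add: powr_def)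
    also have "\<dots> \<le> real p powr (real e * \<eta>)"
      using p2 assms by (intro powr_mono2) auto
    finally have 1: "1 + real e * \<eta> * ln 2 \<le> real p powr (real e * \<eta>)" .
    have "real e = real e * \<eta> * ln 2 * (1 / (\<eta> * ln 2))"
      using assms by simp
    also have "\<dots> \<le> real e * \<eta> * ln 2 * B"
      unfolding B_def using assms by (intro mult_left_mono) auto
    finally have "real (e + 1) \<le> (1 + real e * \<eta> * ln 2) * B"
      using B1 by (simp add: algebra_simps)
    also have "\<dots> \<le> real p powr (real e * \<eta>) * B"
      using 1 B1 by (intro mult_right_mono) auto
    finally show ?thesis using True by simp
  next
    case False
    then have "2 powr (1 / \<eta>) \<le> real p"
      unfolding P_def by linarith
    then have "(2 powr (1 / \<eta>)) powr (real e * \<eta>) \<le> real p powr (real e * \<eta>)"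
      using assms by (intro powr_mono2) auto
    moreover have "(2 powr (1 / \<eta>)) powr (real e * \<eta>) = 2 ^ e"
      using assms by (simp add: powr_powr powr_realpow)
    moreover have "real (e + 1) \<le> 2 ^ e"
      by (induction e) auto
    ultimately show ?thesis using False by simp
  qed
  have main: "n > 0 \<Longrightarrow> real (num_divisors n) \<le> B ^ card (small n) * real n powr \<eta>" for n
  proof (induction n rule: less_induct)
    case (less n)
    show ?case
    proof (cases "n = 1")
      case True
      then have "num_divisors n = 1" by (simp add: num_divisors_def)
      then show ?thesis using True one_le_power[OF B1, of "card (small 1)"] by simp
    next
      case False
      then obtain p where p: "prime p" "p dvd n" using prime_factor_nat by blast
      define e where "e = multiplicity p n"
      obtain m where m: "n = p ^ e * m" "\<not> p dvd m"
        unfolding e_def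
        by (rule multiplicity_decompose'[of n p]) (use less.prems p(1) in auto)
      have m0: "m > 0" using m less.prems by (cases m) auto
      have e0: "e > 0" using m p by (cases e) auto
      have "1 < p ^ e" using e0 prime_gt_1_nat[OF p(1)] by (intro one_less_power) auto
      then have "m < n" using m m0 by simp
      have small_sub: "insert p (small m) \<subseteq> small n" if "p < P"
        using that m p unfolding small_def by auto
      have "p \<notin> small m" using m by (simp add: small_def)
      have cards: "(if p < P then B else 1) * B ^ card (small m) \<le> B ^ card (small n)"
      proof (cases "p < P")
        case True
        have "card (insert p (small m)) \<le> card (small n)"
          using small_sub[OF True] fin_small by (intro card_mono) auto
        then have "Suc (card (small m)) \<le> card (small n)"
          using \<open>p \<notin> small m\<close> fin_small by simp
        then have "B ^ Suc (card (small m)) \<le> B ^ card (small n)"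
          using B1 by (rule power_increasing)
        then show ?thesis using True by simp
      next
        case False
        have "card (small m) \<le> card (small n)"
          by (rule card_mono[OF fin_small]) (auto simp: small_def m)
        then show ?thesis using False B1 by (simp add: power_increasing)
      qed
      have "real (num_divisors n) \<le> real (e + 1) * real (num_divisors m)"
        using num_divisors_prime_power_mult_le[OF p(1) m0, of e] m(1)
        by (metis of_nat_le_iff of_nat_mult)
      also have "\<dots> \<le> (real p powr (real e * \<eta>) * (if p < P then B else 1)) * (B ^ card (small m) * real m powr \<eta>)"
        using factor[OF p(1), of e] less.IH[OF \<open>m < n\<close> m0] B1
        by (intro mult_mono) auto
      also have "\<dots> = ((if p < P then B else 1) * B ^ card (small m)) * (real p powr (real e * \<eta>) * real m powr \<eta>)"
        by simp
      also have "real p powr (real e * \<eta>) * real m powr \<eta> = real n powr \<eta>"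
        using prime_gt_0_nat[OF p(1)] m0 unfolding m(1)
        by (simp add: powr_mult powr_powr flip: powr_realpow)
      also have "(if p < P then B else 1) * B ^ card (small m) * (real n powr \<eta>) \<le> B ^ card (small n) * real n powr \<eta>"
        using cards by (intro mult_right_mono) auto
      finally show ?thesis .
    qed
  qed
  show ?thesis
  proof (rule that[of "B ^ P"])
    show "B ^ P \<ge> 1" using B1 by simp
    fix n :: nat assume n: "n > 0"
    have "card (small n) \<le> card {..<P}"
      by (intro card_mono) (auto simp: small_def)
    then have "B ^ card (small n) \<le> B ^ P"
      using B1 by (intro power_increasing) auto
    then show "real (num_divisors n) \<le> B ^ P * real n powr \<eta>"
      using main[OF n] by (meson mult_right_mono order_trans powr_ge_zero)
  qed
qed

text \<open>
  In Gauss's identity \<open>n = \<Sum> \<phi>(d)\<close> over the divisors \<open>d\<close> of \<open>n\<close>, every summand is at most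
  \<open>\<phi>(n)\<close>.
\<close>

lemma le_totient_mult_num_divisors: "n \<le> totient n * num_divisors n"
proof (cases "n = 0")
  case False
  have "n = (\<Sum>d | d dvd n. totient d)" by (simp add: totient_divisor_sum)
  also have "\<dots> \<le> (\<Sum>d | d dvd n. totient n)"
    using False by (intro sum_mono totient_dvd_mono) auto
  also have "\<dots> = totient n * num_divisors n" by (simp add: num_divisors_def)
  finally show ?thesis .
qed simp

section \<open>Additive characters\<close>

definition add_char :: "nat \<Rightarrow> int \<Rightarrow> complex" where
  "add_char k n = cis (2 * pi * (of_int n / of_nat k))"

lemma add_char_add: "add_char k (m + n) = add_char k m * add_char k n"
  by (simp add: add_char_def cis_mult add_divide_distrib distrib_left)

lemma add_char_0 [simp]: "add_char k 0 = 1"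
  by (simp add: add_char_def)

lemma norm_add_char [simp]: "norm (add_char k n) = 1"
  by (simp add: add_char_def)

lemma cnj_add_char: "cnj (add_char k n) = add_char k (- n)"
  by (simp add: add_char_def cis_cnj)

lemma add_char_power: "add_char k n ^ j = add_char k (int j * n)"
  by (induction j) (simp_all add: add_char_add[symmetric] algebra_simps)

lemma add_char_dvd:
  assumes "int k dvd n" shows "add_char k n = 1"
proof (cases "k = 0")
  case False
  from assms obtain c where "n = int k * c" by blast
  then have "add_char k n = cis (2 * pi * of_int c)" using False by (simp add: add_char_def)
  then show ?thesis by simp
qed (simp add: add_char_def)

lemma add_char_cong:
  assumes "[m = n] (mod int k)" shows "add_char k m = add_char k n"
proof -
  have "add_char k m = add_char k (m - n) * add_char k n"
    by (simp add: add_char_add[symmetric])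
  also have "add_char k (m - n) = 1"
    using assms by (intro add_char_dvd) (simp add: cong_iff_dvd_diff)
  finally show ?thesis by simp
qed

lemma norm_one_minus_cis: "norm (1 - cis \<theta>) = 2 * \<bar>sin (\<theta> / 2)\<bar>"
proof -
  have "(norm (1 - cis \<theta>))\<^sup>2 = (1 - cos \<theta>)\<^sup>2 + (sin \<theta>)\<^sup>2"
    by (simp add: cmod_power2)
  also have "\<dots> = 2 - 2 * cos \<theta>"
    using sin_cos_squared_add[of \<theta>] by (simp add: power2_eq_square algebra_simps)
  also have "\<dots> = (2 * \<bar>sin (\<theta> / 2)\<bar>)\<^sup>2"
    using cos_double_sin[of "\<theta> / 2"] by (simp add: power_mult_distrib)
  finally show ?thesis by (subst (asm) power2_eq_iff_nonneg) auto
qed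

lemma half_le_sin:
  assumes "0 \<le> x" "x \<le> pi / 2" shows "x / 2 \<le> sin x"
proof -
  have "pi \<le> 16 / 5" using pi_approx(2) by (simp add: field_simps)
  then have "x \<le> 8 / 5" using assms by simp
  then have x2: "x * x \<le> 8/5 * (8/5)" using assms by (intro mult_mono) auto
  have "\<bar>sin x - (\<Sum>m<3. sin_coeff m * x ^ m)\<bar> \<le> inverse (fact 3) * \<bar>x\<bar> ^ 3"
    by (rule Maclaurin_sin_bound)
  then have "\<bar>sin x - x\<bar> \<le> x * (x * x) / 6"
    using assms by (simp add: eval_nat_numeral sin_coeff_def fact_numeral)
  moreover have "x * (x * x) \<le> x * (8/5 * (8/5))"
    using x2 assms by (intro mult_left_mono) auto
  ultimately show ?thesis using assms by (simp only: abs_le_iff) linarith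
qed

lemma norm_one_minus_add_char:
  assumes "0 < h" "h < k"
  shows "norm (1 - add_char k (int h)) \<ge> min (real h) (real (k - h)) / real k"
proof -
  have k: "k > 0" using assms by simp
  define x where "x = pi * (real h / real k)"
  have eq: "norm (1 - add_char k (int h)) = 2 * \<bar>sin x\<bar>"
    unfolding add_char_def norm_one_minus_cis x_def by simp
  have *: "2 * \<bar>sin (pi * (real j / real k))\<bar> \<ge> real j / real k" if "2 * j \<le> k" for j
  proof -
    define y where "y = pi * (real j / real k)"
    have "y \<le> pi * (1 / 2)"
      unfolding y_def using that k by (intro mult_left_mono) (auto simp: field_simps)
    then have "y / 2 \<le> sin y"
      by (intro half_le_sin) (auto simp: y_def)
    moreover have "real j / real k \<le> y"
      using mult_right_mono[of 1 pi "real j / real k"] pi_gt3 by (simp add: y_def)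
    ultimately have "real j / real k \<le> 2 * \<bar>sin y\<bar>" by linarith
    then show ?thesis by (simp only: y_def)
  qed
  show ?thesis
  proof (cases "2 * h \<le> k")
    case True
    have "min (real h) (real (k - h)) / real k \<le> real h / real k"
      by (intro divide_right_mono) auto
    also have "\<dots> \<le> norm (1 - add_char k (int h))"
      using *[OF True] unfolding eq x_def by simp
    finally show ?thesis .
  next
    case False
    have "pi * (real (k - h) / real k) = pi - x"
      using assms k unfolding x_def by (simp add: of_nat_diff field_simps)
    then have "real (k - h) / real k \<le> norm (1 - add_char k (int h))"
      using *[of "k - h"] False assms unfolding eq by simp
    moreover have "min (real h) (real (k - h)) / real k \<le> real (k - h) / real k"
      by (intro divide_right_mono) auto
    ultimately show ?thesis by linarith
  qed
qed

lemma sum_add_char: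
  assumes "k > 0"
  shows "(\<Sum>h<k. add_char k (int h * n)) = (if int k dvd n then of_nat k else 0)"
proof (cases "int k dvd n")
  case True
  then show ?thesis by (simp add: add_char_dvd)
next
  case False
  define z where "z = add_char k n"
  have zk: "z ^ k = 1"
    unfolding z_def add_char_power by (rule add_char_dvd) simp
  have "z \<noteq> 1"
  proof
    assume "z = 1"
    then obtain c :: int where "2 * pi * (of_int n / of_nat k) = of_int c * (2 * pi)"
      unfolding z_def add_char_def cis_conv_exp exp_eq_1
      by (auto simp: complex_eq_iff)
    then have "real_of_int n = real_of_int (c * int k)"
      using assms by (simp add: field_simps)
    then have "n = c * int k" by (simp only: of_int_eq_iff)
    with False show False by simp
  qed
  then have "(\<Sum>h<k. z ^ h) = 0" using geometric_sum[of z k] zk by simp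
  then show ?thesis using False by (simp add: z_def add_char_power)
qed

text \<open>
  A geometric sum with ratio \<open>z\<close> on the unit circle is at most \<open>2/\<bar>1 - z\<bar>\<close>. The bound is
  symmetric under \<open>h \<mapsto> k - h\<close>, as conjugation requires.
\<close>

lemma norm_sum_add_char_le:
  assumes "0 < h" "h < k"
  shows "norm (\<Sum>a=1..X. add_char k (- (int h * int a))) \<le> 2 * (real k / real h + real k / real (k - h))"
proof -
  define z where "z = add_char k (int h)"
  have pos: "min (real h) (real (k - h)) / real k > 0" using assms by simp
  have nz: "norm (1 - z) > 0"
    using norm_one_minus_add_char[OF assms] pos unfolding z_def by linarith
  have "norm (\<Sum>a=1..X. add_char k (- (int h * int a))) = norm (\<Sum>a=1..X. z ^ a)"
  proof -
    have "(\<Sum>a=1..X. add_char k (- (int h * int a))) = cnj (\<Sum>a=1..X. z ^ a)"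
      unfolding z_def add_char_power by (simp add: cnj_add_char mult.commute)
    then show ?thesis by (simp only: complex_mod_cnj)
  qed
  also have "\<dots> = norm ((1 - z) * (\<Sum>a=1..X. z ^ a)) / norm (1 - z)"
    using nz by (simp add: norm_mult)
  also have "(1 - z) * (\<Sum>a=1..X. z ^ a) = (if X = 0 then 0 else z - z ^ Suc X)"
    using sum_gp_multiplied[of 1 X z] by (cases X) auto
  also have "norm (if X = 0 then 0 else z - z ^ Suc X) \<le> 2"
  proof -
    have "norm (z - z ^ Suc X) \<le> norm z + norm (z ^ Suc X)" by (rule norm_triangle_ineq4)
    also have "\<dots> = 2" by (simp add: z_def norm_power norm_mult)
    finally show ?thesis by auto
  qed
  then have "norm (if X = 0 then 0 else z - z ^ Suc X) / norm (1 - z)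
      \<le> 2 / (min (real h) (real (k - h)) / real k)"
    using norm_one_minus_add_char[OF assms] pos unfolding z_def
    by (intro frac_le) (simp_all only: zero_le_numeral)
  also have "\<dots> \<le> 2 * (real k / real h + real k / real (k - h))"
    using assms by (auto simp: min_def)
  finally show ?thesis .
qed

text \<open>Orthogonality of the additive characters turns a mean square into a count.\<close>

lemma parseval_two_variables:
  fixes u v :: "'a \<Rightarrow> int"
  assumes "finite P" "k > 0"
  shows "(\<Sum>h<k. \<Sum>m<k. (norm (\<Sum>p\<in>P. add_char k (int h * u p + int m * v p)))\<^sup>2) =
    real (k\<^sup>2 * card {(p, p') \<in> P \<times> P. int k dvd u p - u p' \<and> int k dvd v p - v p'})"
proof -
  let ?S = "\<lambda>h m. \<Sum>p\<in>P. add_char k (int h * u p + int m * v p)"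
  have sq: "complex_of_real ((norm (?S h m))\<^sup>2) =
      (\<Sum>(p, p')\<in>P \<times> P. add_char k (int h * (u p - u p')) * add_char k (int m * (v p - v p')))" for h m
  proof -
    have "complex_of_real ((norm (?S h m))\<^sup>2) = ?S h m * cnj (?S h m)"
      by (rule complex_norm_square)
    also have "\<dots> = (\<Sum>p\<in>P. \<Sum>p'\<in>P. add_char k (int h * u p + int m * v p) * cnj (add_char k (int h * u p' + int m * v p')))"
      by (simp add: sum_product)
    also have "\<dots> = (\<Sum>p\<in>P. \<Sum>p'\<in>P. add_char k (int h * (u p - u p')) * add_char k (int m * (v p - v p')))"
      by (intro sum.cong refl) (simp add: cnj_add_char add_char_add[symmetric] algebra_simps)
    finally show ?thesis by (simp add: sum.cartesian_product)
  qed
  have "complex_of_real (\<Sum>h<k. \<Sum>m<k. (norm (?S h m))\<^sup>2) =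
      (\<Sum>h<k. \<Sum>m<k. \<Sum>(p, p')\<in>P \<times> P. add_char k (int h * (u p - u p')) * add_char k (int m * (v p - v p')))"
    unfolding of_real_sum sq ..
  also have "\<dots> = (\<Sum>(p, p')\<in>P \<times> P. (\<Sum>h<k. add_char k (int h * (u p - u p'))) * (\<Sum>m<k. add_char k (int m * (v p - v p'))))"
    apply (subst sum.swap[of _ "P \<times> P"])
    apply (subst sum.swap[of _ "P \<times> P"])
    by (simp add: sum_product case_prod_unfold)
  also have "\<dots> = (\<Sum>(p, p')\<in>P \<times> P. if int k dvd u p - u p' \<and> int k dvd v p - v p' then of_nat (k\<^sup>2) else 0)"
    by (intro sum.cong refl) (auto simp: sum_add_char[OF assms(2)] power2_eq_square)
  also have "\<dots> = (\<Sum>(p, p')\<in>{(p, p') \<in> P \<times> P. int k dvd u p - u p' \<and> int k dvd v p - v p'}. of_nat (k\<^sup>2))"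
    using assms(1) by (intro sum.mono_neutral_cong_right) (auto split: if_splits)
  also have "\<dots> = of_nat (k\<^sup>2 * card {(p, p') \<in> P \<times> P. int k dvd u p - u p' \<and> int k dvd v p - v p'})"
    by (simp add: case_prod_unfold)
  finally have "complex_of_real (\<Sum>h<k. \<Sum>m<k. (norm (?S h m))\<^sup>2) =
      complex_of_real (real (k\<^sup>2 * card {(p, p') \<in> P \<times> P. int k dvd u p - u p' \<and> int k dvd v p - v p'}))"
    by (simp only: of_real_of_nat_eq)
  then show ?thesis by (simp only: of_real_eq_iff)
qed

section \<open>Kloosterman sums\<close>

definition hyperbola_mod :: "nat \<Rightarrow> int \<Rightarrow> (int \<times> int) set" where
  "hyperbola_mod k \<sigma> = {(x, y). x \<in> {0..<int k} \<and> y \<in> {0..<int k} \<and> [x * y = \<sigma>] (mod int k)}"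

text \<open>
  Summing over the pairs \<open>(x, y)\<close> with \<open>x y \<equiv> \<sigma>\<close> instead of over \<open>x\<close> alone avoids a modular
  inverse in the phase; for \<open>\<sigma> = 1\<close> this is the classical Kloosterman sum.
\<close>

definition kloosterman :: "nat \<Rightarrow> int \<Rightarrow> int \<Rightarrow> int \<Rightarrow> complex" where
  "kloosterman k \<sigma> h m = (\<Sum>(x, y)\<in>hyperbola_mod k \<sigma>. add_char k (h * x + m * y))"

lemma finite_hyperbola_mod [simp]: "finite (hyperbola_mod k \<sigma>)"
  by (rule finite_subset[of _ "{0..<int k} \<times> {0..<int k}"]) (auto simp: hyperbola_mod_def)

lemma hyperbola_mod_coprime:
  assumes "(x, y) \<in> hyperbola_mod k \<sigma>" "coprime \<sigma> (int k)"
  shows "coprime x (int k)" "coprime y (int k)"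
proof -
  have "[\<sigma> = x * y] (mod int k)" using assms by (auto simp: hyperbola_mod_def cong_sym)
  then have "coprime (x * y) (int k)" using assms(2) cong_imp_coprime by blast
  then show "coprime x (int k)" "coprime y (int k)" by auto
qed

lemma hyperbola_mod_fst_inj:
  assumes "(x, y) \<in> hyperbola_mod k \<sigma>" "(x, y') \<in> hyperbola_mod k \<sigma>" "coprime \<sigma> (int k)"
  shows "y = y'"
proof -
  have "[x * y = \<sigma>] (mod int k)" "[x * y' = \<sigma>] (mod int k)"
    using assms by (auto simp: hyperbola_mod_def)
  then have "[x * y = x * y'] (mod int k)" using cong_sym cong_trans by blast
  then have "[y = y'] (mod int k)"
    using cong_mult_lcancel[of x "int k" y y'] hyperbola_mod_coprime[OF assms(1,3)] by simp
  then show ?thesis using assms by (auto simp: hyperbola_mod_def cong_def)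
qed

lemma card_hyperbola_mod:
  assumes "coprime \<sigma> (int k)" "k > 0"
  shows "card (hyperbola_mod k \<sigma>) = totient k"
proof -
  let ?f = "\<lambda>(x::int, y::int). if x = 0 then k else nat x"
  have "bij_betw ?f (hyperbola_mod k \<sigma>) (totatives k)"
    unfolding bij_betw_def
  proof
    show "inj_on ?f (hyperbola_mod k \<sigma>)"
    proof (rule inj_onI)
      fix p q assume pq: "p \<in> hyperbola_mod k \<sigma>" "q \<in> hyperbola_mod k \<sigma>" "?f p = ?f q"
      obtain x y x' y' where p: "p = (x, y)" and q: "q = (x', y')" by (cases p, cases q)
      have r: "0 \<le> x" "x < int k" "0 \<le> x'" "x' < int k"
        using pq unfolding p q hyperbola_mod_def by auto
      have "x = x'" using pq(3) r unfolding p q by (auto split: if_splits)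
      then show "p = q" using hyperbola_mod_fst_inj[of x y k \<sigma> y'] pq assms unfolding p q by auto
    qed
    show "?f ` hyperbola_mod k \<sigma> = totatives k"
    proof (intro equalityI subsetI)
      fix a assume "a \<in> ?f ` hyperbola_mod k \<sigma>"
      then obtain x y where xy: "(x, y) \<in> hyperbola_mod k \<sigma>" and a: "a = (if x = 0 then k else nat x)" by auto
      have r: "0 \<le> x" "x < int k" using xy by (auto simp: hyperbola_mod_def)
      have c: "coprime x (int k)" using hyperbola_mod_coprime[OF xy assms(1)] by simp
      show "a \<in> totatives k"
      proof (cases "x = 0")
        case True
        then have "k = 1" using c by simp
        then show ?thesis using a True by simp
      next
        case False
        then have "coprime (int (nat x)) (int k)" using c r by simp
        then have "coprime (nat x) k" by (simp only: coprime_int_iff)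
        then show ?thesis using a False r by (simp add: in_totatives_iff)
      qed
    next
      fix a assume a: "a \<in> totatives k"
      then have a': "a > 0" "a \<le> k" "coprime (int a) (int k)" by (auto simp: in_totatives_iff)
      then obtain z where z: "[int a * z = 1] (mod int k)" using cong_solve_coprime_int by blast
      define x where "x = int a mod int k"
      define y where "y = (z * \<sigma>) mod int k"
      have "[x * y = int a * (z * \<sigma>)] (mod int k)"
        unfolding x_def y_def by (simp add: cong_def mod_mult_eq)
      moreover have "[int a * z * \<sigma> = 1 * \<sigma>] (mod int k)" using z by (rule cong_scalar_right)
      ultimately have "[x * y = \<sigma>] (mod int k)" by (metis cong_trans mult.assoc mult_1)
      then have in_h: "(x, y) \<in> hyperbola_mod k \<sigma>"
        using assms(2) by (auto simp: hyperbola_mod_def x_def y_def)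
      have fa: "?f (x, y) = a"
      proof (cases "a = k")
        case False
        then have "x = int a" using a' unfolding x_def by auto
        then show ?thesis using a' by simp
      qed (simp add: x_def)
      show "a \<in> ?f ` hyperbola_mod k \<sigma>"
        by (rule image_eqI[where f = ?f, OF fa[symmetric] in_h]) 

    qed
  qed
  then show ?thesis unfolding totient_def by (rule bij_betw_same_card)
qed

lemma kloosterman_cong:
  assumes "[h = h'] (mod int k)" "[m = m'] (mod int k)"
  shows "kloosterman k \<sigma> h m = kloosterman k \<sigma> h' m'"
  unfolding kloosterman_def
proof (intro sum.cong refl, clarify)
  fix x y
  have "[h * x + m * y = h' * x + m' * y] (mod int k)"
    by (intro cong_add cong_scalar_right assms)
  then show "add_char k (h * x + m * y) = add_char k (h' * x + m' * y)"
    by (rule add_char_cong)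
qed

lemma kloosterman_swap: "kloosterman k \<sigma> h m = kloosterman k \<sigma> m h"
  unfolding kloosterman_def
  by (rule sum.reindex_bij_witness[of _ prod.swap prod.swap])
     (auto simp: hyperbola_mod_def mult.commute add.commute)

text \<open>The hyperbola \<open>x y \<equiv> \<sigma>\<close> is invariant under \<open>(x, y) \<mapsto> (u x, u\<^sup>-\<^sup>1 y)\<close>.\<close>

lemma kloosterman_scale:
  assumes "(u, v) \<in> hyperbola_mod k 1"
  shows "kloosterman k \<sigma> (h * u) (m * v) = kloosterman k \<sigma> h m"
proof -
  have uv: "[u * v = 1] (mod int k)" and vu: "[v * u = 1] (mod int k)"
    using assms by (auto simp: hyperbola_mod_def mult.commute)
  have k: "int k > 0" using assms by (auto simp: hyperbola_mod_def)
  have inv_scale: "(b * (a * x mod int k)) mod int k = x" if "[a * b = 1] (mod int k)" "0 \<le> x" "x < int k" for a b x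
  proof -
    have "[b * (a * x mod int k) = (a * b) * x] (mod int k)"
      by (simp add: cong_def mod_mult_right_eq ac_simps)
    also have "[(a * b) * x = 1 * x] (mod int k)" using that(1) by (rule cong_scalar_right)
    finally show ?thesis using that by (simp add: cong_def)
  qed
  have mem: "((a * x) mod int k, (b * y) mod int k) \<in> hyperbola_mod k \<sigma>"
    if "[a * b = 1] (mod int k)" "(x, y) \<in> hyperbola_mod k \<sigma>" for a b x y
  proof -
    have "[(a * x mod int k) * (b * y mod int k) = (a * b) * (x * y)] (mod int k)"
      by (simp add: cong_def mod_mult_eq ac_simps)
    also have "[(a * b) * (x * y) = 1 * \<sigma>] (mod int k)"
      using that by (intro cong_mult) (auto simp: hyperbola_mod_def)
    finally show ?thesis using k by (simp add: hyperbola_mod_def)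
  qed
  let ?i = "\<lambda>(x, y). ((v * x) mod int k, (u * y) mod int k)"
  let ?j = "\<lambda>(x, y). ((u * x) mod int k, (v * y) mod int k)"
  show ?thesis unfolding kloosterman_def
  proof (rule sum.reindex_bij_witness[of _ ?i ?j])
    fix p assume p: "p \<in> hyperbola_mod k \<sigma>"
    obtain x y where xy: "p = (x, y)" by (cases p)
    have r: "0 \<le> x" "x < int k" "0 \<le> y" "y < int k" using p unfolding xy hyperbola_mod_def by auto
    show "?i (?j p) = p" using inv_scale[OF uv] inv_scale[OF vu] r by (simp add: xy)
    show "?j (?i p) = p" using inv_scale[OF uv] inv_scale[OF vu] r by (simp add: xy)
    show "?j p \<in> hyperbola_mod k \<sigma>" using mem[OF uv] p by (simp add: xy)
    show "?i p \<in> hyperbola_mod k \<sigma>" using mem[OF vu] p by (simp add: xy)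
    show "(case ?j p of (x, y) \<Rightarrow> add_char k (h * x + m * y)) =
       (case p of (x, y) \<Rightarrow> add_char k (h * u * x + m * v * y))"
    proof -
      have "[h * (u * x mod int k) + m * (v * y mod int k) = h * u * x + m * v * y] (mod int k)"
        unfolding mult.assoc by (intro cong_add cong_mult) (auto simp: cong_def)
      then show ?thesis by (simp add: xy add_char_cong)
    qed
  qed
qed

lemma card_dvd_interval:
  assumes "d dvd k" "k > 0"
  shows "card {a \<in> {0..<int k}. int d dvd a} = k div d"
proof -
  have d: "d > 0" using assms by (metis dvd_pos_nat)
  obtain e where e: "k = d * e" using assms by blast
  have "{a \<in> {0..<int k}. int d dvd a} = (\<lambda>j. int d * j) ` {0..<int e}"
  proof (intro equalityI subsetI)
    fix a assume "a \<in> {a \<in> {0..<int k}. int d dvd a}"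
    then obtain j where j: "a = int d * j" and a: "0 \<le> a" "a < int k" by (auto elim!: dvdE)
    then have "0 \<le> j" "j < int e" using d by (auto simp: e zero_le_mult_iff)
    then show "a \<in> (\<lambda>j. int d * j) ` {0..<int e}" using j by (intro image_eqI[of _ _ j]) auto
  qed (use d in \<open>auto simp: e\<close>)
  moreover have "inj_on (\<lambda>j. int d * j) {0..<int e}" using d by (auto simp: inj_on_def)
  ultimately have "card {a \<in> {0..<int k}. int d dvd a} = e" by (simp add: card_image)
  then show ?thesis using e d by simp
qed

lemma zdiv_less_of_less_mult:
  fixes u g w :: int
  assumes "u < g * w" "w > 0" shows "u div w < g"
proof (rule ccontr)
  assume "\<not> u div w < g"
  then have "g * w \<le> u div w * w" using assms(2) by (intro mult_right_mono) auto
  also have "\<dots> \<le> u" using assms(2) by (simp add: minus_mod_eq_div_mult [symmetric])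
  finally show False using assms(1) by simp
qed

lemma div_div_eq_self:
  fixes g k :: nat
  assumes "g dvd k" "k > 0" shows "k div (k div g) = g"
proof -
  obtain c where c: "k = g * c" using assms(1) by blast
  then have "g > 0" "c > 0" using assms(2) by auto
  then show ?thesis by (simp add: c)
qed

lemma dvd_gcd_mult:
  fixes k a x :: int
  assumes "k dvd a * x" shows "k dvd gcd a k * x"
proof -
  obtain u v where uv: "u * a + v * k = gcd a k" using bezout_int by blast
  have "gcd a k * x = u * (a * x) + k * (v * x)" by (simp flip: uv add: algebra_simps)
  then show ?thesis using assms by simp
qed

text \<open>
  If \<open>k\<close> divides \<open>a b c\<close>, put \<open>d = gcd(a, k)\<close> and \<open>e = gcd(b, k)\<close>; then \<open>k / gcd(k, d e)\<close> divides
  \<open>c\<close>. Each of the \<open>\<tau>(k)\<^sup>2\<close> pairs \<open>(d, e)\<close> accounts for at most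
  \<open>(k/d) (k/e) (d e) = k\<^sup>2\<close> triples.
\<close>

lemma card_triple_product_le:
  assumes "k > 0"
  shows "card {(a, b, c). a \<in> {0..<int k} \<and> b \<in> {0..<int k} \<and> c \<in> {0..<int k} \<and> int k dvd a * b * c}
    \<le> (num_divisors k)\<^sup>2 * k\<^sup>2" (is "card ?T \<le> _")
proof -
  let ?M = "\<lambda>d. {a \<in> {0..<int k}. int d dvd a}"
  let ?g = "\<lambda>d e. gcd k (d * e)"
  let ?D = "{d. d dvd k}"
  let ?B = "\<lambda>d e. ?M d \<times> ?M e \<times> ?M (k div ?g d e)"
  have finD: "finite ?D" using assms by (simp add: finite_divisors_nat)
  have sub: "?T \<subseteq> (\<Union>(d, e) \<in> ?D \<times> ?D. ?B d e)"
  proof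
    fix t assume "t \<in> ?T"
    then obtain a b c where t: "t = (a, b, c)" and r: "a \<in> {0..<int k}" "b \<in> {0..<int k}" "c \<in> {0..<int k}"
      and dv: "int k dvd a * b * c" by auto
    define d where "d = nat (gcd a (int k))"
    define e where "e = nat (gcd b (int k))"
    have id: "int d = gcd a (int k)" and ie: "int e = gcd b (int k)" by (auto simp: d_def e_def)
    have 1: "int k dvd int d * b * c"
      using dvd_gcd_mult[of "int k" a "b * c"] dv by (simp add: id mult.assoc)
    have 2: "int k dvd int (d * e) * c"
      using dvd_gcd_mult[of "int k" b "int d * c"] 1 by (simp add: ie ac_simps)
    have 3: "int k dvd int (?g d e) * c"
      using dvd_gcd_mult[OF 2] by (simp only: gcd_int_int_eq gcd.commute)
    have gp: "?g d e > 0" using assms by simp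
    have "int (?g d e) * int (k div ?g d e) = int k"
      by (simp flip: of_nat_mult)
    then have "int (k div ?g d e) dvd c" using 3 gp
      by (metis dvd_mult_cancel_left of_nat_0_less_iff less_irrefl)
    moreover have "d dvd k" "e dvd k"
      by (simp_all flip: int_dvd_int_iff add: id ie)
    moreover have "int d dvd a" "int e dvd b" by (simp_all add: id ie)
    ultimately show "t \<in> (\<Union>(d, e) \<in> ?D \<times> ?D. ?B d e)" using r unfolding t by auto
  qed
  have finM: "finite (?M d)" for d by (rule finite_subset[of _ "{0..<int k}"]) auto
  have cB: "card (?B d e) \<le> k\<^sup>2" if "d dvd k" "e dvd k" for d e
  proof -
    have g: "?g d e dvd k" by simp
    then have g': "k div ?g d e dvd k" by (metis dvd_div_mult_self dvd_triv_left)
    have "card (?B d e) = (k div d) * ((k div e) * (k div (k div ?g d e)))"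
      unfolding card_cartesian_product
      using card_dvd_interval[OF that(1) assms] card_dvd_interval[OF that(2) assms]
        card_dvd_interval[OF g' assms] by (simp only:)
    also have "k div (k div ?g d e) = ?g d e" by (rule div_div_eq_self[OF g assms])
    also have "(k div d) * ((k div e) * ?g d e) \<le> (k div d) * ((k div e) * (d * e))"
      using that assms by (intro mult_le_mono le_refl) (auto intro!: gcd_le2_nat simp: dvd_pos_nat)
    also have "\<dots> = ((k div d) * d) * ((k div e) * e)" by simp
    also have "\<dots> = k\<^sup>2" using that by (simp add: power2_eq_square)
    finally show ?thesis .
  qed
  have finU: "finite (\<Union>(d, e) \<in> ?D \<times> ?D. ?B d e)"
    unfolding case_prod_beta by (intro finite_UN_I finite_cartesian_product finD finM)
  have "card ?T \<le> card (\<Union>(d, e) \<in> ?D \<times> ?D. ?B d e)"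
    using finU by (rule card_mono[OF _ sub])
  also have "\<dots> \<le> (\<Sum>p\<in>?D \<times> ?D. card (case p of (d, e) \<Rightarrow> ?B d e))"
    by (intro card_UN_le finite_cartesian_product finD)
  also have "\<dots> \<le> (\<Sum>p\<in>?D \<times> ?D. k\<^sup>2)"
  proof (rule sum_mono)
    fix p assume "p \<in> ?D \<times> ?D"
    then obtain d e where p: "p = (d, e)" "d dvd k" "e dvd k" by blast
    show "card (case p of (d, e) \<Rightarrow> ?B d e) \<le> k\<^sup>2"
      unfolding p(1) prod.case by (rule cB[OF p(2,3)])
  qed
  also have "\<dots> = (num_divisors k)\<^sup>2 * k\<^sup>2"
    by (simp add: num_divisors_def card_cartesian_product power2_eq_square)
  finally show ?thesis .
qed

text \<open>
  Eliminating the inverses and \<open>x\<^sub>4\<close> from \<open>x\<^sub>1 + x\<^sub>2 = x\<^sub>3 + x\<^sub>4\<close> and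
  \<open>1/x\<^sub>1 + 1/x\<^sub>2 = 1/x\<^sub>3 + 1/x\<^sub>4\<close> leaves a product of three linear forms divisible by \<open>k\<close>.
  The three forms determine \<open>2 x\<^sub>1\<close>; the Boolean records in which half of the residue system
  \<open>x\<^sub>1\<close> lies, which makes the map to triples injective.
\<close>

lemma card_additive_quadruples_le:
  assumes "coprime \<sigma> (int k)" "k > 0"
  defines "H \<equiv> hyperbola_mod k \<sigma>"
  shows "card {(p, p') \<in> (H \<times> H) \<times> (H \<times> H).
      int k dvd (fst (fst p) + fst (snd p)) - (fst (fst p') + fst (snd p')) \<and>
      int k dvd (snd (fst p) + snd (snd p)) - (snd (fst p') + snd (snd p'))}
    \<le> 2 * (num_divisors k)\<^sup>2 * k\<^sup>2" (is "card ?Q \<le> _")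
proof -
  let ?T = "{(a, b, c). a \<in> {0..<int k} \<and> b \<in> {0..<int k} \<and> c \<in> {0..<int k} \<and> int k dvd a * b * c}"
  let ?f = "\<lambda>((p1, p2), (p3, p4)). (2 * fst p1 < int k,
     ((fst p1 + fst p2) mod int k, (fst p3 - fst p1) mod int k, (fst p2 - fst p3) mod int k))"
  have finT: "finite ?T"
    by (rule finite_subset[of _ "{0..<int k} \<times> {0..<int k} \<times> {0..<int k}"]) auto
  have eq_of_cong: "x = x'" if "[x = x'] (mod int k)" "0 \<le> x" "x < int k" "0 \<le> x'" "x' < int k" for x x'
    using that by (simp add: cong_def)
  have "card ?Q \<le> card ((UNIV :: bool set) \<times> ?T)"
  proof (rule card_inj_on_le[of ?f])
    show "finite ((UNIV :: bool set) \<times> ?T)" using finT by simp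
    show "?f ` ?Q \<subseteq> UNIV \<times> ?T"
    proof
      fix z assume "z \<in> ?f ` ?Q"
      then obtain x1 y1 x2 y2 x3 y3 x4 y4 where z: "z = ?f (((x1,y1),(x2,y2)),((x3,y3),(x4,y4)))"
        and H: "(x1,y1) \<in> H" "(x2,y2) \<in> H" "(x3,y3) \<in> H" "(x4,y4) \<in> H"
        and d1: "int k dvd (x1 + x2) - (x3 + x4)" and d2: "int k dvd (y1 + y2) - (y3 + y4)"
        by auto
      have h: "[x1 * y1 = \<sigma>] (mod int k)" "[x2 * y2 = \<sigma>] (mod int k)"
        "[x3 * y3 = \<sigma>] (mod int k)" "[x4 * y4 = \<sigma>] (mod int k)"
        using H by (auto simp: H_def hyperbola_mod_def)
      \<comment> \<open>Clearing denominators in \<open>1/x1 + 1/x2 = 1/x3 + 1/x4\<close> and using \<open>x4 = x1 + x2 - x3\<close>.\<close>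
      obtain e1 e2 e3 e4 where e: "x1 * y1 - \<sigma> = int k * e1" "x2 * y2 - \<sigma> = int k * e2"
        "x3 * y3 - \<sigma> = int k * e3" "x4 * y4 - \<sigma> = int k * e4"
        using h unfolding cong_iff_dvd_diff by (elim dvdE) blast
      obtain s t where s: "(x1 + x2) - (x3 + x4) = int k * s" and t: "(y1 + y2) - (y3 + y4) = int k * t"
        using d1 d2 by (elim dvdE) blast
      have x4: "x4 = x1 + x2 - x3 - int k * s" using s by simp
      have "\<sigma> * ((x1 + x2) * (x3 * x4 - x1 * x2)) =
          x3 * x4 * (x1 * x2) * ((y1 + y2) - (y3 + y4))
          - x3 * x4 * (x2 * (x1 * y1 - \<sigma>) + x1 * (x2 * y2 - \<sigma>))
          + x1 * x2 * (x4 * (x3 * y3 - \<sigma>) + x3 * (x4 * y4 - \<sigma>))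
          - \<sigma> * (x1 * x2) * ((x1 + x2) - (x3 + x4))"
        by (simp add: algebra_simps)
      also have "\<dots> = int k * (x3 * x4 * (x1 * x2) * t - x3 * x4 * (x2 * e1 + x1 * e2)
          + x1 * x2 * (x4 * e3 + x3 * e4) - \<sigma> * (x1 * x2) * s)"
        unfolding e s t by (simp add: algebra_simps)
      finally have "int k dvd \<sigma> * ((x1 + x2) * (x3 * x4 - x1 * x2))" by simp
      then have "int k dvd (x1 + x2) * (x3 * x4 - x1 * x2)"
        using assms(1) by (simp add: coprime_commute coprime_dvd_mult_right_iff)
      moreover have "(x1 + x2) * (x3 * x4 - x1 * x2) =
          (x1 + x2) * (x3 - x1) * (x2 - x3) - int k * ((x1 + x2) * x3 * s)"
        unfolding x4 by (simp add: algebra_simps)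
      ultimately have "int k dvd (x1 + x2) * (x3 - x1) * (x2 - x3)"
        by (metis dvd_triv_left zdvd_zdiffD)
      moreover have "[(x1 + x2) mod int k * ((x3 - x1) mod int k) * ((x2 - x3) mod int k)
          = (x1 + x2) * (x3 - x1) * (x2 - x3)] (mod int k)"
        by (intro cong_mult) (auto simp: cong_def)
      ultimately have "int k dvd ((x1 + x2) mod int k) * ((x3 - x1) mod int k) * ((x2 - x3) mod int k)"
        using cong_dvd_iff by blast
      then show "z \<in> UNIV \<times> ?T" unfolding z using assms(2) by auto
    qed
    show "inj_on ?f ?Q"
    proof (rule inj_onI)
      fix p q assume pq: "p \<in> ?Q" "q \<in> ?Q" "?f p = ?f q"
      obtain x1 y1 x2 y2 x3 y3 x4 y4 where p: "p = (((x1,y1),(x2,y2)),((x3,y3),(x4,y4)))"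
        by (metis surj_pair)
      obtain x1' y1' x2' y2' x3' y3' x4' y4' where q: "q = (((x1',y1'),(x2',y2')),((x3',y3'),(x4',y4')))"
        by (metis surj_pair)
      have Hp: "(x1,y1) \<in> H" "(x2,y2) \<in> H" "(x3,y3) \<in> H" "(x4,y4) \<in> H" "int k dvd (x1 + x2) - (x3 + x4)"
        using pq(1) unfolding p by auto
      have Hq: "(x1',y1') \<in> H" "(x2',y2') \<in> H" "(x3',y3') \<in> H" "(x4',y4') \<in> H" "int k dvd (x1' + x2') - (x3' + x4')"
        using pq(2) unfolding q by auto
      have rp: "0 \<le> x1" "x1 < int k" "0 \<le> x2" "x2 < int k" "0 \<le> x3" "x3 < int k" "0 \<le> x4" "x4 < int k"
        using Hp by (auto simp: H_def hyperbola_mod_def)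
      have rq: "0 \<le> x1'" "x1' < int k" "0 \<le> x2'" "x2' < int k" "0 \<le> x3'" "x3' < int k" "0 \<le> x4'" "x4' < int k"
        using Hq by (auto simp: H_def hyperbola_mod_def)
      have b: "(2 * x1 < int k) = (2 * x1' < int k)" using pq(3) unfolding p q by simp
      have c: "[x1 + x2 = x1' + x2'] (mod int k)" "[x3 - x1 = x3' - x1'] (mod int k)"
        "[x2 - x3 = x2' - x3'] (mod int k)"
        using pq(3) unfolding p q by (simp_all only: case_prod_conv prod.inject fst_conv snd_conv cong_def)
      have "[(x1 + x2) - (x3 - x1) - (x2 - x3) = (x1' + x2') - (x3' - x1') - (x2' - x3')] (mod int k)"
        by (rule cong_diff[OF cong_diff[OF c(1) c(2)] c(3)])
      then have "[2 * x1 = 2 * x1'] (mod int k)" by (simp add: algebra_simps)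
      then have "int k dvd 2 * x1 - 2 * x1'" by (simp add: cong_iff_dvd_diff)
      moreover have "\<bar>2 * x1 - 2 * x1'\<bar> < int k" using b rp rq by linarith
      ultimately have "2 * x1 - 2 * x1' = 0" using dvd_imp_le_int[of "2 * x1 - 2 * x1'" "int k"] by fastforce
      then have x1: "x1 = x1'" by simp
      have "[x3 - x1 + x1 = x3' - x1' + x1'] (mod int k)" using c x1 by (intro cong_add) auto
      then have x3: "x3 = x3'" using rp rq by (intro eq_of_cong) auto
      have "[x1 + x2 - x1 = x1' + x2' - x1'] (mod int k)" using c x1 by (intro cong_diff) auto
      then have x2: "x2 = x2'" using rp rq by (intro eq_of_cong) auto
      have "[x4 = x1 + x2 - x3] (mod int k)" "[x4' = x1 + x2 - x3] (mod int k)"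
        using Hp(5) Hq(5) x1 x2 x3 by (auto simp: cong_iff_dvd_diff algebra_simps dvd_diff_commute)
      then have "[x4 = x4'] (mod int k)" by (meson cong_sym cong_trans)
      then have x4: "x4 = x4'" using rp rq by (intro eq_of_cong) auto
      show "p = q"
        using Hp Hq hyperbola_mod_fst_inj assms(1) unfolding p q x1 x2 x3 x4 H_def by blast
    qed
  qed
  also have "\<dots> = 2 * card ?T" by (simp add: card_cartesian_product)
  also have "\<dots> \<le> 2 * ((num_divisors k)\<^sup>2 * k\<^sup>2)"
    using card_triple_product_le[OF assms(2)] by simp
  finally show ?thesis by (simp add: mult.assoc)
qed

lemma kloosterman_fourth_moment:
  assumes "coprime \<sigma> (int k)" "k > 0"
  shows "(\<Sum>h<k. \<Sum>m<k. norm (kloosterman k \<sigma> (int h) (int m)) ^ 4)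
    \<le> 2 * real (num_divisors k) ^ 2 * real k ^ 4"
proof -
  let ?H = "hyperbola_mod k \<sigma>"
  let ?u = "\<lambda>p :: (int \<times> int) \<times> (int \<times> int). fst (fst p) + fst (snd p)"
  let ?v = "\<lambda>p :: (int \<times> int) \<times> (int \<times> int). snd (fst p) + snd (snd p)"
  have sq: "(kloosterman k \<sigma> h m)\<^sup>2 = (\<Sum>p\<in>?H \<times> ?H. add_char k (h * ?u p + m * ?v p))" for h m
  proof -
    have "(kloosterman k \<sigma> h m)\<^sup>2 = (\<Sum>p\<in>?H. \<Sum>q\<in>?H. add_char k (h * fst p + m * snd p) * add_char k (h * fst q + m * snd q))"
      unfolding kloosterman_def power2_eq_square by (simp add: sum_product case_prod_unfold)
    also have "\<dots> = (\<Sum>p\<in>?H. \<Sum>q\<in>?H. add_char k (h * (fst p + fst q) + m * (snd p + snd q)))"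
      by (intro sum.cong refl) (simp add: add_char_add[symmetric] algebra_simps)
    finally show ?thesis by (simp add: sum.cartesian_product case_prod_unfold)
  qed
  have "(\<Sum>h<k. \<Sum>m<k. norm (kloosterman k \<sigma> (int h) (int m)) ^ 4) =
      (\<Sum>h<k. \<Sum>m<k. (norm ((kloosterman k \<sigma> (int h) (int m))\<^sup>2))\<^sup>2)"
    by (simp add: norm_power flip: power_mult)
  also have "\<dots> = real (k\<^sup>2 * card {(p, p') \<in> (?H \<times> ?H) \<times> (?H \<times> ?H). int k dvd ?u p - ?u p' \<and> int k dvd ?v p - ?v p'})"
    unfolding sq by (rule parseval_two_variables) (use assms in auto)
  also have "\<dots> \<le> real (k\<^sup>2 * (2 * (num_divisors k)\<^sup>2 * k\<^sup>2))"
    using card_additive_quadruples_le[OF assms] by (intro of_nat_mono mult_le_mono2) simp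
  also have "\<dots> = 2 * real (num_divisors k) ^ 2 * real k ^ 4"
    by (simp add: power2_eq_square eval_nat_numeral)
  finally show ?thesis .
qed

text \<open>
  The solutions \<open>u\<close> of \<open>h u \<equiv> z\<close> modulo \<open>k\<close> lie in a single class modulo \<open>k / gcd h k\<close>.
\<close>

lemma card_scale_fibre_le:
  assumes "k > 0"
  shows "card {p \<in> hyperbola_mod k 1. ((h * fst p) mod int k, (m * snd p) mod int k) = z} \<le> nat (gcd h (int k))"
    (is "card ?S \<le> _")
proof -
  define g where "g = gcd h (int k)"
  define w where "w = int k div g"
  have g: "g > 0" using assms by (simp add: g_def)
  have gw: "int k = g * w" by (simp add: w_def g_def)
  have w: "w > 0" using gw g assms by (metis of_nat_0_less_iff zero_less_mult_pos)
  have hw: "coprime (h div g) w"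
    unfolding w_def g_def using assms by (intro div_gcd_coprime) auto
  have "card ?S \<le> card {0..<g}"
  proof (rule card_inj_on_le[of "\<lambda>p. fst p div w"])
    show "(\<lambda>p. fst p div w) ` ?S \<subseteq> {0..<g}"
    proof
      fix y assume "y \<in> (\<lambda>p. fst p div w) ` ?S"
      then obtain u v where uv: "(u, v) \<in> hyperbola_mod k 1" "y = u div w" by auto
      have "0 \<le> u" "u < g * w" using uv gw by (auto simp: hyperbola_mod_def)
      then show "y \<in> {0..<g}" using w zdiv_less_of_less_mult[of u g w] by (simp add: uv pos_imp_zdiv_nonneg_iff)
    qed
    show "inj_on (\<lambda>p. fst p div w) ?S"
    proof (rule inj_onI)
      fix p q assume pq: "p \<in> ?S" "q \<in> ?S" "fst p div w = fst q div w"
      obtain u v u' v' where p: "p = (u, v)" and q: "q = (u', v')" by (cases p, cases q)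
      have "(h * u) mod int k = (h * u') mod int k" using pq unfolding p q by auto
      then have "int k dvd h * (u - u')" by (simp add: mod_eq_dvd_iff algebra_simps)
      moreover have "h = g * (h div g)" by (simp add: g_def)
      ultimately have "g * w dvd g * ((h div g) * (u - u'))" by (metis gw mult.assoc)
      then have "w dvd (h div g) * (u - u')" using g by simp
      then have "w dvd u - u'" using hw by (simp add: coprime_commute coprime_dvd_mult_right_iff)
      then have "u mod w = u' mod w" by (simp add: mod_eq_dvd_iff)
      then have "u = u'" using pq(3) unfolding p q by (metis fst_conv mult_div_mod_eq)
      then show "p = q" using pq hyperbola_mod_fst_inj[of u v k 1 v'] unfolding p q by auto
    qed
  qed simp
  then show ?thesis by (simp add: g_def)
qed

text \<open>
  The sum is constant along the orbit of \<open>(h, m)\<close> under \<open>(h, m) \<mapsto> (h u, m u\<^sup>-\<^sup>1)\<close>, and no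
  frequency is met by more than \<open>gcd h k\<close> of the \<open>\<phi>(k)\<close> units \<open>u\<close>. So the fourth moment
  contains this one value at least \<open>\<phi>(k) / gcd h k\<close> times.
\<close>

lemma kloosterman_bound_fst:
  assumes "coprime \<sigma> (int k)" "k > 0"
  shows "norm (kloosterman k \<sigma> h m) \<le> 2 * real_of_int (gcd h (int k)) * real (num_divisors k) * real k powr (3/4)"
proof -
  define K where "K = norm (kloosterman k \<sigma> h m)"
  define \<tau> where "\<tau> = real (num_divisors k)"
  define g where "g = gcd h (int k)"
  have g1: "real_of_int g \<ge> 1" using assms unfolding g_def
    by (metis gcd_pos_int int_one_le_iff_zero_less of_int_1_le_iff of_nat_0_less_iff less_irrefl)
  have t1: "\<tau> \<ge> 1" using num_divisors_pos[OF assms(2)] by (simp add: \<tau>_def)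
  let ?f = "\<lambda>z::int \<times> int. norm (kloosterman k \<sigma> (fst z) (snd z)) ^ 4"
  let ?s = "\<lambda>p. ((h * fst p) mod int k, (m * snd p) mod int k)"
  let ?R = "{0..<int k} \<times> {0..<int k}"
  have c1: "card (hyperbola_mod k 1) = totient k" using assms by (intro card_hyperbola_mod) auto
  have val: "?f (?s p) = K ^ 4" if "p \<in> hyperbola_mod k 1" for p
  proof -
    have "kloosterman k \<sigma> (fst (?s p)) (snd (?s p)) = kloosterman k \<sigma> (h * fst p) (m * snd p)"
      by (rule kloosterman_cong) (auto simp: cong_def)
    also have "\<dots> = kloosterman k \<sigma> h m" using that by (intro kloosterman_scale) simp
    finally show ?thesis by (simp add: K_def)
  qed
  have "real (totient k) * K ^ 4 = (\<Sum>p\<in>hyperbola_mod k 1. ?f (?s p))"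
    using val c1 by simp
  also have "\<dots> = (\<Sum>z\<in>?R. \<Sum>p\<in>{p \<in> hyperbola_mod k 1. ?s p = z}. ?f (?s p))"
    by (rule sum.group[symmetric]) (use assms in auto)
  also have "\<dots> = (\<Sum>z\<in>?R. real (card {p \<in> hyperbola_mod k 1. ?s p = z}) * ?f z)"
    by (intro sum.cong refl) simp
  also have "\<dots> \<le> (\<Sum>z\<in>?R. real_of_int g * ?f z)"
  proof (intro sum_mono mult_right_mono)
    fix z
    have "card {p \<in> hyperbola_mod k 1. ?s p = z} \<le> nat g"
      unfolding g_def by (rule card_scale_fibre_le[OF assms(2)])
    then show "real (card {p \<in> hyperbola_mod k 1. ?s p = z}) \<le> real_of_int g"
      using g1 by linarith
  qed auto
  also have "\<dots> = real_of_int g * (\<Sum>z\<in>?R. ?f z)" by (simp add: sum_distrib_left)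
  also have "(\<Sum>z\<in>?R. ?f z) = (\<Sum>h<k. \<Sum>m<k. norm (kloosterman k \<sigma> (int h) (int m)) ^ 4)"
  proof -
    have "(\<Sum>z\<in>?R. ?f z) = (\<Sum>z\<in>{..<k} \<times> {..<k}. ?f (int (fst z), int (snd z)))"
      by (rule sum.reindex_bij_witness[of _ "\<lambda>z. (int (fst z), int (snd z))" "\<lambda>z. (nat (fst z), nat (snd z))"]) auto
    then show ?thesis by (simp add: sum.cartesian_product case_prod_unfold)
  qed
  also have "real_of_int g * \<dots> \<le> real_of_int g * (2 * \<tau> ^ 2 * real k ^ 4)"
    using kloosterman_fourth_moment[OF assms] g1 unfolding \<tau>_def by (intro mult_left_mono) auto
  finally have 1: "real (totient k) * K ^ 4 \<le> real_of_int g * (2 * \<tau> ^ 2 * real k ^ 4)" .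
  have "real k \<le> real (totient k) * \<tau>"
    using le_totient_mult_num_divisors[of k] unfolding \<tau>_def by (metis of_nat_le_iff of_nat_mult)
  then have "real k * K ^ 4 \<le> real (totient k) * \<tau> * K ^ 4"
    by (intro mult_right_mono) auto
  also have "\<dots> = \<tau> * (real (totient k) * K ^ 4)" by simp
  also have "\<dots> \<le> \<tau> * (real_of_int g * (2 * \<tau> ^ 2 * real k ^ 4))"
    using 1 t1 by (intro mult_left_mono) auto
  also have "\<dots> = real k * (2 * real_of_int g * \<tau> ^ 3 * real k ^ 3)"
    by (simp add: eval_nat_numeral)
  finally have "K ^ 4 \<le> 2 * real_of_int g * \<tau> ^ 3 * real k ^ 3"
    using assms(2) by simp
  also have "\<dots> \<le> 16 * real_of_int g ^ 4 * \<tau> ^ 4 * real k ^ 3"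
    using g1 t1 power_increasing[of 1 4 "real_of_int g"]
    by (intro mult_mono power_increasing order_refl) auto
  also have "\<dots> = (2 * real_of_int g * \<tau> * real k powr (3/4)) ^ 4"
  proof -
    have "(real k powr (3/4)) ^ 4 = real k powr (real 4 * (3/4))"
      using assms(2) by (intro powr_power) simp
    also have "\<dots> = real k powr real 3" by simp
    also have "\<dots> = real k ^ 3" using assms(2) by (intro powr_realpow) simp
    finally have "(real k powr (3/4)) ^ 4 = real k ^ 3" .
    then show ?thesis by (simp add: power_mult_distrib)
  qed
  finally have "K \<le> 2 * real_of_int g * \<tau> * real k powr (3/4)"
    using g1 t1 by (simp add: power_mono_iff K_def)
  then show ?thesis by (simp add: K_def g_def \<tau>_def)
qed

lemma kloosterman_bound_snd:
  assumes "coprime \<sigma> (int k)" "k > 0"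
  shows "norm (kloosterman k \<sigma> h m) \<le> 2 * real_of_int (gcd m (int k)) * real (num_divisors k) * real k powr (3/4)"
  using kloosterman_bound_fst[OF assms, of m h] by (simp add: kloosterman_swap[of k \<sigma> h m])

section \<open>Modular inverses in boxes\<close>

lemma sum_inverse_le_ln:
  assumes "n > 0"
  shows "(\<Sum>j=1..n. 1 / real j) \<le> 1 + ln (real n)"
  using assms
proof (induction n rule: nat_induct_non_zero)
  case (Suc n)
  have "ln (real n / real (Suc n)) \<le> real n / real (Suc n) - 1"
    using Suc.hyps by (intro ln_le_minus_one) auto
  also have "\<dots> = - (1 / real (Suc n))" by (simp add: field_simps)
  finally have "ln (real n) + 1 / real (Suc n) \<le> ln (real (Suc n))"
    using Suc.hyps by (simp add: ln_div)
  moreover have "(\<Sum>j=1..Suc n. 1 / real j) = (\<Sum>j=1..n. 1 / real j) + 1 / real (Suc n)"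
    by simp
  ultimately show ?case using Suc.IH by linarith
qed simp

text \<open>
  Writing \<open>h = d j\<close> with \<open>d = gcd h k\<close>, the summand is \<open>1/j\<close>; there are \<open>\<tau>(k)\<close> values of \<open>d\<close>.
\<close>

lemma sum_gcd_over_le:
  assumes "k > 0"
  shows "(\<Sum>h\<in>{0<..<k}. real (gcd h k) / real h) \<le> real (num_divisors k) * (1 + ln (real k))"
proof -
  let ?D = "{d. d dvd k}"
  have fin: "finite ?D" using assms by (simp add: finite_divisors_nat)
  have "(\<Sum>h\<in>{0<..<k}. real (gcd h k) / real h) =
      (\<Sum>h\<in>{0<..<k}. case (gcd h k, h div gcd h k) of (d, j) \<Rightarrow> 1 / real j)"
    by (intro sum.cong refl) (auto simp: real_of_nat_div)
  also have "\<dots> = (\<Sum>(d, j)\<in>(\<lambda>h. (gcd h k, h div gcd h k)) ` {0<..<k}. 1 / real j)"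
  proof (subst sum.reindex)
    show "inj_on (\<lambda>h. (gcd h k, h div gcd h k)) {0<..<k}"
      by (rule inj_onI) (metis (no_types, lifting) dvd_mult_div_cancel gcd_dvd1 prod.inject)
  qed (simp add: o_def)
  also have "\<dots> \<le> (\<Sum>(d, j)\<in>?D \<times> {1..k}. 1 / real j)"
  proof (rule sum_mono2)
    show "(\<lambda>h. (gcd h k, h div gcd h k)) ` {0<..<k} \<subseteq> ?D \<times> {1..k}"
    proof
      fix z assume "z \<in> (\<lambda>h. (gcd h k, h div gcd h k)) ` {0<..<k}"
      then obtain h where z: "z = (gcd h k, h div gcd h k)" and h: "0 < h" "h < k" by auto
      have "gcd h k \<le> h" using h by (intro gcd_le1_nat) auto
      then have "1 \<le> h div gcd h k" using h by (simp add: Suc_le_eq div_greater_zero_iff)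
      moreover have "h div gcd h k \<le> k" using h div_le_dividend[of h "gcd h k"] by linarith
      ultimately show "z \<in> ?D \<times> {1..k}" by (simp add: z)
    qed
  qed (use fin in auto)
  also have "\<dots> = real (num_divisors k) * (\<Sum>j=1..k. 1 / real j)"
    by (simp add: sum.cartesian_product[symmetric] num_divisors_def)
  also have "\<dots> \<le> real (num_divisors k) * (1 + ln (real k))"
    using sum_inverse_le_ln[OF assms] by (intro mult_left_mono) auto
  finally show ?thesis .
qed

definition box_count :: "nat \<Rightarrow> int \<Rightarrow> nat \<Rightarrow> nat \<Rightarrow> nat" where
  "box_count k \<sigma> X Y = card {(a, s) \<in> {1..X} \<times> {1..Y}. int k dvd int a * int s - \<sigma>}"

text \<open>
  Both box conditions are detected by additive characters; summing over the points of the
  hyperbola first leaves a Kloosterman sum.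
\<close>

lemma box_count_completion:
  assumes "k > 0"
  shows "of_nat (k\<^sup>2 * box_count k \<sigma> X Y) =
    (\<Sum>h<k. \<Sum>m<k. (\<Sum>a=1..X. add_char k (- (int h * int a))) * (\<Sum>b=1..Y. add_char k (- (int m * int b)))
      * kloosterman k \<sigma> (int h) (int m))"
proof -
  let ?H = "hyperbola_mod k \<sigma>"
  let ?I = "\<lambda>n. if int k dvd n then of_nat k else (0 :: complex)"
  have single: "(\<Sum>(x, y)\<in>?H. ?I (x - int a) * ?I (y - int b)) =
      (if int k dvd int a * int b - \<sigma> then of_nat (k\<^sup>2) else 0)" for a b
  proof -
    let ?p = "(int a mod int k, int b mod int k)"
    have *: "int k dvd x - int a \<longleftrightarrow> x = int a mod int k" if "0 \<le> x" "x < int k" for x a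
      using that by (metis mod_eq_dvd_iff mod_pos_pos_trivial)
    have "(\<Sum>(x, y)\<in>?H. ?I (x - int a) * ?I (y - int b)) =
        (\<Sum>p\<in>?H. if p = ?p then of_nat (k\<^sup>2) else 0)"
    proof (intro sum.cong refl)
      fix p assume p: "p \<in> ?H"
      obtain x y where xy: "p = (x, y)" by (cases p)
      have r: "0 \<le> x" "x < int k" "0 \<le> y" "y < int k" using p by (auto simp: xy hyperbola_mod_def)
      show "(case p of (x, y) \<Rightarrow> ?I (x - int a) * ?I (y - int b)) = (if p = ?p then of_nat (k\<^sup>2) else 0)"
        unfolding xy prod.case *[OF r(1,2)] *[OF r(3,4)] by (simp add: power2_eq_square)
    qed
    also have "\<dots> = (if ?p \<in> ?H then of_nat (k\<^sup>2) else 0)" by simp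
    also have "?p \<in> ?H \<longleftrightarrow> int k dvd int a * int b - \<sigma>"
      unfolding mod_eq_dvd_iff[symmetric] using assms
      by (simp add: hyperbola_mod_def cong_def mod_mult_eq)
    finally show ?thesis .
  qed
  have pair: "(\<Sum>h\<in>A. \<Sum>m\<in>B. f h m) = (\<Sum>z\<in>A \<times> B. f (fst z) (snd z))"
    for A B :: "nat set" and f :: "nat \<Rightarrow> nat \<Rightarrow> complex"
    by (simp add: sum.cartesian_product case_prod_unfold)
  have expand: "(\<Sum>a=1..X. add_char k (- (int h * int a))) * (\<Sum>b=1..Y. add_char k (- (int m * int b))) * kloosterman k \<sigma> (int h) (int m)
      = (\<Sum>a=1..X. \<Sum>b=1..Y. \<Sum>(x, y)\<in>?H. add_char k (int h * (x - int a)) * add_char k (int m * (y - int b)))" for h m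
  proof -
    have "(\<Sum>a=1..X. add_char k (- (int h * int a))) * (\<Sum>b=1..Y. add_char k (- (int m * int b))) * kloosterman k \<sigma> (int h) (int m)
      = (\<Sum>a=1..X. \<Sum>b=1..Y. \<Sum>p\<in>?H. add_char k (- (int h * int a)) * add_char k (- (int m * int b)) * add_char k (int h * fst p + int m * snd p))"
      unfolding kloosterman_def sum_product 
      by (simp add: sum_distrib_right sum_distrib_left case_prod_unfold)
         (intro sum.cong refl, rule sum.swap)
    also have "\<dots> = (\<Sum>a=1..X. \<Sum>b=1..Y. \<Sum>p\<in>?H. add_char k (int h * (fst p - int a)) * add_char k (int m * (snd p - int b)))"
      by (intro sum.cong refl) (simp add: add_char_add[symmetric] algebra_simps)
    finally show ?thesis by (simp add: case_prod_unfold)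
  qed
  have "(\<Sum>h<k. \<Sum>m<k. (\<Sum>a=1..X. add_char k (- (int h * int a))) * (\<Sum>b=1..Y. add_char k (- (int m * int b)))
      * kloosterman k \<sigma> (int h) (int m)) =
    (\<Sum>z\<in>{..<k} \<times> {..<k}. \<Sum>w\<in>{1..X} \<times> {1..Y}. \<Sum>p\<in>?H.
       add_char k (int (fst z) * (fst p - int (fst w))) * add_char k (int (snd z) * (snd p - int (snd w))))"
    unfolding expand by (simp only: pair case_prod_unfold)
  also have "\<dots> = (\<Sum>w\<in>{1..X} \<times> {1..Y}. \<Sum>p\<in>?H. \<Sum>z\<in>{..<k} \<times> {..<k}.
       add_char k (int (fst z) * (fst p - int (fst w))) * add_char k (int (snd z) * (snd p - int (snd w))))"
    by (subst sum.swap, intro sum.cong refl, rule sum.swap)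
  also have "\<dots> = (\<Sum>w\<in>{1..X} \<times> {1..Y}. \<Sum>(x, y)\<in>?H. ?I (x - int (fst w)) * ?I (y - int (snd w)))"
  proof (intro sum.cong refl)
    fix w p
    show "(\<Sum>z\<in>{..<k} \<times> {..<k}.
       add_char k (int (fst z) * (fst p - int (fst w))) * add_char k (int (snd z) * (snd p - int (snd w))))
      = (case p of (x, y) \<Rightarrow> ?I (x - int (fst w)) * ?I (y - int (snd w)))"
      unfolding sum_add_char[OF assms, symmetric] sum_product
      by (simp add: sum.cartesian_product case_prod_unfold)
  qed
  also have "\<dots> = (\<Sum>w\<in>{1..X} \<times> {1..Y}. if int k dvd int (fst w) * int (snd w) - \<sigma> then of_nat (k\<^sup>2) else 0)"
    unfolding single ..
  also have "\<dots> = (\<Sum>w\<in>{(a, s) \<in> {1..X} \<times> {1..Y}. int k dvd int a * int s - \<sigma>}. of_nat (k\<^sup>2))"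
    by (intro sum.mono_neutral_cong_right) auto
  finally show ?thesis by (simp add: box_count_def)
qed

text \<open>
  The frequency \<open>(0, 0)\<close> gives the main term. At every other frequency the Kloosterman sum
  is small, by the bound in terms of whichever of \<open>h\<close> and \<open>m\<close> does not vanish, and the
  geometric sums over the sides of the box cost only logarithms.
\<close>

lemma box_count_discrepancy:
  assumes "coprime \<sigma> (int k)" "k > 0" "X \<le> k" "Y \<le> k"
  shows "\<bar>real (box_count k \<sigma> X Y) - real X * real Y * real (totient k) / real k ^ 2\<bar>
    \<le> 80 * real k powr (3/4) * real (num_divisors k) ^ 2 * (1 + ln (real k)) ^ 2"
proof -
  define \<tau> where "\<tau> = real (num_divisors k)"
  define L where "L = 1 + ln (real k)"
  define D where "D = 2 * \<tau> * real k powr (3/4)"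
  define w where "w = (\<lambda>h. if h = 0 then real k else 2 * (real k / real h + real k / real (k - h)))"
  define A where "A = (\<lambda>X h. \<Sum>a=1..X. add_char k (- (int h * int a)))"
  define F where "F = (\<lambda>h m. A X h * A Y m * kloosterman k \<sigma> (int h) (int m))"
  have L1: "L \<ge> 1" using assms by (simp add: L_def)
  have t0: "\<tau> \<ge> 1" using num_divisors_pos[OF assms(2)] by (simp add: \<tau>_def)
  have D0: "D \<ge> 0" using t0 by (simp add: D_def)
  have w0: "w h \<ge> 0" if "h < k" for h using that by (auto simp: w_def)
  have A_le: "norm (A Z h) \<le> w h" if "h < k" "Z \<le> k" for Z h
    using that norm_sum_add_char_le[of h k Z] by (auto simp: A_def w_def)
  have F_le: "norm (F h m) \<le> w h * w m * (D * real (gcd j k))"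
    if "h < k" "m < k" "j = h \<or> j = m" for h m j
  proof -
    have "norm (kloosterman k \<sigma> (int h) (int m)) \<le> D * real (gcd j k)"
      using kloosterman_bound_fst[OF assms(1,2), of "int h" "int m"]
        kloosterman_bound_snd[OF assms(1,2), of "int h" "int m"] that(3)
      by (auto simp: D_def \<tau>_def mult_ac)
    then show ?thesis
      unfolding F_def norm_mult using that assms w0 A_le
      by (intro mult_mono) auto
  qed
  have gcd_sum: "(\<Sum>h\<in>{0<..<k}. w h * real (gcd h k)) \<le> 4 * real k * (\<tau> * L)"
  proof -
    have refl_sum: "(\<Sum>h\<in>{0<..<k}. real (gcd h k) / real (k - h)) = (\<Sum>h\<in>{0<..<k}. real (gcd h k) / real h)"
    proof (rule sum.reindex_bij_witness[of _ "\<lambda>h. k - h" "\<lambda>h. k - h"])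
      fix h assume h: "h \<in> {0<..<k}"
      then have "gcd (k - h) k = gcd h k"
        by (metis gcd.commute gcd_diff2_nat greaterThanLessThan_iff less_imp_le_nat)
      then show "real (gcd (k - h) k) / real (k - h) = real (gcd h k) / real (k - h)" by simp
    qed auto
    have "(\<Sum>h\<in>{0<..<k}. w h * real (gcd h k)) =
        2 * real k * ((\<Sum>h\<in>{0<..<k}. real (gcd h k) / real h) + (\<Sum>h\<in>{0<..<k}. real (gcd h k) / real (k - h)))"
      unfolding sum.distrib[symmetric] sum_distrib_left
      by (intro sum.cong refl) (simp add: w_def field_simps)
    also have "\<dots> = 4 * real k * (\<Sum>h\<in>{0<..<k}. real (gcd h k) / real h)"
      unfolding refl_sum by simp
    also have "\<dots> \<le> 4 * real k * (\<tau> * L)"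
      using sum_gcd_over_le[OF assms(2)] unfolding \<tau>_def L_def by (intro mult_left_mono) auto
    finally show ?thesis .
  qed
  have w_sum: "(\<Sum>m<k. w m) \<le> 9 * real k * L"
  proof -
    have "(\<Sum>h\<in>{0<..<k}. w h) = 2 * real k * ((\<Sum>h\<in>{0<..<k}. 1 / real h) + (\<Sum>h\<in>{0<..<k}. 1 / real (k - h)))"
      unfolding sum.distrib[symmetric] sum_distrib_left
      by (intro sum.cong refl) (simp add: w_def field_simps)
    also have "(\<Sum>h\<in>{0<..<k}. 1 / real (k - h)) = (\<Sum>h\<in>{0<..<k}. 1 / real h)"
      by (rule sum.reindex_bij_witness[of _ "\<lambda>h. k - h" "\<lambda>h. k - h"]) auto
    also have "(\<Sum>h\<in>{0<..<k}. 1 / real h) \<le> (\<Sum>h=1..k. 1 / real h)"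
      by (intro sum_mono2) auto
    also have "\<dots> \<le> L" unfolding L_def using assms by (intro sum_inverse_le_ln)
    finally have "(\<Sum>h\<in>{0<..<k}. w h) \<le> 4 * real k * L" using assms(2) by simp
    moreover have "{..<k} = insert 0 {0<..<k}" using assms by auto
    then have "(\<Sum>m<k. w m) = real k + (\<Sum>h\<in>{0<..<k}. w h)" by (simp add: w_def)
    moreover have "real k * 1 \<le> real k * L" using L1 by (intro mult_left_mono) auto
    ultimately show ?thesis by simp
  qed
  have split: "(\<Sum>h<k. \<Sum>m<k. F h m) = F 0 0 + (\<Sum>m\<in>{0<..<k}. F 0 m) + (\<Sum>h\<in>{0<..<k}. \<Sum>m<k. F h m)"
  proof -
    have "{..<k} = insert 0 {0<..<k}" using assms by auto
    then show ?thesis by simp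
  qed
  have F00: "F 0 0 = of_nat (X * Y * totient k)"
    using card_hyperbola_mod[OF assms(1,2)] by (simp add: F_def A_def kloosterman_def)
  have "norm (\<Sum>m\<in>{0<..<k}. F 0 m) \<le> (\<Sum>m\<in>{0<..<k}. real k * w m * (D * real (gcd m k)))"
  proof (rule sum_norm_le)
    fix m assume "m \<in> {0<..<k}"
    then show "norm (F 0 m) \<le> real k * w m * (D * real (gcd m k))"
      using F_le[of 0 m m] by (simp add: w_def[THEN fun_cong, of 0])
  qed
  also have "\<dots> = real k * D * (\<Sum>m\<in>{0<..<k}. w m * real (gcd m k))"
    by (simp add: sum_distrib_left mult_ac)
  also have "\<dots> \<le> real k * D * (4 * real k * (\<tau> * L))"
    using gcd_sum D0 by (intro mult_left_mono) auto
  also have "\<dots> \<le> real k * D * (4 * real k * (\<tau> * L)) * L"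
    using L1 D0 t0 mult_left_mono[of 1 L "real k * D * (4 * real k * (\<tau> * L))"] by simp
  finally have 1: "norm (\<Sum>m\<in>{0<..<k}. F 0 m) \<le> 4 * (real k)\<^sup>2 * D * \<tau> * L\<^sup>2"
    by (simp add: power2_eq_square mult_ac)
  have "norm (\<Sum>h\<in>{0<..<k}. \<Sum>m<k. F h m) \<le> (\<Sum>h\<in>{0<..<k}. \<Sum>m<k. w h * w m * (D * real (gcd h k)))"
    using F_le by (intro sum_norm_le) auto
  also have "\<dots> = (\<Sum>h\<in>{0<..<k}. w h * real (gcd h k)) * D * (\<Sum>m<k. w m)"
    by (simp add: sum_distrib_left sum_distrib_right mult_ac)
  also have "\<dots> \<le> (4 * real k * (\<tau> * L)) * D * (9 * real k * L)"
    using gcd_sum w_sum D0 t0 L1 w0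
    by (intro mult_mono mult_nonneg_nonneg sum_nonneg) auto
  finally have 2: "norm (\<Sum>h\<in>{0<..<k}. \<Sum>m<k. F h m) \<le> 36 * (real k)\<^sup>2 * D * \<tau> * L\<^sup>2"
    by (simp add: power2_eq_square mult_ac)
  have "of_nat (k\<^sup>2 * box_count k \<sigma> X Y) = (\<Sum>h<k. \<Sum>m<k. F h m)"
    unfolding F_def A_def by (rule box_count_completion[OF assms(2)])
  then have eq: "complex_of_real (real k ^ 2 * real (box_count k \<sigma> X Y) - real X * real Y * real (totient k)) =
      (\<Sum>m\<in>{0<..<k}. F 0 m) + (\<Sum>h\<in>{0<..<k}. \<Sum>m<k. F h m)"
    unfolding split F00 by simp
  have "\<bar>real k ^ 2 * real (box_count k \<sigma> X Y) - real X * real Y * real (totient k)\<bar>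
      = norm ((\<Sum>m\<in>{0<..<k}. F 0 m) + (\<Sum>h\<in>{0<..<k}. \<Sum>m<k. F h m))"
    by (simp only: eq[symmetric] norm_of_real)
  also have "\<dots> \<le> 4 * (real k)\<^sup>2 * D * \<tau> * L\<^sup>2 + 36 * (real k)\<^sup>2 * D * \<tau> * L\<^sup>2"
    using norm_triangle_ineq 1 2 by (rule order_trans[OF _ add_mono])
  also have "\<dots> = real k ^ 2 * (80 * real k powr (3/4) * \<tau>\<^sup>2 * L\<^sup>2)"
    by (simp add: D_def power2_eq_square)
  finally have "\<bar>real k ^ 2 * real (box_count k \<sigma> X Y) - real X * real Y * real (totient k)\<bar> / real k ^ 2
      \<le> 80 * real k powr (3/4) * \<tau>\<^sup>2 * L\<^sup>2"
    using assms(2) by (simp add: field_simps)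
  moreover have "\<bar>real k ^ 2 * real (box_count k \<sigma> X Y) - real X * real Y * real (totient k)\<bar> / real k ^ 2
      = \<bar>real (box_count k \<sigma> X Y) - real X * real Y * real (totient k) / real k ^ 2\<bar>"
  proof -
    have "real (box_count k \<sigma> X Y) - real X * real Y * real (totient k) / real k ^ 2
        = (real k ^ 2 * real (box_count k \<sigma> X Y) - real X * real Y * real (totient k)) / real k ^ 2"
      using assms(2) by (simp add: diff_divide_distrib)
    then show ?thesis by (simp add: abs_divide)
  qed
  ultimately show ?thesis by (simp add: \<tau>_def L_def)
qed

lemma box_count_discrepancy_bound:
  obtains C where "C \<ge> 1"
    "\<And>k \<sigma> X Y. coprime \<sigma> (int k) \<Longrightarrow> k > 0 \<Longrightarrow> X \<le> k \<Longrightarrow> Y \<le> k \<Longrightarrow>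
      \<bar>real (box_count k \<sigma> X Y) - real X * real Y * real (totient k) / real k ^ 2\<bar> \<le> C * real k powr (4/5)"
proof -
  obtain B where B: "B \<ge> 1" "\<And>n. n > 0 \<Longrightarrow> real (num_divisors n) \<le> B * real n powr (1/100)"
    using num_divisors_bound[of "1/100"] by auto
  show ?thesis
  proof (rule that[of "816080 * B\<^sup>2"])
    show "816080 * B\<^sup>2 \<ge> 1" using one_le_power[OF B(1), of 2]
      by linarith
    fix k X Y :: nat and \<sigma> :: int
    assume a: "coprime \<sigma> (int k)" "k > 0" "X \<le> k" "Y \<le> k"
    have k1: "real k \<ge> 1" using a by simp
    have one: "1 \<le> real k powr (1/100)" using k1 by (simp add: ge_one_powr_ge_zero)
    \<comment> \<open>The divisors and the logarithms each cost \<open>k\<^sup>2\<^sup>/\<^sup>1\<^sup>0\<^sup>0\<close>, and \<open>3/4 + 4/100 < 4/5\<close>.\<close>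
    have "ln (real k) \<le> real k powr (1/100) / (1/100)"
      using k1 by (intro ln_powr_bound) auto
    then have L: "1 + ln (real k) \<le> 101 * real k powr (1/100)" using one by simp
    have "\<bar>real (box_count k \<sigma> X Y) - real X * real Y * real (totient k) / real k ^ 2\<bar>
        \<le> 80 * real k powr (3/4) * real (num_divisors k) ^ 2 * (1 + ln (real k)) ^ 2"
      by (rule box_count_discrepancy[OF a])
    also have "\<dots> \<le> 80 * real k powr (3/4) * (B * real k powr (1/100)) ^ 2 * (101 * real k powr (1/100)) ^ 2"
      using B(2)[OF a(2)] L k1 by (intro mult_mono power_mono) auto
    also have "\<dots> = 816080 * B\<^sup>2 * (real k powr (3/4) * (real k powr (1/100) * real k powr (1/100)) * (real k powr (1/100) * real k powr (1/100)))"
      by (simp add: power2_eq_square mult_ac)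
    also have "real k powr (3/4) * (real k powr (1/100) * real k powr (1/100)) * (real k powr (1/100) * real k powr (1/100)) = real k powr (79/100)"
      by (simp add: powr_add[symmetric])
    also have "816080 * B\<^sup>2 * real k powr (79/100) \<le> 816080 * B\<^sup>2 * real k powr (4/5)"
      using k1 by (intro mult_left_mono powr_mono) auto
    finally show "\<bar>real (box_count k \<sigma> X Y) - real X * real Y * real (totient k) / real k ^ 2\<bar>
        \<le> 816080 * B\<^sup>2 * real k powr (4/5)" .
  qed
qed

section \<open>The mean value of the totient ratio\<close>

definition totient_ratio_sum :: "nat \<Rightarrow> real" where
  "totient_ratio_sum n = (\<Sum>k=1..n. real (totient k) / real k)"

text \<open>
  Grouping the pairs \<open>(m, k)\<close> by their product \<open>N\<close>, this is Gauss's identity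
  \<open>(1/N) \<Sum> \<phi>(k) = 1\<close> over the divisors \<open>k\<close> of \<open>N\<close>, summed over \<open>N \<le> n\<close>.
\<close>

lemma totient_ratio_sum_convolution:
  "(\<Sum>m=1..n. totient_ratio_sum (n div m) / real m) = real n"
proof -
  have "(\<Sum>m=1..n. totient_ratio_sum (n div m) / real m) =
      (\<Sum>m=1..n. \<Sum>k=1..n div m. real (totient k) / (real k * real m))"
    by (simp add: totient_ratio_sum_def sum_divide_distrib)
  also have "\<dots> = (\<Sum>(m, k)\<in>Sigma {1..n} (\<lambda>m. {1..n div m}). real (totient k) / (real k * real m))"
    by (rule sum.Sigma) auto
  also have "\<dots> = (\<Sum>(N, k)\<in>Sigma {1..n} (\<lambda>N. {d. d dvd N}). real (totient k) / real N)"
  proof (rule sum.reindex_bij_witness[of _ "\<lambda>(N, k). (N div k, k)" "\<lambda>(m, k). (m * k, k)"])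
    fix z assume "z \<in> Sigma {1..n} (\<lambda>m. {1..n div m})"
    then obtain m k where z: "z = (m, k)" "1 \<le> m" "m \<le> n" "1 \<le> k" "k \<le> n div m" by auto
    have "k * m \<le> n div m * m" using z by (intro mult_right_mono) auto
    also have "\<dots> \<le> n" by simp
    finally show "(case z of (m, k) \<Rightarrow> (m * k, k)) \<in> Sigma {1..n} (\<lambda>N. {d. d dvd N})"
      using z by (simp add: mult.commute)
    show "(case (case z of (m, k) \<Rightarrow> (m * k, k)) of (N, k) \<Rightarrow> (N div k, k)) = z" using z by simp
    show "(case (case z of (m, k) \<Rightarrow> (m * k, k)) of (N, k) \<Rightarrow> real (totient k) / real N) =
        (case z of (m, k) \<Rightarrow> real (totient k) / (real k * real m))"
      using z by (simp add: mult.commute)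
  next
    fix z assume "z \<in> Sigma {1..n} (\<lambda>N. {d. d dvd N})"
    then obtain N k where z: "z = (N, k)" "1 \<le> N" "N \<le> n" "k dvd N" by auto
    then obtain m where m: "N = k * m" by blast
    have pos: "k > 0" "m > 0" using z m by auto
    have "k \<le> n div m" using z m pos by (simp add: less_eq_div_iff_mult_less_eq)
    moreover have "m \<le> n" using z m pos by (metis dvd_imp_le dvd_triv_right le_trans mult_pos_pos)
    ultimately show "(case z of (N, k) \<Rightarrow> (N div k, k)) \<in> Sigma {1..n} (\<lambda>m. {1..n div m})"
      using z m pos by simp
    show "(case (case z of (N, k) \<Rightarrow> (N div k, k)) of (m, k) \<Rightarrow> (m * k, k)) = z"
      using z by simp
  qed
  also have "\<dots> = (\<Sum>N=1..n. \<Sum>k | k dvd N. real (totient k) / real N)"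
    by (rule sum.Sigma[symmetric]) (auto simp: finite_divisors_nat)
  also have "\<dots> = (\<Sum>N=1..n. 1)"
  proof (intro sum.cong refl)
    fix N assume N: "N \<in> {1..n}"
    have "(\<Sum>k | k dvd N. real (totient k) / real N) = real (\<Sum>k | k dvd N. totient k) / real N"
      by (simp add: sum_divide_distrib)
    also have "\<dots> = 1" using N by (simp only: totient_divisor_sum) simp
    finally show "(\<Sum>k | k dvd N. real (totient k) / real N) = 1" .
  qed
  finally show ?thesis by simp
qed

lemma sum_inverse_squares_bounds:
  assumes "n > 0"
  shows "(\<Sum>m=1..n. 1 / (real m)\<^sup>2) \<le> pi\<^sup>2 / 6"
    and "pi\<^sup>2 / 6 \<le> (\<Sum>m=1..n. 1 / (real m)\<^sup>2) + 1 / real n"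
proof -
  define S where "S = (\<lambda>n. \<Sum>m=1..n. 1 / (real m)\<^sup>2)"
  have "(\<lambda>n. \<Sum>i<n. 1 / (real i + 1)\<^sup>2) \<longlonglongrightarrow> pi\<^sup>2 / 6"
    using inverse_squares_sums unfolding sums_def by (simp add: add.commute)
  moreover have "(\<Sum>i<n. 1 / (real i + 1)\<^sup>2) = S n" for n
    unfolding S_def by (rule sum.reindex_bij_witness[of _ "\<lambda>m. m - 1" Suc]) auto
  ultimately have lim: "S \<longlonglongrightarrow> pi\<^sup>2 / 6" by simp
  have "incseq S" unfolding S_def by (intro incseq_SucI) simp
  then show "(\<Sum>m=1..n. 1 / (real m)\<^sup>2) \<le> pi\<^sup>2 / 6"
    using incseq_le[OF _ lim, of n] by (simp add: S_def)
  define T where "T = (\<lambda>n. S (Suc n) + 1 / real (Suc n))"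
  have "decseq T"
  proof (rule decseq_SucI)
    fix n
    have "1 / (x + 1)\<^sup>2 + 1 / (x + 1) \<le> 1 / x" if "x > 0" for x :: real
    proof -
      have "1 / (x + 1)\<^sup>2 \<le> 1 / (x * (x + 1))"
        using that by (intro frac_le) (auto simp: power2_eq_square)
      also have "\<dots> = 1 / x - 1 / (x + 1)" using that by (simp add: field_simps)
      finally show ?thesis by simp
    qed
    from this[of "real (Suc n)"]
    have "1 / (real (Suc (Suc n)))\<^sup>2 + 1 / real (Suc (Suc n)) \<le> 1 / real (Suc n)"
      by (simp add: add.commute)
    then show "T (Suc n) \<le> T n" by (simp add: T_def S_def)
  qed
  moreover have "T \<longlonglongrightarrow> pi\<^sup>2 / 6 + 0"
    unfolding T_def by (intro tendsto_add LIMSEQ_Suc[OF lim] LIMSEQ_Suc[OF lim_1_over_n])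
  ultimately have "pi\<^sup>2 / 6 \<le> T (n - 1)" using decseq_ge by fastforce
  then show "pi\<^sup>2 / 6 \<le> (\<Sum>m=1..n. 1 / (real m)\<^sup>2) + 1 / real n"
    using assms by (cases n) (simp_all add: T_def S_def)
qed

lemma powr_le_of_power5:
  fixes x q :: real
  assumes "x > 0" "q \<ge> 0" "x powr (5 * p) \<le> q ^ 5"
  shows "x powr p \<le> q"
proof -
  have "(x powr p) ^ 5 = x powr (real 5 * p)" using assms by (intro powr_power) simp
  then have "(x powr p) ^ 5 \<le> q ^ 5" using assms by simp
  then show ?thesis using assms by (simp add: power_mono_iff)
qed

lemma powr_step_le:
  fixes x :: real
  assumes "x > 1"
  shows "4/5 * x powr (-9/5) \<le> (x - 1) powr (-4/5) - x powr (-4/5)"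
proof -
  have "\<exists>z. x - 1 < z \<and> z < x \<and> x powr (-4/5) - (x - 1) powr (-4/5) = (x - (x - 1)) * ((-4/5) * z powr (-4/5 - 1))"
    by (intro MVT2 has_real_derivative_powr) (use assms in auto)
  then obtain z where z: "x - 1 < z" "z < x"
    "x powr (-4/5) - (x - 1) powr (-4/5) = (-4/5) * z powr (-9/5)" by auto
  have "x powr (-9/5) \<le> z powr (-9/5)" using z assms by (intro powr_mono2') auto
  then show ?thesis using z(3) by simp
qed

text \<open>
  That \<open>\<zeta>(9/5) - 1 < 1\<close> makes the induction for the mean value of \<open>\<phi>(k)/k\<close> contract; the
  exponent \<open>4/5\<close> of the error term there is small enough for the application and large enough
  for this inequality.
\<close>

lemma sum_powr_tail_less_one: "(\<Sum>m=2..n. real m powr (-9/5)) \<le> 24/25"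
proof -
  have tail: "(\<Sum>m=4..n. real m powr (-9/5)) \<le> 5/4 * (3 powr (-4/5) - real n powr (-4/5))" if "n \<ge> 3" for n
    using that
  proof (induction n rule: dec_induct)
    case (step n)
    have "4/5 * real (Suc n) powr (-9/5) \<le> real n powr (-4/5) - real (Suc n) powr (-4/5)"
      using powr_step_le[of "real (Suc n)"] step.hyps by simp
    moreover have "(\<Sum>m=4..Suc n. real m powr (-9/5)) = (\<Sum>m=4..n. real m powr (-9/5)) + real (Suc n) powr (-9/5)"
      using step.hyps by simp
    moreover have "S' \<le> 5/4 * (t - c)" if "4/5 * a \<le> b - c" "S' = S + a" "S \<le> 5/4 * (t - b)"
      for a b c t S S' :: real
      using that by (simp add: algebra_simps)
    ultimately show ?case using step.IH by blast
  qed simp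
  have a: "2 powr (-9/5) \<le> (29/100 :: real)"
    by (rule powr_le_of_power5) (simp_all add: powr_minus eval_nat_numeral powr_numeral)
  have b: "3 powr (-9/5) \<le> (14/100 :: real)"
    by (rule powr_le_of_power5) (simp_all add: powr_minus eval_nat_numeral powr_numeral)
  have c: "3 powr (-4/5) \<le> (42/100 :: real)"
    by (rule powr_le_of_power5) (simp_all add: powr_minus eval_nat_numeral powr_numeral)
  have "(\<Sum>m=2..n. real m powr (-9/5)) \<le> (\<Sum>m=2..max n 3. real m powr (-9/5))"
    by (intro sum_mono2) auto
  also have "{2..max n 3} = {2, 3} \<union> {4..max n 3}" by auto
  also have "(\<Sum>m\<in>{2, 3} \<union> {4..max n 3}. real m powr (-9/5)) = 2 powr (-9/5) + 3 powr (-9/5) + (\<Sum>m=4..max n 3. real m powr (-9/5))"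
    by (subst sum.union_disjoint) auto
  also have "(\<Sum>m=4..max n 3. real m powr (-9/5)) \<le> 5/4 * 3 powr (-4/5)"
  proof -
    have "5/4 * (3 powr (-4/5) - real (max n 3) powr (-4/5)) \<le> 5/4 * (3 powr (-4/5) :: real)" by simp
    with tail[of "max n 3"] show ?thesis by (meson max.cobounded2 order_trans)
  qed
  finally show ?thesis using a b c by linarith
qed


text \<open>
  The error term \<open>\<Delta>(n)\<close> satisfies \<open>\<Sum> \<Delta>(n div m)/m = O(1 + log n)\<close> by the convolution identity and
  \<open>\<zeta>(2) = \<pi>\<^sup>2/6\<close>. Isolating the term \<open>m = 1\<close> expresses \<open>\<Delta>(n)\<close> through smaller arguments, and an
  induction takes the place of Moebius inversion.
\<close>

lemma totient_ratio_sum_asymp: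
  assumes "n > 0"
  shows "\<bar>totient_ratio_sum n - 6 / pi\<^sup>2 * real n\<bar> \<le> 100 * real n powr (4/5)"
  using assms
proof (induction n rule: less_induct)
  case (less n)
  define c where "c = 6 / pi\<^sup>2"
  define \<Delta> where "\<Delta> = (\<lambda>n. totient_ratio_sum n - c * real n)"
  define H where "H = (\<Sum>m=1..n. 1 / real m)"
  have H: "0 \<le> H" "H \<le> 1 + ln (real n)"
    unfolding H_def using sum_inverse_le_ln[OF less.prems] by (auto intro: sum_nonneg)
  have n1: "real n \<ge> 1" using less.prems by simp
  have "pi\<^sup>2 \<ge> 3\<^sup>2" using pi_gt3 by (intro power_mono) auto
  then have c: "0 < c" "c \<le> 1" by (auto simp: c_def field_simps)
  define W where "W = (\<Sum>m=1..n. real (n div m) / real m)"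
  define Z where "Z = (\<Sum>m=1..n. 1 / (real m)\<^sup>2)"
  have Z: "Z \<le> 1 / c" "1 / c \<le> Z + 1 / real n"
    using sum_inverse_squares_bounds[OF less.prems] by (auto simp: Z_def c_def)
  have W_up: "W \<le> real n * Z"
    unfolding W_def Z_def sum_distrib_left
  proof (rule sum_mono)
    fix m assume "m \<in> {1..n}"
    have "real (n div m) / real m \<le> (real n / real m) / real m"
      by (intro divide_right_mono of_nat_div_le_of_nat) auto
    then show "real (n div m) / real m \<le> real n * (1 / (real m)\<^sup>2)" by (simp add: power2_eq_square)
  qed
  have W_lo: "real n * Z - H \<le> W"
    unfolding W_def Z_def H_def sum_distrib_left sum_subtractf[symmetric]
  proof (rule sum_mono)
    fix m assume m: "m \<in> {1..n}"
    have "real n / real m \<le> real (n div m) + 1"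
    proof -
      have "n mod m < m" using m by simp
      moreover have "(n div m + 1) * m = n div m * m + m" by simp
      ultimately have "n \<le> (n div m + 1) * m" using div_mult_mod_eq[of n m] by linarith
      then have "real n \<le> (real (n div m) + 1) * real m"
        by (metis of_nat_1 of_nat_add of_nat_le_iff of_nat_mult)
      then show ?thesis using m by (simp add: divide_le_eq)
    qed
    then have "(real n / real m) / real m \<le> (real (n div m) + 1) / real m"
      by (intro divide_right_mono) auto
    then show "real n * (1 / (real m)\<^sup>2) - 1 / real m \<le> real (n div m) / real m"
      by (simp add: power2_eq_square add_divide_distrib)
  qed
  have "(\<Sum>m=1..n. \<Delta> (n div m) / real m) = real n - c * W"
    unfolding \<Delta>_def W_def using totient_ratio_sum_convolution[of n]
    by (simp add: diff_divide_distrib sum_subtractf sum_distrib_left)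
  moreover have "(\<Sum>m=1..n. \<Delta> (n div m) / real m) = \<Delta> n + (\<Sum>m=2..n. \<Delta> (n div m) / real m)"
  proof -
    have "{1..n} = insert 1 {2..n}" using less.prems by auto
    then show ?thesis by simp
  qed
  ultimately have eq: "\<Delta> n = (real n - c * W) - (\<Sum>m=2..n. \<Delta> (n div m) / real m)" by simp
  have "c * W \<le> c * (real n * (1 / c))"
    using W_up Z n1 c by (intro mult_left_mono order_trans[OF W_up]) auto
  then have r1: "real n - c * W \<ge> 0" using c by simp
  have "real n * (1 / c) \<le> real n * (Z + 1 / real n)" using Z n1 by (intro mult_left_mono) auto
  then have "c * (real n * (1 / c)) \<le> c * (W + H + 1)"
    using W_lo n1 c by (intro mult_left_mono) (auto simp: distrib_left)
  then have "real n - c * W \<le> c * (H + 1)" using c by (simp add: algebra_simps)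
  also have "\<dots> \<le> 1 * (1 + ln (real n) + 1)"
    using c H by (intro mult_mono) auto
  also have "\<dots> \<le> 2 + real n powr (4/5) / (4/5)" using ln_powr_bound[OF n1, of "4/5"] by simp
  also have "\<dots> \<le> 4 * real n powr (4/5)"
    using ge_one_powr_ge_zero[OF n1, of "4/5"] by simp
  finally have r2: "\<bar>real n - c * W\<bar> \<le> 4 * real n powr (4/5)" using r1 by simp
  have "\<bar>\<Sum>m=2..n. \<Delta> (n div m) / real m\<bar> \<le> (\<Sum>m=2..n. \<bar>\<Delta> (n div m) / real m\<bar>)"
    by (rule sum_abs)
  also have "\<dots> \<le> (\<Sum>m=2..n. 100 * real n powr (4/5) * real m powr (-9/5))"
  proof (rule sum_mono)
    fix m assume m: "m \<in> {2..n}"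
    have "n div m < n" "n div m > 0" using m by (auto simp: div_greater_zero_iff)
    then have "\<bar>\<Delta> (n div m)\<bar> \<le> 100 * real (n div m) powr (4/5)"
      using less.IH by (simp add: \<Delta>_def c_def)
    also have "\<dots> \<le> 100 * (real n / real m) powr (4/5)"
      using of_nat_div_le_of_nat by (intro mult_left_mono powr_mono2) auto
    also have "\<dots> = 100 * real n powr (4/5) * real m powr (-4/5)"
      by (simp add: powr_divide powr_minus_divide)
    finally have "\<bar>\<Delta> (n div m)\<bar> / real m \<le> 100 * real n powr (4/5) * real m powr (-4/5) / real m"
      by (rule divide_right_mono) simp
    also have "\<dots> = 100 * real n powr (4/5) * (real m powr (-4/5) * real m powr (-1))"
      using m by (simp add: powr_minus_divide)
    also have "real m powr (-4/5) * real m powr (-1) = real m powr (-9/5)"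
      by (simp only: powr_add[symmetric]) simp
    finally show "\<bar>\<Delta> (n div m) / real m\<bar> \<le> 100 * real n powr (4/5) * real m powr (-9/5)"
      by (simp add: abs_divide)
  qed
  also have "\<dots> = 100 * real n powr (4/5) * (\<Sum>m=2..n. real m powr (-9/5))"
    by (simp add: sum_distrib_left)
  also have "\<dots> \<le> 100 * real n powr (4/5) * (24/25)"
    by (intro mult_left_mono sum_powr_tail_less_one) auto
  finally have "\<bar>\<Sum>m=2..n. \<Delta> (n div m) / real m\<bar> \<le> 96 * real n powr (4/5)" by simp
  \<comment> \<open>The constant \<open>100\<close> reproduces itself: \<open>4 + 100 * 24/25 = 100\<close>.\<close>
  then have "\<bar>\<Delta> n\<bar> \<le> 100 * real n powr (4/5)" using r2 unfolding eq by linarith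
  then show ?case by (simp add: \<Delta>_def c_def)
qed

section \<open>Partial summation and Riemann sums\<close>

lemma sum_by_parts:
  fixes b g :: "nat \<Rightarrow> real"
  shows "(\<Sum>k=1..n. b k * g k) = (\<Sum>k=1..n. b k) * g n + (\<Sum>j\<in>{1..<n}. (\<Sum>k=1..j. b k) * (g j - g (Suc j)))"
proof (induction n)
  case (Suc n)
  show ?case
  proof (cases "n = 0")
    case False
    then have "{1..<Suc n} = insert n {1..<n}" by auto
    then show ?thesis using Suc.IH by (simp add: algebra_simps)
  qed simp
qed simp

lemma abel_sum_decreasing:
  fixes b g :: "nat \<Rightarrow> real"
  assumes "\<And>j. j \<le> n \<Longrightarrow> \<bar>\<Sum>k=1..j. b k\<bar> \<le> B" and "n > 0"
    and "\<And>i j. 1 \<le> i \<Longrightarrow> i \<le> j \<Longrightarrow> j \<le> n \<Longrightarrow> g j \<le> g i" and "g n \<ge> 0"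
  shows "\<bar>\<Sum>k=1..n. b k * g k\<bar> \<le> B * g 1"
proof -
  have B0: "B \<ge> 0" using assms(1)[of 0] by simp
  have "\<bar>\<Sum>j\<in>{1..<n}. (\<Sum>k=1..j. b k) * (g j - g (Suc j))\<bar> \<le> (\<Sum>j\<in>{1..<n}. B * (g j - g (Suc j)))"
    using assms B0 by (intro order_trans[OF sum_abs] sum_mono) (auto simp: abs_mult intro!: mult_mono)
  also have "\<dots> = B * (g 1 - g n)"
    using sum_Suc_diff'[of 1 n "\<lambda>j. - g j"] assms(2) by (simp add: sum_distrib_left[symmetric])
  finally have 1: "\<bar>\<Sum>j\<in>{1..<n}. (\<Sum>k=1..j. b k) * (g j - g (Suc j))\<bar> \<le> B * (g 1 - g n)" .
  have "\<bar>(\<Sum>k=1..n. b k) * g n\<bar> \<le> B * g n"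
    using assms B0 by (auto simp: abs_mult intro!: mult_mono)
  then show ?thesis unfolding sum_by_parts[of b g] using 1 by (simp add: algebra_simps)
qed

lemma abel_sum_increasing:
  fixes b g :: "nat \<Rightarrow> real"
  assumes "\<And>j. j \<le> n \<Longrightarrow> \<bar>\<Sum>k=1..j. b k\<bar> \<le> B" and "n > 0"
    and "\<And>i j. 1 \<le> i \<Longrightarrow> i \<le> j \<Longrightarrow> j \<le> n \<Longrightarrow> g i \<le> g j" and "g 1 \<ge> 0"
  shows "\<bar>\<Sum>k=1..n. b k * g k\<bar> \<le> 2 * B * g n"
proof -
  have B0: "B \<ge> 0" using assms(1)[of 0] by simp
  have gn: "g n \<ge> 0" using assms by (metis One_nat_def Suc_leI le_refl order_trans)
  have "\<bar>\<Sum>j\<in>{1..<n}. (\<Sum>k=1..j. b k) * (g j - g (Suc j))\<bar> \<le> (\<Sum>j\<in>{1..<n}. B * (g (Suc j) - g j))"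
    using assms B0 by (intro order_trans[OF sum_abs] sum_mono) (auto simp: abs_mult intro!: mult_mono)
  also have "\<dots> = B * (g n - g 1)"
    using assms(2) by (simp add: sum_distrib_left[symmetric] sum_Suc_diff')
  also have "\<dots> \<le> B * g n" using assms(4) B0 by (intro mult_left_mono) auto
  finally have 1: "\<bar>\<Sum>j\<in>{1..<n}. (\<Sum>k=1..j. b k) * (g j - g (Suc j))\<bar> \<le> B * g n" .
  have "\<bar>(\<Sum>k=1..n. b k) * g n\<bar> \<le> B * g n"
    using assms gn B0 by (auto simp: abs_mult intro!: mult_mono)
  then show ?thesis unfolding sum_by_parts[of b g] using 1 by (simp add: algebra_simps)
qed

text \<open>
  On each cell the oscillation of \<open>u w\<close> is at most the increase of \<open>u\<close> plus the decrease of \<open>w\<close>,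
  and both telescope to at most \<open>1\<close>.
\<close>

lemma riemann_sum_monotone_product:
  fixes u w :: "real \<Rightarrow> real"
  assumes e: "e > 0"
    and u: "\<And>x y. 0 \<le> x \<Longrightarrow> x \<le> y \<Longrightarrow> y \<le> e * real n \<Longrightarrow> u x \<le> u y"
    and w: "\<And>x y. 0 \<le> x \<Longrightarrow> x \<le> y \<Longrightarrow> y \<le> e * real n \<Longrightarrow> w y \<le> w x"
    and u01: "\<And>x. 0 \<le> x \<Longrightarrow> x \<le> e * real n \<Longrightarrow> 0 \<le> u x \<and> u x \<le> 1"
    and w01: "\<And>x. 0 \<le> x \<Longrightarrow> x \<le> e * real n \<Longrightarrow> 0 \<le> w x \<and> w x \<le> 1"
    and int: "(\<lambda>x. u x * w x) integrable_on {0..e * real n}"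
  shows "\<bar>(\<Sum>k=1..n. e * (u (e * real k) * w (e * real k))) - integral {0..e * real n} (\<lambda>x. u x * w x)\<bar> \<le> 2 * e"
proof -
  let ?f = "\<lambda>x. u x * w x"
  have main: "\<bar>(\<Sum>k=1..j. e * ?f (e * real k)) - integral {0..e * real j} ?f\<bar>
      \<le> e * (u (e * real j) - u 0 + w 0 - w (e * real j))" if "j \<le> n" for j
    using that
  proof (induction j)
    case (Suc j)
    let ?a = "e * real j" and ?b = "e * real (Suc j)"
    define d where "d = (u ?b - u ?a) + (w ?a - w ?b)"
    have bn: "?b \<le> e * real n" using Suc.prems e by (intro mult_left_mono) auto
    have a0: "0 \<le> ?a" "?a \<le> ?b" using e by auto
    have intb: "?f integrable_on {0..?b}" by (rule integrable_on_subinterval[OF int]) (use bn in auto)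
    have intab: "?f integrable_on {?a..?b}" by (rule integrable_on_subinterval[OF intb]) (use a0 in auto)
    have close: "\<bar>?f x - ?f ?b\<bar> \<le> d" if "x \<in> {?a..?b}" for x
    proof -
      have x: "0 \<le> x" "x \<le> ?b" "?a \<le> x" "x \<le> e * real n" using that a0 bn by auto
      have ux: "u ?a \<le> u x" "u x \<le> u ?b" "0 \<le> u x" "u x \<le> 1" using u u01 x a0 bn by auto
      have wx: "w ?b \<le> w x" "w x \<le> w ?a" "0 \<le> w ?b" "w ?b \<le> 1" using w w01 x a0 bn by auto
      have "?f x - ?f ?b = u x * (w x - w ?b) - (u ?b - u x) * w ?b" by (simp add: algebra_simps)
      moreover have "0 \<le> u x * (w x - w ?b)" "u x * (w x - w ?b) \<le> 1 * (w ?a - w ?b)"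
        using ux wx mult_mono[of "u x" 1 "w x - w ?b" "w ?a - w ?b"] by simp_all
      moreover have "0 \<le> (u ?b - u x) * w ?b" "(u ?b - u x) * w ?b \<le> (u ?b - u ?a) * 1"
        using ux wx mult_mono[of "u ?b - u x" "u ?b - u ?a" "w ?b" 1] by simp_all
      moreover have "\<bar>f\<bar> \<le> d2 + d1" if "f = p - q" "0 \<le> p" "p \<le> 1 * d1" "0 \<le> q" "q \<le> d2 * 1"
        for f p q d1 d2 :: real
        using that by linarith
      ultimately show ?thesis unfolding d_def by blast
    qed
    have up: "integral {?a..?b} ?f \<le> integral {?a..?b} (\<lambda>x. ?f ?b + d)"
      using close unfolding abs_diff_le_iff by (intro integral_le intab) blast+
    have lo: "integral {?a..?b} (\<lambda>x. ?f ?b - d) \<le> integral {?a..?b} ?f"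
      using close unfolding abs_diff_le_iff by (intro integral_le intab) blast+
    have "?b - ?a = e" by (simp add: algebra_simps)
    then have const: "integral {?a..?b} (\<lambda>x. c) = e * c" for c :: real using a0 by simp
    have "\<bar>e * F - J\<bar> \<le> e * d" if "J \<le> e * (F + d)" "e * (F - d) \<le> J" for F J :: real
      using that by (simp add: algebra_simps abs_le_iff)
    then have cell: "\<bar>e * ?f ?b - integral {?a..?b} ?f\<bar> \<le> e * d"
      using up[unfolded const] lo[unfolded const] by blast
    have split: "integral {0..?b} ?f = integral {0..?a} ?f + integral {?a..?b} ?f"
      using Henstock_Kurzweil_Integration.integral_combine[OF a0 intb] by simp
    have "(\<Sum>k=1..Suc j. e * ?f (e * real k)) = (\<Sum>k=1..j. e * ?f (e * real k)) + e * ?f ?b" by simp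
    then have "\<bar>(\<Sum>k=1..Suc j. e * ?f (e * real k)) - integral {0..?b} ?f\<bar>
        \<le> e * (u ?a - u 0 + w 0 - w ?a) + e * d"
      unfolding split using Suc.IH Suc.prems cell by linarith
    then show ?case by (simp add: d_def algebra_simps)
  qed simp
  have "e * (u (e * real n) - u 0 + w 0 - w (e * real n)) \<le> e * 2"
    using u01[of "e * real n"] u01[of 0] w01[of 0] w01[of "e * real n"] e by (intro mult_left_mono) auto
  then show ?thesis using main[of n] by simp
qed

lemma sum_powr_le:
  fixes s :: real
  assumes "s > 0"
  shows "(\<Sum>k=1..n. real k powr (s - 1)) \<le> (1 + 1 / s) * real n powr s"
proof (cases "s \<ge> 1")
  case True
  have "(\<Sum>k=1..n. real k powr (s - 1)) \<le> (\<Sum>k=1..n. real n powr (s - 1))"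
    using True by (intro sum_mono powr_mono2) auto
  also have "\<dots> = real n powr s"
    by (cases "n = 0") (auto simp: powr_diff)
  also have "\<dots> \<le> (1 + 1 / s) * real n powr s"
    using assms mult_right_mono[of 1 "1 + 1 / s" "real n powr s"] by simp
  finally show ?thesis .
next
  case False
  have "(\<Sum>k=1..n. real k powr (s - 1)) \<le> (1 / s) * real n powr s"
  proof (induction n)
    case (Suc n)
    have "s * real (Suc n) powr (s - 1) \<le> real (Suc n) powr s - real n powr s"
    proof (cases "n = 0")
      case True
      then show ?thesis using False by simp
    next
      case n0: False
      have "\<exists>z. real n < z \<and> z < real (Suc n) \<and> real (Suc n) powr s - real n powr s = (real (Suc n) - real n) * (s * z powr (s - 1))"
        by (intro MVT2 has_real_derivative_powr) (use n0 in auto)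
      then obtain z where z: "real n < z" "z < real (Suc n)" "real (Suc n) powr s - real n powr s = s * z powr (s - 1)"
        by auto
      have "real (Suc n) powr (s - 1) \<le> z powr (s - 1)"
        using z n0 False by (intro powr_mono2') auto
      then show ?thesis using z assms by simp
    qed
    then have "real (Suc n) powr (s - 1) \<le> (1 / s) * real (Suc n) powr s - (1 / s) * real n powr s"
      using assms by (simp add: field_simps)
    then show ?case using Suc.IH by simp
  qed simp
  also have "\<dots> \<le> (1 + 1 / s) * real n powr s"
    using assms by (intro mult_right_mono) auto
  finally show ?thesis .
qed

section \<open>The limiting density\<close>

text \<open>
  Up to scaling, the arc of slopes that belongs to the fraction \<open>a/k\<close> and a neighbour of
  denominator \<open>s = v k\<close> has length \<open>1 / max 1 (\<rho> v)\<close> with \<open>\<rho> = y/(1 - y)\<close> and \<open>y = \<epsilon> k\<close>. As the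
  inverses are equidistributed, \<open>v\<close> is averaged over \<open>[0, 1]\<close>. The resulting
  \<open>12/\<pi>\<^sup>2\<close> \<open>denominator_density\<close> is the limiting density of \<open>\<epsilon>\<close> times the first denominator.
\<close>

definition ratio_mean :: "real \<Rightarrow> real" where
  "ratio_mean \<rho> = integral {0..1} (\<lambda>v. 1 / max 1 (\<rho> * v))"

definition denominator_density :: "real \<Rightarrow> real" where
  "denominator_density y = (if y < 1 then ratio_mean (y / (1 - y)) else 0)"

lemma continuous_on_ratio: "continuous_on S (\<lambda>v. 1 / max 1 (\<rho> * v))" for \<rho> :: real
  by (intro continuous_intros) auto

lemma ratio_integrable: "(\<lambda>v. 1 / max 1 (\<rho> * v)) integrable_on {a..b}" for \<rho> :: real
  by (intro integrable_continuous_real continuous_on_ratio)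

lemma ratio_mean_antimono:
  assumes "0 \<le> \<rho>" "\<rho> \<le> \<mu>" shows "ratio_mean \<mu> \<le> ratio_mean \<rho>"
  unfolding ratio_mean_def
  by (intro integral_le ratio_integrable) (use assms in \<open>auto intro!: divide_left_mono max.mono mult_right_mono\<close>)

lemma ratio_mean_bounds:
  assumes "0 \<le> \<rho>" shows "0 \<le> ratio_mean \<rho>" "ratio_mean \<rho> \<le> 1"
proof -
  show "0 \<le> ratio_mean \<rho>"
    unfolding ratio_mean_def by (intro integral_nonneg ratio_integrable) auto
  have "ratio_mean 0 = 1" by (simp add: ratio_mean_def)
  then show "ratio_mean \<rho> \<le> 1" using ratio_mean_antimono[of 0 \<rho>] assms by simp
qed

lemma ratio_mean_riemann:
  assumes "0 \<le> \<rho>" "k > 0"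
  shows "\<bar>(\<Sum>s=1..k. 1 / max 1 (\<rho> * (real s / real k))) - real k * ratio_mean \<rho>\<bar> \<le> 2"
proof -
  define e where "e = 1 / real k"
  have e: "e > 0" "e * real k = 1" using assms by (auto simp: e_def)
  let ?w = "\<lambda>v. 1 / max 1 (\<rho> * v)"
  have "\<bar>(\<Sum>s=1..k. e * (1 * ?w (e * real s))) - integral {0..e * real k} (\<lambda>x. 1 * ?w x)\<bar> \<le> 2 * e"
    by (rule riemann_sum_monotone_product)
       (use assms e ratio_integrable[of \<rho>] in \<open>auto intro!: divide_left_mono max.mono mult_left_mono\<close>)
  then have 1: "\<bar>e * (\<Sum>s=1..k. ?w (e * real s)) - ratio_mean \<rho>\<bar> \<le> 2 * e"
    unfolding e(2) ratio_mean_def by (simp add: sum_distrib_left)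
  then have "real k * \<bar>e * (\<Sum>s=1..k. ?w (e * real s)) - ratio_mean \<rho>\<bar> \<le> real k * (2 * e)"
    by (intro mult_left_mono) auto
  moreover have "real k * \<bar>e * (\<Sum>s=1..k. ?w (e * real s)) - ratio_mean \<rho>\<bar>
      = \<bar>real k * (e * (\<Sum>s=1..k. ?w (e * real s)) - ratio_mean \<rho>)\<bar>"
    by (simp add: abs_mult)
  moreover have "real k * (e * (\<Sum>s=1..k. ?w (e * real s)) - ratio_mean \<rho>)
      = (\<Sum>s=1..k. ?w (real s / real k)) - real k * ratio_mean \<rho>"
    using assms(2) by (simp add: e_def right_diff_distrib)
  moreover have "real k * (2 * e) = 2" using e by (simp add: mult.commute)
  ultimately show ?thesis by simp
qed

lemma ratio_mean_eq_one: "0 \<le> \<rho> \<Longrightarrow> \<rho> \<le> 1 \<Longrightarrow> ratio_mean \<rho> = 1"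
proof -
  assume l: "0 \<le> \<rho>" "\<rho> \<le> 1"
  have "ratio_mean \<rho> = integral {0..1} (\<lambda>v :: real. 1 :: real)"
    unfolding ratio_mean_def
  proof (rule Henstock_Kurzweil_Integration.integral_cong)
    fix v :: real assume "v \<in> {0..1}"
    then have "\<rho> * v \<le> 1 * 1" using l by (intro mult_mono) auto
    then show "1 / max 1 (\<rho> * v) = 1" by (simp add: max_def)
  qed
  then show ?thesis by simp
qed

lemma ratio_mean_eq_ln:
  assumes "\<rho> \<ge> 1" shows "ratio_mean \<rho> = (1 + ln \<rho>) / \<rho>"
proof -
  have a: "0 \<le> 1 / \<rho>" "1 / \<rho> \<le> 1" using assms by auto
  have "ratio_mean \<rho> = integral {0..1 / \<rho>} (\<lambda>v. 1 / max 1 (\<rho> * v)) + integral {1 / \<rho>..1} (\<lambda>v. 1 / max 1 (\<rho> * v))"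
    unfolding ratio_mean_def
    using Henstock_Kurzweil_Integration.integral_combine[OF a ratio_integrable[of \<rho>]] by simp
  also have "integral {0..1 / \<rho>} (\<lambda>v. 1 / max 1 (\<rho> * v)) = integral {0..1 / \<rho>} (\<lambda>v. 1)"
    using assms by (intro Henstock_Kurzweil_Integration.integral_cong) (auto simp: max_def field_simps)
  also have "\<dots> = 1 / \<rho>" using a by simp
  also have "integral {1 / \<rho>..1} (\<lambda>v. 1 / max 1 (\<rho> * v)) = integral {1 / \<rho>..1} (\<lambda>v. 1 / \<rho> * (1 / v))"
    using assms by (intro Henstock_Kurzweil_Integration.integral_cong) (auto simp: max_def field_simps)
  also have "((\<lambda>v. 1 / \<rho> * (1 / v)) has_integral 1 / \<rho> * ln 1 - 1 / \<rho> * ln (1 / \<rho>)) {1 / \<rho>..1}"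
  proof (rule fundamental_theorem_of_calculus[OF a(2)])
    fix x assume x: "x \<in> {1 / \<rho>..1}"
    then have "x > 0" using assms by (meson atLeastAtMost_iff less_le_trans zero_less_divide_1_iff less_le_trans[OF zero_less_one])
    then show "((\<lambda>v. 1 / \<rho> * ln v) has_vector_derivative 1 / \<rho> * (1 / x)) (at x within {1 / \<rho>..1})"
      unfolding has_real_derivative_iff_has_vector_derivative[symmetric]
      using assms by (auto intro!: derivative_eq_intros)
  qed
  then have "integral {1 / \<rho>..1} (\<lambda>v. 1 / \<rho> * (1 / v)) = 1 / \<rho> * ln \<rho>"
    using assms by (subst integral_unique) (auto simp: ln_div)
  finally show ?thesis by (simp add: add_divide_distrib)
qed

lemma denominator_density_small:
  assumes "0 \<le> y" "y \<le> 1/2" shows "denominator_density y = 1"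
  unfolding denominator_density_def using assms
  by (auto intro!: ratio_mean_eq_one simp: field_simps)

lemma denominator_density_large:
  assumes "1/2 \<le> y" "y < 1"
  shows "denominator_density y = (1 - y) / y * (1 + ln (y / (1 - y)))"
  unfolding denominator_density_def using assms
  by (subst ratio_mean_eq_ln) (auto simp: field_simps)

lemma denominator_density_bounds:
  assumes "0 \<le> y" shows "0 \<le> denominator_density y" "denominator_density y \<le> 1"
  using assms ratio_mean_bounds[of "y / (1 - y)"] by (auto simp: denominator_density_def)

lemma denominator_density_antimono:
  assumes "0 \<le> x" "x \<le> y" shows "denominator_density y \<le> denominator_density x"
proof (cases "y < 1")
  case True
  have "x / (1 - x) \<le> y / (1 - y)" using assms True by (intro frac_le) auto
  then show ?thesis using ratio_mean_antimono[of "x / (1 - x)" "y / (1 - y)"] assms True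
    by (simp add: denominator_density_def)
next
  case False
  then show ?thesis using denominator_density_bounds[OF assms(1)] by (simp add: denominator_density_def)
qed

lemma powr_density_integrable:
  assumes "r > 0"
  shows "(\<lambda>y. y powr r * denominator_density y) integrable_on {0..b}"
proof (cases "b \<ge> 0")
  case True
  have "(\<lambda>y. - denominator_density y) integrable_on {0..b}"
    by (intro integrable_on_mono_on mono_onI) (auto intro: denominator_density_antimono)
  then have 1: "denominator_density integrable_on {0..b}"
    using integrable_neg by fastforce
  have mono: "x powr r \<le> y powr r" if "0 \<le> x" "x \<le> y" for x y
    using that assms by (intro powr_mono2) auto
  show ?thesis
    by (rule second_mean_value_theorem_full[OF 1 True, of "\<lambda>y. y powr r"])
       (use mono in \<open>auto intro: has_integral_integrable\<close>)
qed (simp add: integrable_on_empty)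

definition density_moment :: "real \<Rightarrow> real" where
  "density_moment r = integral {0..1} (\<lambda>y. y powr r * denominator_density y)"

text \<open>
  Weighting by \<open>\<phi>(k)/k\<close> amounts to the factor \<open>6/\<pi>\<^sup>2\<close>, after two partial summations:
  the weight \<open>y\<^sup>r\<close> increases and the density decreases.
\<close>

lemma totient_weighted_density_sum:
  assumes r: "r > 0" and e: "0 < e" and n: "n > 0" "e * real n \<le> 1" "1 < e * real (Suc n)"
  shows "\<bar>(\<Sum>k=1..n. e * (real (totient k) / real k * ((e * real k) powr r * denominator_density (e * real k))))
      - 6 / pi\<^sup>2 * density_moment r\<bar> \<le> 3 * e + 200 * (e * real n powr (4/5))"
proof -
  define c where "c = 6 / pi\<^sup>2"
  define b where "b = (\<lambda>k. real (totient k) / real k - c)"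
  define B where "B = 100 * real n powr (4/5)"
  let ?u = "\<lambda>y. y powr r"
  let ?w = "denominator_density"
  have "pi\<^sup>2 \<ge> 3\<^sup>2" using pi_gt3 by (intro power_mono) auto
  then have c: "0 < c" "c \<le> 1" by (auto simp: c_def field_simps)
  have b_sum: "\<bar>\<Sum>k=1..j. b k\<bar> \<le> B" if "j \<le> n" for j
  proof (cases "j = 0")
    case False
    have "(\<Sum>k=1..j. b k) = totient_ratio_sum j - c * real j"
      by (simp add: b_def totient_ratio_sum_def sum_subtractf)
    then have "\<bar>\<Sum>k=1..j. b k\<bar> \<le> 100 * real j powr (4/5)"
      using totient_ratio_sum_asymp[of j] False by (simp add: c_def)
    also have "\<dots> \<le> B" unfolding B_def using that by (intro mult_left_mono powr_mono2) auto
    finally show ?thesis .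
  qed (simp add: B_def)
  have B0: "B \<ge> 0" by (simp add: B_def)
  have w_sum: "\<bar>\<Sum>k=1..j. b k * ?w (e * real k)\<bar> \<le> B" if "j \<le> n" for j
  proof (cases "j = 0")
    case False
    have "\<bar>\<Sum>k=1..j. b k * ?w (e * real k)\<bar> \<le> B * ?w (e * real 1)"
    proof (rule abel_sum_decreasing)
      show "\<bar>\<Sum>k=1..i. b k\<bar> \<le> B" if "i \<le> j" for i using b_sum that \<open>j \<le> n\<close> by simp
      show "?w (e * real k) \<le> ?w (e * real i)" if "1 \<le> i" "i \<le> k" for i k
        using that e by (intro denominator_density_antimono mult_left_mono) auto
    qed (use False e in \<open>auto intro: denominator_density_bounds\<close>)
    also have "\<dots> \<le> B * 1" using B0 e by (intro mult_left_mono denominator_density_bounds) auto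
    finally show ?thesis by simp
  qed (simp add: B0)
  have "\<bar>\<Sum>k=1..n. (b k * ?w (e * real k)) * ?u (e * real k)\<bar> \<le> 2 * B * ?u (e * real n)"
  proof (rule abel_sum_increasing[OF w_sum n(1)])
    show "?u (e * real i) \<le> ?u (e * real j)" if "1 \<le> i" "i \<le> j" for i j
      using that e r by (intro powr_mono2 mult_left_mono) auto
  qed auto
  also have "\<dots> \<le> 2 * B * 1"
    using B0 n e r by (intro mult_left_mono powr_le1) auto
  finally have "\<bar>\<Sum>k=1..n. b k * ?w (e * real k) * ?u (e * real k)\<bar> \<le> 2 * B" by simp
  then have "e * \<bar>\<Sum>k=1..n. b k * ?w (e * real k) * ?u (e * real k)\<bar> \<le> e * (2 * B)"
    using e by (intro mult_left_mono) auto
  then have 1: "\<bar>e * (\<Sum>k=1..n. b k * ?w (e * real k) * ?u (e * real k))\<bar> \<le> e * (2 * B)"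
    using e by (simp add: abs_mult)
  let ?f = "\<lambda>y. ?u y * ?w y"
  have int: "?f integrable_on {0..x}" for x by (rule powr_density_integrable[OF r])
  have 2: "\<bar>(\<Sum>k=1..n. e * ?f (e * real k)) - integral {0..e * real n} ?f\<bar> \<le> 2 * e"
  proof (rule riemann_sum_monotone_product[OF e _ _ _ _ int])
    fix x y assume "0 \<le> x" "x \<le> y" "y \<le> e * real n"
    then show "?u x \<le> ?u y" "?w y \<le> ?w x"
      using r by (auto intro: powr_mono2 denominator_density_antimono)
  next
    fix x assume "0 \<le> x" "x \<le> e * real n"
    then show "0 \<le> ?u x \<and> ?u x \<le> 1" "0 \<le> ?w x \<and> ?w x \<le> 1"
      using r n by (auto intro: powr_le1 denominator_density_bounds)
  qed
  have n0: "0 \<le> e * real n" using e by simp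
  have split: "density_moment r = integral {0..e * real n} ?f + integral {e * real n..1} ?f"
    unfolding density_moment_def
    using Henstock_Kurzweil_Integration.integral_combine[OF n0 n(2) int] by simp
  have int': "?f integrable_on {e * real n..1}"
    by (rule integrable_on_subinterval[OF int[of 1]]) (use n0 in auto)
  have "integral {e * real n..1} ?f \<le> integral {e * real n..1} (\<lambda>x. 1)"
  proof (intro integral_le int')
    fix x assume "x \<in> {e * real n..1}"
    then have "?f x \<le> 1 * 1"
      using r n0 by (intro mult_mono powr_le1 denominator_density_bounds) auto
    then show "?f x \<le> 1" by simp
  qed auto
  also have "\<dots> \<le> e" using n by (simp add: algebra_simps)
  finally have 3: "integral {e * real n..1} ?f \<le> e" .
  have 4: "0 \<le> integral {e * real n..1} ?f"
    using n0 by (intro integral_nonneg int' mult_nonneg_nonneg denominator_density_bounds) auto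
  have "\<bar>(\<Sum>k=1..n. e * ?f (e * real k)) - density_moment r\<bar> \<le> 3 * e"
    using 2 3 4 unfolding split by linarith
  then have "c * \<bar>(\<Sum>k=1..n. e * ?f (e * real k)) - density_moment r\<bar> \<le> 1 * (3 * e)"
    using c e by (intro mult_mono) auto
  then have 5: "\<bar>c * (\<Sum>k=1..n. e * ?f (e * real k)) - c * density_moment r\<bar> \<le> 3 * e"
    using c by (simp add: right_diff_distrib[symmetric] abs_mult)
  have "(\<Sum>k=1..n. e * (real (totient k) / real k * ?f (e * real k)))
      = c * (\<Sum>k=1..n. e * ?f (e * real k)) + e * (\<Sum>k=1..n. b k * ?w (e * real k) * ?u (e * real k))"
    unfolding sum_distrib_left sum.distrib[symmetric]
    by (intro sum.cong refl) (simp add: b_def algebra_simps)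
  moreover have "e * (2 * B) = 200 * (e * real n powr (4/5))" by (simp add: B_def)
  ultimately show ?thesis using 1 5 unfolding c_def by linarith
qed

lemma set_integrable_lborel_nonneg:
  fixes f :: "real \<Rightarrow> real"
  assumes "f integrable_on S" "\<And>x. x \<in> S \<Longrightarrow> 0 \<le> f x"
    and "f \<in> borel_measurable borel" "S \<in> sets borel"
  shows "set_integrable lborel S f"
proof -
  have "f absolutely_integrable_on S"
    using assms by (simp add: absolutely_integrable_on_iff_nonneg)
  then have "integrable (completion lborel) (\<lambda>x. indicator S x *\<^sub>R f x)"
    by (simp add: set_integrable_def)
  moreover have "(\<lambda>x. indicator S x *\<^sub>R f x) \<in> borel_measurable lborel"
    using assms by measurable
  ultimately show ?thesis
    by (simp add: set_integrable_def integrable_completion)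
qed

text \<open>
  Reflecting the half \<open>[1/2, 1]\<close> of the range of integration turns the moment into an integral over
  \<open>[0, 1/2]\<close> which contains \<open>B'(x) ln ((1 - x)/x)\<close>, where
  \<open>B(x) = (1 - (1 - x)\<^sup>r)/r - (1 - (1 - x)\<^sup>r\<^sup>+\<^sup>1)/(r + 1)\<close>. Since \<open>B\<close> vanishes at \<open>0\<close> and the
  logarithm at \<open>1/2\<close>, integration by parts replaces it by \<open>B(x) / (x (1 - x))\<close>.
\<close>

lemma moment_const_eq_density_moment:
  assumes r: "r > 0"
  shows "moment_const r = 12 / pi\<^sup>2 * density_moment r"
proof -
  define P where "P = (\<lambda>x::real. x * (x powr (r - 1) + (1 - x) powr (r - 1)))"
  define V where "V = (\<lambda>x::real. x * (1 - x) powr (r - 1) * ln ((1 - x) / x))"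
  define B where "B = (\<lambda>x::real. (1 - (1 - x) powr r) / r - (1 - (1 - x) powr (r + 1)) / (r + 1))"
  define U where "U = (\<lambda>x. B x / (x * (1 - x)))"
  define F where "F = (\<lambda>x. - (B x * ln ((1 - x) / x)))"
  let ?f = "\<lambda>y. y powr r * denominator_density y"
  have B_deriv: "(B has_real_derivative x * (1 - x) powr (r - 1)) (at x)" if "x < 1" for x
  proof -
    have "(B has_real_derivative (1 - x) powr (r - 1) - (1 - x) powr r) (at x)"
      unfolding B_def using that r
      by (auto intro!: derivative_eq_intros simp: powr_diff)
    moreover have "(1 - x) powr r = (1 - x) * (1 - x) powr (r - 1)"
      using that by (simp add: powr_diff)
    then have "(1 - x) powr (r - 1) - (1 - x) powr r = x * (1 - x) powr (r - 1)"
      by (simp add: left_diff_distrib)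
    ultimately show ?thesis by simp
  qed
  have B0: "B 0 = 0" by (simp add: B_def)
  have B_nonneg: "0 \<le> B x" if "0 \<le> x" "x \<le> 1/2" for x
  proof -
    have "B 0 \<le> B x"
    proof (rule DERIV_nonneg_imp_nondecreasing[OF that(1)])
      fix z assume "0 \<le> z" "z \<le> x"
      then show "\<exists>y. (B has_real_derivative y) (at z) \<and> 0 \<le> y"
        using B_deriv[of z] that by (intro exI[of _ "z * (1 - z) powr (r - 1)"]) auto
    qed
    then show ?thesis using B0 by simp
  qed
  have F_lim: "(F \<longlongrightarrow> 0) (at_right 0)"
    unfolding F_def B_def using r by real_asymp
  have F_deriv: "(F has_real_derivative U x - V x) (at x)" if "0 < x" "x < 1" for x
  proof -
    have "((\<lambda>x. ln ((1 - x) / x)) has_real_derivative - 1 / (x * (1 - x))) (at x)"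
      using that by (auto intro!: derivative_eq_intros simp: field_simps)
    then have "(F has_real_derivative - (x * (1 - x) powr (r - 1) * ln ((1 - x) / x) + - 1 / (x * (1 - x)) * B x)) (at x)"
      unfolding F_def using that by (intro DERIV_minus DERIV_mult B_deriv) auto
    then show ?thesis by (simp add: U_def V_def)
  qed
  have F_cont: "continuous_on {0..1/2} F"
    unfolding continuous_on
  proof
    fix x :: real assume x: "x \<in> {0..1/2}"
    show "(F \<longlongrightarrow> F x) (at x within {0..1/2})"
    proof (cases "x = 0")
      case True
      have "F 0 = 0" by (simp add: F_def B0)
      moreover have "at 0 within {0..1/2::real} = at_right 0" by (rule at_within_Icc_at_right) simp
      ultimately show ?thesis using F_lim True by simp
    next
      case False
      then have "isCont F x" using F_deriv[of x] x by (intro DERIV_isCont) auto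
      then have "(F \<longlongrightarrow> F x) (at x)" by (simp add: isCont_def)
      then show ?thesis by (rule tendsto_within_subset) simp
    qed
  qed
  have "((\<lambda>x. U x - V x) has_integral F (1/2) - F 0) {0..1/2}"
    by (rule fundamental_theorem_of_calculus_interior[OF _ F_cont])
       (use F_deriv in \<open>auto simp: has_real_derivative_iff_has_vector_derivative[symmetric]\<close>)
  then have UV: "((\<lambda>x. U x - V x) has_integral 0) {0..1/2}"
    by (simp add: F_def B0)
  have int: "?f integrable_on {0..b}" for b by (rule powr_density_integrable[OF r])
  have int1: "?f integrable_on {1/2..1}" by (rule integrable_on_subinterval[OF int[of 1]]) auto
  have "((\<lambda>x. ?f ((-1) *\<^sub>R x + 1)) has_integral (1 / \<bar>-1\<bar> ^ DIM(real)) *\<^sub>R integral {1/2..1} ?f)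
      ((\<lambda>x. (1 / (-1)) *\<^sub>R x + - ((1 / (-1)) *\<^sub>R 1)) ` cbox (1/2) 1)"
    by (rule has_integral_affinity) (use int1 in \<open>auto simp: integrable_integral\<close>)
  moreover have "(\<lambda>x::real. (1 / (-1)) *\<^sub>R x + - ((1 / (-1)) *\<^sub>R 1)) ` cbox (1/2) 1 = {0..1/2}"
  proof (intro equalityI subsetI)
    fix x :: real assume "x \<in> {0..1/2}"
    then show "x \<in> (\<lambda>x::real. (1 / (-1)) *\<^sub>R x + - ((1 / (-1)) *\<^sub>R 1)) ` cbox (1/2) 1"
      by (intro image_eqI[of _ _ "1 - x"]) auto
  qed auto
  ultimately have reflected: "((\<lambda>x. ?f (1 - x)) has_integral integral {1/2..1} ?f) {0..1/2}"
    by simp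
  have "(?f has_integral integral {0..1/2} ?f) {0..1/2}" using int by (rule integrable_integral)
  from has_integral_add[OF this reflected]
  have "((\<lambda>x. ?f x + ?f (1 - x)) has_integral integral {0..1/2} ?f + integral {1/2..1} ?f) {0..1/2}" .
  moreover have "integral {0..1/2} ?f + integral {1/2..1} ?f = density_moment r"
    unfolding density_moment_def
    by (intro Henstock_Kurzweil_Integration.integral_combine int) auto
  moreover have "?f x + ?f (1 - x) = P x + V x" if "x \<in> {0..1/2}" for x
  proof (cases "x = 0")
    case True
    then show ?thesis using r by (simp add: P_def V_def denominator_density_def)
  next
    case False
    then have x: "0 < x" "x \<le> 1/2" using that by auto
    have "?f x = x * x powr (r - 1)" using x denominator_density_small[of x] by (simp add: powr_diff)
    moreover have "?f (1 - x) = x * (1 - x) powr (r - 1) * (1 + ln ((1 - x) / x))"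
      using x denominator_density_large[of "1 - x"] by (simp add: powr_diff)
    ultimately show ?thesis by (simp add: P_def V_def distrib_left)
  qed
  ultimately have PV: "((\<lambda>x. P x + V x) has_integral density_moment r) {0..1/2}"
    using has_integral_cong[of "{0..1/2}" "\<lambda>x. ?f x + ?f (1 - x)" "\<lambda>x. P x + V x"] by simp
  have PU: "((\<lambda>x. P x + U x) has_integral density_moment r) {0..1/2}"
    using has_integral_add[OF PV UV] by simp
  let ?g = "\<lambda>x. x * (x powr (r - 1) + (1 - x) powr (r - 1))
        + (1 - (1 - x) powr r) / (r * x * (1 - x))
        - (1 - (1 - x) powr (r + 1)) / ((r + 1) * x * (1 - x))"
  have g: "?g x = P x + U x" for x
    by (simp add: P_def U_def B_def diff_divide_distrib mult.assoc)
  have "set_integrable lborel {0..1/2} ?g"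
  proof (rule set_integrable_lborel_nonneg)
    show "?g integrable_on {0..1/2}" unfolding g using PU by (rule has_integral_integrable)
    fix x :: real assume x: "x \<in> {0..1/2}"
    then have "0 \<le> P x" "0 \<le> U x" using B_nonneg[of x] by (auto simp: P_def U_def)
    then show "0 \<le> ?g x" unfolding g by simp
  qed auto
  then have "(LBINT x:{0..1/2}. ?g x) = integral {0..1/2} ?g"
    by (rule set_borel_integral_eq_integral(2))
  also have "\<dots> = density_moment r" unfolding g using PU by (rule integral_unique)
  finally show ?thesis unfolding moment_const_def by simp
qed

section \<open>The first denominator\<close>

definition first_denominator :: "real \<Rightarrow> real \<Rightarrow> nat" where
  "first_denominator \<epsilon> t = (LEAST k. 1 \<le> k \<and> (\<exists>a::int. \<bar>real k * t - of_int a\<bar> \<le> \<epsilon>))"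

lemma first_denominator_ex:
  assumes "\<epsilon> > 0"
  shows "\<exists>k\<ge>1. \<exists>a::int. \<bar>real k * t - of_int a\<bar> \<le> \<epsilon>"
proof -
  define N where "N = nat \<lceil>1 / \<epsilon>\<rceil>"
  have N: "real N \<ge> 1 / \<epsilon>" "N > 0" using assms unfolding N_def by (auto simp: of_nat_ceiling)
  obtain h k where hk: "0 < k" "k \<le> int N" "\<bar>of_int k * t - of_int h\<bar> < 1 / real N"
    by (rule Dirichlet_approx[OF N(2), of t])
  have "1 / real N \<le> \<epsilon>" using N assms by (simp add: field_simps)
  then have "\<bar>real (nat k) * t - of_int h\<bar> \<le> \<epsilon>" using hk by simp
  then show ?thesis using hk by (intro exI[of _ "nat k"]) auto
qed

lemma first_denominator_props:
  assumes "\<epsilon> > 0"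
  shows "1 \<le> first_denominator \<epsilon> t"
    and "\<exists>a::int. \<bar>real (first_denominator \<epsilon> t) * t - of_int a\<bar> \<le> \<epsilon>"
    and "\<And>s (p::int). 1 \<le> s \<Longrightarrow> \<bar>real s * t - of_int p\<bar> \<le> \<epsilon> \<Longrightarrow> first_denominator \<epsilon> t \<le> s"
proof -
  let ?P = "\<lambda>k. 1 \<le> k \<and> (\<exists>a::int. \<bar>real k * t - of_int a\<bar> \<le> \<epsilon>)"
  have "?P (first_denominator \<epsilon> t)"
    unfolding first_denominator_def using first_denominator_ex[OF assms, of t] by (rule LeastI_ex)
  then show "1 \<le> first_denominator \<epsilon> t" "\<exists>a::int. \<bar>real (first_denominator \<epsilon> t) * t - of_int a\<bar> \<le> \<epsilon>"
    by auto
  show "first_denominator \<epsilon> t \<le> s" if "1 \<le> s" "\<bar>real s * t - of_int p\<bar> \<le> \<epsilon>" for s and p :: int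
    unfolding first_denominator_def by (rule Least_le) (use that in blast)
qed

lemma first_denominator_eqI:
  assumes "\<epsilon> > 0" "k \<ge> 1" "\<bar>real k * t - of_int a\<bar> \<le> \<epsilon>"
    and "\<And>s (p::int). 1 \<le> s \<Longrightarrow> s < k \<Longrightarrow> \<bar>real s * t - of_int p\<bar> > \<epsilon>"
  shows "first_denominator \<epsilon> t = k"
proof -
  have "first_denominator \<epsilon> t \<le> k" using first_denominator_props(3)[OF assms(1-3)] .
  moreover have "\<not> first_denominator \<epsilon> t < k"
    using first_denominator_props(1,2)[OF assms(1), of t] assms(4) by (meson not_le)
  ultimately show ?thesis by simp
qed

lemma first_denominator_minus: "first_denominator \<epsilon> (- t) = first_denominator \<epsilon> t"
proof -
  have "(\<exists>a::int. \<bar>real k * (- t) - of_int a\<bar> \<le> \<epsilon>) \<longleftrightarrow> (\<exists>a::int. \<bar>real k * t - of_int a\<bar> \<le> \<epsilon>)" for k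
  proof
    assume "\<exists>a::int. \<bar>real k * (- t) - of_int a\<bar> \<le> \<epsilon>"
    then obtain a :: int where "\<bar>real k * (- t) - of_int a\<bar> \<le> \<epsilon>" by blast
    then show "\<exists>a::int. \<bar>real k * t - of_int a\<bar> \<le> \<epsilon>" by (intro exI[of _ "- a"]) (simp add: abs_le_iff)
  next
    assume "\<exists>a::int. \<bar>real k * t - of_int a\<bar> \<le> \<epsilon>"
    then obtain a :: int where "\<bar>real k * t - of_int a\<bar> \<le> \<epsilon>" by blast
    then show "\<exists>a::int. \<bar>real k * (- t) - of_int a\<bar> \<le> \<epsilon>" by (intro exI[of _ "- a"]) (simp add: abs_le_iff)
  qed
  then show ?thesis by (simp only: first_denominator_def)
qed

lemma first_denominator_measurable [measurable]:
  "first_denominator \<epsilon> \<in> borel \<rightarrow>\<^sub>M count_space UNIV"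
proof -
  have "Measurable.pred borel (\<lambda>t. \<bar>real k * t - of_int a\<bar> \<le> \<epsilon>)" for k and a :: int
    by measurable
  then have "Measurable.pred borel (\<lambda>t. \<exists>a::int. \<bar>real k * t - of_int a\<bar> \<le> \<epsilon>)" for k
    by (intro pred_intros_countable)
  then have "Measurable.pred borel (\<lambda>t. 1 \<le> k \<and> (\<exists>a::int. \<bar>real k * t - of_int a\<bar> \<le> \<epsilon>))" for k
    by (cases "1 \<le> k") simp_all
  then show ?thesis unfolding first_denominator_def[abs_def] by (rule measurable_Least)
qed

text \<open>
  A common factor of \<open>a\<close> and \<open>k\<close> could be cancelled, which gives a smaller denominator.
\<close>

lemma first_denominator_coprime:
  assumes "\<epsilon> > 0" "first_denominator \<epsilon> t = k" "\<bar>real k * t - of_int a\<bar> \<le> \<epsilon>"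
  shows "coprime a (int k)"
proof -
  define d where "d = gcd a (int k)"
  have k: "k \<ge> 1" using first_denominator_props(1)[OF assms(1), of t] assms(2) by simp
  have d1: "d \<ge> 1" using k by (simp add: d_def int_one_le_iff_zero_less)
  obtain b c where b: "a = d * b" and c: "int k = d * c" unfolding d_def by (meson dvdE gcd_dvd1 gcd_dvd2)
  have c0: "c > 0" using c d1 k by (metis of_nat_0_less_iff zero_less_mult_pos less_le_trans zero_less_one)
  have "real k = real_of_int d * real_of_int c" using c by (metis of_int_mult of_int_of_nat_eq)
  then have "real k * t - of_int a = real_of_int d * (real_of_int c * t - of_int b)"
    by (simp add: b algebra_simps)
  then have "real_of_int d * \<bar>real_of_int c * t - of_int b\<bar> = \<bar>real k * t - of_int a\<bar>"
    using d1 by (simp add: abs_mult)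
  then have "real_of_int d * \<bar>real_of_int c * t - of_int b\<bar> \<le> \<epsilon>" using assms(3) by simp
  moreover have "1 * \<bar>real_of_int c * t - of_int b\<bar> \<le> real_of_int d * \<bar>real_of_int c * t - of_int b\<bar>"
    using d1 by (intro mult_right_mono) auto
  ultimately have "\<bar>real (nat c) * t - of_int b\<bar> \<le> \<epsilon>" using c0 by simp
  then have "k \<le> nat c" using first_denominator_props(3)[OF assms(1), of "nat c" t b] c0 assms(2) by simp
  then have "int k \<le> c" using c0 by linarith
  then have "d * c \<le> 1 * c" using c by simp
  then have "d = 1" using d1 c0 by simp
  then show ?thesis by (simp add: d_def coprime_iff_gcd_eq_1)
qed

definition right_arc :: "real \<Rightarrow> nat \<Rightarrow> int \<Rightarrow> real set" where
  "right_arc \<epsilon> k a = {t. 0 \<le> real k * t - of_int a \<and> real k * t - of_int a \<le> \<epsilon> \<and> first_denominator \<epsilon> t = k}"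

definition left_arc :: "real \<Rightarrow> nat \<Rightarrow> int \<Rightarrow> real set" where
  "left_arc \<epsilon> k a = {t. - \<epsilon> \<le> real k * t - of_int a \<and> real k * t - of_int a \<le> 0 \<and> first_denominator \<epsilon> t = k}"

text \<open>
  With \<open>w = k t - a\<close>, the neighbour of denominator \<open>s\<^sub>0\<close> on the right is within \<open>\<epsilon>\<close> exactly when
  \<open>s\<^sub>0 w \<ge> 1 - k \<epsilon>\<close>. No other denominator below \<open>k\<close> can come earlier.
\<close>

lemma right_arc_eq:
  assumes e: "\<epsilon> > 0" "\<epsilon> < 1/2" and s0: "1 \<le> s0" "s0 \<le> k" "int k dvd a * int s0 + 1"
  shows "right_arc \<epsilon> k a = {t. 0 \<le> real k * t - of_int a \<and> real k * t - of_int a \<le> \<epsilon> \<and>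
    real s0 * (real k * t - of_int a) < 1 - real k * \<epsilon>}"
proof (cases "k = 1")
  case True
  have "first_denominator \<epsilon> t = 1" if "0 \<le> t - of_int a" "t - of_int a \<le> \<epsilon>" for t
    using e that by (intro first_denominator_eqI[of _ _ _ a]) auto
  moreover have "s0 = 1" using s0 True by simp
  ultimately show ?thesis using e True unfolding right_arc_def by force
next
  case False
  then have k2: "k \<ge> 2" using s0 by simp
  have s0k: "s0 < k"
  proof (rule ccontr)
    assume "\<not> s0 < k"
    then have "s0 = k" using s0 by simp
    then have "int k dvd 1" using s0(3) by (metis dvd_add_right_iff dvd_triv_right)
    then show False using k2 by simp
  qed
  obtain a0 where a0: "a * int s0 + 1 = int k * a0" using s0(3) by blast
  have cop: "coprime a (int k)"
  proof (rule coprimeI)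
    fix c assume "c dvd a" "c dvd int k"
    then have "c dvd int k * a0 - a * int s0" by (intro dvd_diff dvd_mult2)
    then show "is_unit c" using a0 by (metis add_diff_cancel_left' )
  qed
  have kr: "real k > 0" using k2 by simp
  show ?thesis
  proof (intro equalityI subsetI)
    fix t assume t: "t \<in> right_arc \<epsilon> k a"
    define w where "w = real k * t - of_int a"
    have w: "0 \<le> w" "w \<le> \<epsilon>" and first: "first_denominator \<epsilon> t = k"
      using t by (auto simp: right_arc_def w_def)
    have "\<not> \<bar>real s0 * t - of_int a0\<bar> \<le> \<epsilon>"
      using first_denominator_props(3)[OF e(1) s0(1), of t a0] first s0k by auto
    then have "real k * \<epsilon> < real k * \<bar>real s0 * t - of_int a0\<bar>" using kr by simp
    also have "\<dots> = \<bar>real k * (real s0 * t - of_int a0)\<bar>" by (simp add: abs_mult)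
    also have "real k * (real s0 * t - of_int a0) = real s0 * w - 1"
    proof -
      have "real_of_int (a * int s0 + 1) = real_of_int (int k * a0)" using a0 by simp
      then show ?thesis by (simp add: w_def algebra_simps)
    qed
    finally have 1: "real k * \<epsilon> < \<bar>real s0 * w - 1\<bar>" .
    have "real s0 * w \<le> real k * \<epsilon>" using w s0k by (intro mult_mono) auto
    then have "real s0 * w < 1 - real k * \<epsilon>" using 1 by linarith
    then show "t \<in> {t. 0 \<le> real k * t - of_int a \<and> real k * t - of_int a \<le> \<epsilon> \<and>
      real s0 * (real k * t - of_int a) < 1 - real k * \<epsilon>}" using w by (simp add: w_def)
  next
    fix t assume t: "t \<in> {t. 0 \<le> real k * t - of_int a \<and> real k * t - of_int a \<le> \<epsilon> \<and>
      real s0 * (real k * t - of_int a) < 1 - real k * \<epsilon>}"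
    define w where "w = real k * t - of_int a"
    have w: "0 \<le> w" "w \<le> \<epsilon>" and sw: "real s0 * w < 1 - real k * \<epsilon>" using t by (auto simp: w_def)
    have ke: "real k * \<epsilon> < 1" using sw w mult_nonneg_nonneg[of "real s0" w] by linarith
    have "first_denominator \<epsilon> t = k"
    proof (rule first_denominator_eqI[OF e(1), of _ _ a])
      show "1 \<le> k" using k2 by simp
      show "\<bar>real k * t - of_int a\<bar> \<le> \<epsilon>" using w by (simp add: w_def)
      fix s :: nat and p :: int assume s: "1 \<le> s" "s < k"
      define n where "n = p * int k - int s * a"
      have eq: "real k * (real s * t - of_int p) = real s * w - of_int n"
        by (simp add: n_def w_def algebra_simps)
      have sw': "0 \<le> real s * w" "real s * w \<le> real k * \<epsilon>" using w s by (auto intro!: mult_mono)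
      have "n \<noteq> 0"
      proof
        assume "n = 0"
        then have "int k dvd int s * a" by (metis n_def dvd_triv_right eq_iff_diff_eq_0)
        then have "int k dvd int s" using cop by (simp add: coprime_commute coprime_dvd_mult_left_iff)
        then show False using s by (auto dest: zdvd_imp_le)
      qed
      \<comment> \<open>Numerator difference \<open>1\<close> forces \<open>s = s0\<close>; every other difference leaves a larger gap.\<close>
      have "real k * \<epsilon> < \<bar>real s * w - of_int n\<bar>"
      proof (cases "n = 1")
        case True
        have "int k dvd int s - int s0"
        proof -
          have "a * (int s - int s0) = (p * int k - 1) - (int k * a0 - 1)"
            using True a0 by (simp add: n_def algebra_simps)
          also have "\<dots> = int k * (p - a0)" by (simp add: algebra_simps)
          finally have "int k dvd a * (int s - int s0)" by simp
          then show ?thesis using cop by (simp add: coprime_commute coprime_dvd_mult_right_iff)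
        qed
        moreover have "\<bar>int s - int s0\<bar> < int k" using s s0k by linarith
        ultimately have "int s - int s0 = 0" using dvd_imp_le_int[of "int s - int s0" "int k"] by fastforce
        then have "s = s0" by simp
        then show ?thesis using True sw by simp
      next
        case False
        then consider "n \<le> -1" | "n \<ge> 2" using \<open>n \<noteq> 0\<close> by linarith
        then show ?thesis
        proof cases
          case 1
          then have "real_of_int n \<le> -1" by linarith
          then show ?thesis using sw' ke by linarith
        next
          case 2
          then have "real_of_int n \<ge> 2" by linarith
          then show ?thesis using sw' ke by linarith
        qed
      qed
      then have "real k * \<epsilon> < real k * \<bar>real s * t - of_int p\<bar>"
        unfolding eq[symmetric] by (simp add: abs_mult)
      then show "\<epsilon> < \<bar>real s * t - of_int p\<bar>" using kr by simp
    qed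
    then show "t \<in> right_arc \<epsilon> k a" using w by (simp add: right_arc_def w_def)
  qed
qed

lemma left_arc_eq_image: "left_arc \<epsilon> k a = uminus ` right_arc \<epsilon> k (- a)"
proof (intro equalityI subsetI)
  fix t assume "t \<in> left_arc \<epsilon> k a"
  then have "- t \<in> right_arc \<epsilon> k (- a)"
    by (simp add: left_arc_def right_arc_def first_denominator_minus)
  then show "t \<in> uminus ` right_arc \<epsilon> k (- a)" by (metis imageI minus_minus)
next
  fix t assume "t \<in> uminus ` right_arc \<epsilon> k (- a)"
  then obtain u where "t = - u" "u \<in> right_arc \<epsilon> k (- a)" by blast
  then show "t \<in> left_arc \<epsilon> k a"
    by (simp add: left_arc_def right_arc_def first_denominator_minus)
qed

lemma first_denominator_fibre_borel [measurable]: "{t. first_denominator \<epsilon> t = k} \<in> sets borel"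
proof -
  have "first_denominator \<epsilon> -` {k} \<inter> space borel \<in> sets borel"
    by (rule measurable_sets[OF first_denominator_measurable]) simp
  then show ?thesis by (simp add: vimage_def)
qed

lemma arc_in_borel:
  "{t. c \<le> real k * t - b \<and> real k * t - b \<le> d \<and> first_denominator \<epsilon> t = k} \<in> sets borel"
proof -
  have "closed {t. c \<le> real k * t - b}" "closed {t. real k * t - b \<le> d}"
    by (intro closed_Collect_le continuous_intros)+
  then have "{t. c \<le> real k * t - b} \<inter> {t. real k * t - b \<le> d} \<inter> {t. first_denominator \<epsilon> t = k} \<in> sets borel"
    by (intro sets.Int first_denominator_fibre_borel) auto
  moreover have "{t. c \<le> real k * t - b \<and> real k * t - b \<le> d \<and> first_denominator \<epsilon> t = k}
      = {t. c \<le> real k * t - b} \<inter> {t. real k * t - b \<le> d} \<inter> {t. first_denominator \<epsilon> t = k}" by blast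
  ultimately show ?thesis by (simp only:)
qed

lemma arcs_in_borel [measurable]: "right_arc \<epsilon> k a \<in> sets borel" "left_arc \<epsilon> k a \<in> sets borel"
  unfolding right_arc_def left_arc_def by (rule arc_in_borel)+

text \<open>
  The length of the right arc at \<open>a/k\<close>, multiplied by \<open>k\<close>, when its neighbour has denominator
  \<open>s\<close>. It vanishes for \<open>k \<ge> 1/\<epsilon>\<close>.
\<close>

definition arc_gap :: "real \<Rightarrow> nat \<Rightarrow> nat \<Rightarrow> real" where
  "arc_gap \<epsilon> k s = max 0 (min \<epsilon> ((1 - real k * \<epsilon>) / real s))"

lemma inverse_residue_ex1:
  assumes "coprime a (int k)" "k \<ge> 1"
  shows "\<exists>s. {s \<in> {1..k}. int k dvd a * int s + 1} = {s}"
proof -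
  obtain z where z: "[a * z = 1] (mod int k)" using assms cong_solve_coprime_int by blast
  define s where "s = (if (- z) mod int k = 0 then k else nat ((- z) mod int k))"
  have r: "0 \<le> (- z) mod int k" "(- z) mod int k < int k" using assms by auto
  have s_range: "s \<in> {1..k}" 
  proof (cases "(- z) mod int k = 0")
    case False
    then have "1 \<le> (- z) mod int k" using r by linarith
    then show ?thesis using r False by (simp add: s_def) linarith
  qed (use assms in \<open>simp add: s_def\<close>)
  have "[int s = - z] (mod int k)" using r by (auto simp: s_def cong_def)
  then have "[a * int s = a * (- z)] (mod int k)" by (rule cong_scalar_left)
  also have "[a * (- z) = - 1] (mod int k)" using z by (simp add: cong_minus_minus_iff)
  finally have s_dvd: "int k dvd a * int s + 1" by (simp add: cong_iff_dvd_diff)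
  have "s' = s" if s': "s' \<in> {1..k}" "int k dvd a * int s' + 1" for s'
  proof -
    have "int k dvd (a * int s' + 1) - (a * int s + 1)" using s'(2) s_dvd by (rule dvd_diff)
    then have "int k dvd a * (int s' - int s)" by (simp add: algebra_simps)
    then have "int k dvd int s' - int s" using assms by (simp add: coprime_commute coprime_dvd_mult_right_iff)
    moreover have "\<bar>int s' - int s\<bar> < int k" using s'(1) s_range by auto
    ultimately have "int s' - int s = 0" using dvd_imp_le_int[of "int s' - int s" "int k"] by fastforce
    then show ?thesis by simp
  qed
  then have "{s \<in> {1..k}. int k dvd a * int s + 1} = {s}" using s_range s_dvd by blast
  then show ?thesis by blast
qed

text \<open>
  The sum has one term if \<open>a\<close> is coprime to \<open>k\<close>, and is empty otherwise, as is the arc. Written as a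
  sum over \<open>s\<close>, the total length of the arcs becomes a weighted count of modular inverses.
\<close>

lemma measure_right_arc:
  assumes e: "\<epsilon> > 0" "\<epsilon> < 1/2" and k: "k \<ge> 1"
  shows "measure lborel (right_arc \<epsilon> k a) = (\<Sum>s | s \<in> {1..k} \<and> int k dvd a * int s + 1. arc_gap \<epsilon> k s) / real k"
proof (cases "coprime a (int k)")
  case False
  have "right_arc \<epsilon> k a = {}"
  proof -
    have "coprime a (int k)" if "t \<in> right_arc \<epsilon> k a" for t
      using that by (intro first_denominator_coprime[OF e(1), of t]) (auto simp: right_arc_def)
    then show ?thesis using False by blast
  qed
  moreover have "{s \<in> {1..k}. int k dvd a * int s + 1} = {}"
  proof -
    have "coprime a (int k)" if "int k dvd a * int s + 1" for s
    proof (rule coprimeI)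
      fix c assume "c dvd a" "c dvd int k"
      then have "c dvd (a * int s + 1) - a * int s" using that by (intro dvd_diff) (auto intro: dvd_trans)
      then show "is_unit c" by simp
    qed
    then show ?thesis using False by auto
  qed
  ultimately show ?thesis by (simp only: measure_empty sum.empty div_0)
next
  case True
  then obtain s where s: "{s \<in> {1..k}. int k dvd a * int s + 1} = {s}"
    using inverse_residue_ex1 k by blast
  then have s1: "1 \<le> s" "s \<le> k" "int k dvd a * int s + 1" by auto
  have kr: "real k > 0" and sr: "real s > 0" using k s1 by auto
  have arc: "right_arc \<epsilon> k a = {t. 0 \<le> real k * t - of_int a \<and> real k * t - of_int a \<le> \<epsilon> \<and>
    real s * (real k * t - of_int a) < 1 - real k * \<epsilon>}"
    by (rule right_arc_eq[OF e s1])
  define L where "L = of_int a / real k"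
  define g where "g = (1 - real k * \<epsilon>) / real s"
  have gap: "arc_gap \<epsilon> k s = max 0 (min \<epsilon> g)" by (simp add: arc_gap_def g_def)
  have w_iff: "0 \<le> real k * t - of_int a \<longleftrightarrow> L \<le> t" "real k * t - of_int a \<le> x \<longleftrightarrow> t \<le> L + x / real k"
    "real k * t - of_int a < x \<longleftrightarrow> t < L + x / real k" for t x
    using kr by (auto simp: L_def field_simps)
  have s_iff: "real s * (real k * t - of_int a) < 1 - real k * \<epsilon> \<longleftrightarrow> real k * t - of_int a < g" for t
    using sr by (simp add: g_def field_simps)
  have arc': "right_arc \<epsilon> k a = {L..L + \<epsilon> / real k} \<inter> {..<L + g / real k}"
    unfolding arc s_iff w_iff by auto
  have "measure lborel (right_arc \<epsilon> k a) = arc_gap \<epsilon> k s / real k"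
  proof (cases "g \<le> 0")
    case True
    then have "g / real k \<le> 0" using kr by (intro divide_nonpos_pos)
    then have "right_arc \<epsilon> k a = {}" unfolding arc' by auto
    then show ?thesis using True e by (simp add: gap max_def min_def)
  next
    case False
    show ?thesis
    proof (cases "\<epsilon> < g")
      case True
      then have "\<epsilon> / real k < g / real k" using kr by (simp add: divide_strict_right_mono)
      then have "right_arc \<epsilon> k a = {L..L + \<epsilon> / real k}" unfolding arc' by auto
      then show ?thesis using True e kr by (simp add: gap max_def min_def)
    next
      case F: False
      then have "g / real k \<le> \<epsilon> / real k" using kr by (simp add: divide_right_mono)
      then have "right_arc \<epsilon> k a = {L..<L + g / real k}" unfolding arc' by auto
      moreover have "0 \<le> g / real k" using False kr by simp
      ultimately show ?thesis using F False by (simp add: gap max_def min_def)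
    qed
  qed
  then show ?thesis unfolding s by (simp only: sum.insert[of "{}"] sum.empty finite.emptyI empty_iff not_False_eq_True add_0_right)
qed

lemma measure_left_arc:
  assumes e: "\<epsilon> > 0" "\<epsilon> < 1/2" and k: "k \<ge> 1"
  shows "measure lborel (left_arc \<epsilon> k a) = (\<Sum>s | s \<in> {1..k} \<and> int k dvd a * int s - 1. arc_gap \<epsilon> k s) / real k"
proof -
  have "measure lborel (left_arc \<epsilon> k a) = measure lborel (right_arc \<epsilon> k (- a))"
  proof -
    have "left_arc \<epsilon> k a = uminus -` right_arc \<epsilon> k (- a)"
      unfolding left_arc_eq_image by (auto intro: image_eqI[of _ _ "- _"])
    then have "measure lborel (left_arc \<epsilon> k a) = measure (distr lborel borel uminus) (right_arc \<epsilon> k (- a))"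
      by (subst measure_distr) auto
    then show ?thesis by (simp only: lborel_distr_uminus)
  qed
  also have "\<dots> = (\<Sum>s | s \<in> {1..k} \<and> int k dvd (- a) * int s + 1. arc_gap \<epsilon> k s) / real k"
    by (rule measure_right_arc[OF assms])
  also have "{s. s \<in> {1..k} \<and> int k dvd (- a) * int s + 1} = {s. s \<in> {1..k} \<and> int k dvd a * int s - 1}"
  proof -
    have "(- a) * int s + 1 = - (a * int s - 1)" for s by simp
    then show ?thesis by (simp only: dvd_minus_iff)
  qed
  finally show ?thesis .
qed

text \<open>
  An arc of first denominator \<open>k\<close> is non-empty only if \<open>1 - k \<epsilon>\<close> is positive.
\<close>

lemma first_denominator_less:
  assumes e: "\<epsilon> > 0" "\<epsilon> < 1/2"
  shows "real (first_denominator \<epsilon> t) * \<epsilon> < 1"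
proof -
  have right: "real k * \<epsilon> < 1" if "t \<in> right_arc \<epsilon> k a" for k a t
  proof -
    have t: "0 \<le> real k * t - of_int a" "real k * t - of_int a \<le> \<epsilon>" "first_denominator \<epsilon> t = k"
      using that unfolding right_arc_def by blast+
    have "coprime a (int k)" using t(1,2) by (intro first_denominator_coprime[OF e(1) t(3)]) simp
    moreover have "k \<ge> 1" using first_denominator_props(1)[OF e(1), of t] unfolding t(3) .
    ultimately obtain s where "{s \<in> {1..k}. int k dvd a * int s + 1} = {s}" using inverse_residue_ex1 by blast
    then have s: "1 \<le> s" "s \<le> k" "int k dvd a * int s + 1" by auto
    have "real s * (real k * t - of_int a) < 1 - real k * \<epsilon>"
      using that unfolding right_arc_eq[OF e s] by blast
    then show ?thesis using t(1) mult_nonneg_nonneg[of "real s" "real k * t - of_int a"] by linarith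
  qed
  define k where "k = first_denominator \<epsilon> t"
  obtain a :: int where a: "\<bar>real k * t - of_int a\<bar> \<le> \<epsilon>"
    using first_denominator_props(2)[OF e(1), of t] by (auto simp: k_def)
  show ?thesis
  proof (cases "0 \<le> real k * t - of_int a")
    case True
    then have "t \<in> right_arc \<epsilon> k a" using a by (simp add: right_arc_def k_def)
    then show ?thesis using right by (simp add: k_def)
  next
    case False
    then have "t \<in> left_arc \<epsilon> k a" using a by (simp add: left_arc_def k_def)
    then show ?thesis using right unfolding left_arc_eq_image by (auto simp: k_def)
  qed
qed

section \<open>The distribution of the first denominator\<close>

lemma arc_gap_bounds:
  assumes "\<epsilon> > 0" shows "0 \<le> arc_gap \<epsilon> k s" "arc_gap \<epsilon> k s \<le> \<epsilon>"
  using assms by (auto simp: arc_gap_def)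

lemma arc_gap_antimono:
  assumes "1 \<le> i" "i \<le> j" shows "arc_gap \<epsilon> k j \<le> arc_gap \<epsilon> k i"
proof (cases "1 - real k * \<epsilon> \<ge> 0")
  case True
  have "(1 - real k * \<epsilon>) / real j \<le> (1 - real k * \<epsilon>) / real i"
    using True assms by (intro divide_left_mono) auto
  then show ?thesis unfolding arc_gap_def by (intro max.mono min.mono) auto
next
  case False
  then have "(1 - real k * \<epsilon>) / real j \<le> 0" by (intro divide_nonpos_nonneg) auto
  then show ?thesis unfolding arc_gap_def by (simp add: max_def min_def)
qed

lemma sum_arc_gap_asymp:
  assumes e: "\<epsilon> > 0" and k: "k > 0"
  shows "\<bar>(\<Sum>s=1..k. arc_gap \<epsilon> k s) - \<epsilon> * real k * denominator_density (\<epsilon> * real k)\<bar> \<le> 2 * \<epsilon>"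
proof (cases "\<epsilon> * real k < 1")
  case True
  define y where "y = \<epsilon> * real k"
  define l where "l = y / (1 - y)"
  have y: "0 < y" "y < 1" using True e k by (auto simp: y_def)
  have l: "0 \<le> l" using y by (simp add: l_def)
  have gap: "arc_gap \<epsilon> k s = \<epsilon> * (1 / max 1 (l * (real s / real k)))" if "s \<in> {1..k}" for s
  proof -
    have s: "real s > 0" using that by simp
    define z where "z = l * (real s / real k)"
    have z0: "z > 0" using y s k by (simp add: z_def l_def)
    have "(1 - real k * \<epsilon>) / real s = \<epsilon> / z"
      using y s k e unfolding z_def l_def y_def by (simp add: field_simps)
    moreover have "max 0 (min \<epsilon> (\<epsilon> / z)) = \<epsilon> * (1 / max 1 z)"
    proof (cases "z \<le> 1")
      case True
      then have "\<epsilon> \<le> \<epsilon> / z" using e z0 by (simp add: field_simps)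
      then show ?thesis using True e by (simp add: max_def min_def)
    next
      case False
      then have "\<epsilon> / z \<le> \<epsilon>" using e z0 by (simp add: field_simps)
      then show ?thesis using False e z0 by (simp add: max_def min_def)
    qed
    ultimately show ?thesis by (simp add: arc_gap_def z_def)
  qed
  have "(\<Sum>s=1..k. arc_gap \<epsilon> k s) = \<epsilon> * (\<Sum>s=1..k. 1 / max 1 (l * (real s / real k)))"
    unfolding sum_distrib_left by (intro sum.cong refl gap)
  then have "(\<Sum>s=1..k. arc_gap \<epsilon> k s) - \<epsilon> * real k * ratio_mean l
      = \<epsilon> * ((\<Sum>s=1..k. 1 / max 1 (l * (real s / real k))) - real k * ratio_mean l)"
    by (simp add: right_diff_distrib)
  then have "\<bar>(\<Sum>s=1..k. arc_gap \<epsilon> k s) - \<epsilon> * real k * ratio_mean l\<bar>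
      = \<epsilon> * \<bar>(\<Sum>s=1..k. 1 / max 1 (l * (real s / real k))) - real k * ratio_mean l\<bar>"
    using e by (simp add: abs_mult)
  also have "\<dots> \<le> \<epsilon> * 2" using ratio_mean_riemann[OF l k] e by (intro mult_left_mono) auto
  finally show ?thesis using True by (simp add: denominator_density_def l_def y_def)
next
  case False
  have "arc_gap \<epsilon> k s = 0" for s
  proof -
    have "(1 - real k * \<epsilon>) / real s \<le> 0"
      using False by (intro divide_nonpos_nonneg) (auto simp: mult.commute)
    then show ?thesis by (simp add: arc_gap_def max_def min_def)
  qed
  then show ?thesis using False e by (simp add: denominator_density_def)
qed

lemma sum_arcs_eq_box_sum:
  assumes "\<And>a. M a = (\<Sum>s | s \<in> {1..k} \<and> int k dvd a * int s - \<sigma>. arc_gap \<epsilon> k s) / real k"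
  shows "(\<Sum>a=1..X. M (int a)) =
    (\<Sum>s=1..k. real (card {a \<in> {1..X}. int k dvd int a * int s - \<sigma>}) * arc_gap \<epsilon> k s) / real k"
proof -
  have "(\<Sum>a=1..X. M (int a)) = (\<Sum>a=1..X. \<Sum>s | s \<in> {1..k} \<and> int k dvd int a * int s - \<sigma>. arc_gap \<epsilon> k s) / real k"
    unfolding assms sum_divide_distrib ..
  also have "(\<Sum>a=1..X. \<Sum>s | s \<in> {1..k} \<and> int k dvd int a * int s - \<sigma>. arc_gap \<epsilon> k s)
      = (\<Sum>s=1..k. \<Sum>a | a \<in> {1..X} \<and> int k dvd int a * int s - \<sigma>. arc_gap \<epsilon> k s)"
    by (rule sum.swap_restrict) auto
  finally show ?thesis by simp
qed

lemma sum_box_columns: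
  "(\<Sum>s=1..Y. real (card {a \<in> {1..X}. int k dvd int a * int s - \<sigma>})) = real (box_count k \<sigma> X Y)"
proof -
  have "box_count k \<sigma> X Y = card (Sigma {1..Y} (\<lambda>s. {a \<in> {1..X}. int k dvd int a * int s - \<sigma>}))"
    unfolding box_count_def
    by (rule bij_betw_same_card[of prod.swap])
       (auto simp: bij_betw_def inj_on_def image_iff)
  then show ?thesis by simp
qed

text \<open>
  The weight decreases in \<open>s\<close> and is at most \<open>\<epsilon>\<close>, so partial summation transfers the discrepancy of
  the box counts to the weighted count.
\<close>

lemma sum_arcs_asymp:
  assumes e: "\<epsilon> > 0" and k: "k > 0" and cop: "coprime \<sigma> (int k)" and X: "X \<le> k"
    and M: "\<And>a. M a = (\<Sum>s | s \<in> {1..k} \<and> int k dvd a * int s - \<sigma>. arc_gap \<epsilon> k s) / real k"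
    and E: "\<And>Y. Y \<le> k \<Longrightarrow> \<bar>real (box_count k \<sigma> X Y) - real X * real Y * real (totient k) / real k ^ 2\<bar> \<le> E"
  shows "\<bar>(\<Sum>a=1..X. M (int a)) - real X * real (totient k) / real k ^ 3 * (\<Sum>s=1..k. arc_gap \<epsilon> k s)\<bar> \<le> E * \<epsilon> / real k"
proof -
  define c where "c = real X * real (totient k) / real k ^ 2"
  define b where "b = (\<lambda>s. real (card {a \<in> {1..X}. int k dvd int a * int s - \<sigma>}) - c)"
  have E0: "E \<ge> 0" using E[of 0] by (simp add: box_count_def)
  have "\<bar>\<Sum>s=1..k. b s * arc_gap \<epsilon> k s\<bar> \<le> E * arc_gap \<epsilon> k 1"
  proof (rule abel_sum_decreasing[OF _ k])
    fix Y assume Y: "Y \<le> k"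
    have "(\<Sum>s=1..Y. b s) = real (box_count k \<sigma> X Y) - real X * real Y * real (totient k) / real k ^ 2"
      unfolding b_def sum_subtractf sum_box_columns by (simp add: c_def)
    then show "\<bar>\<Sum>s=1..Y. b s\<bar> \<le> E" using E[OF Y] by simp
  qed (use arc_gap_antimono arc_gap_bounds e in auto)
  also have "\<dots> \<le> E * \<epsilon>" using E0 e by (intro mult_left_mono arc_gap_bounds) auto
  finally have 1: "\<bar>\<Sum>s=1..k. b s * arc_gap \<epsilon> k s\<bar> \<le> E * \<epsilon>" .
  have "(\<Sum>a=1..X. M (int a)) - real X * real (totient k) / real k ^ 3 * (\<Sum>s=1..k. arc_gap \<epsilon> k s)
      = (\<Sum>s=1..k. b s * arc_gap \<epsilon> k s) / real k"
  proof -
    have "(\<Sum>s=1..k. b s * arc_gap \<epsilon> k s) =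
        (\<Sum>s=1..k. real (card {a \<in> {1..X}. int k dvd int a * int s - \<sigma>}) * arc_gap \<epsilon> k s) - c * (\<Sum>s=1..k. arc_gap \<epsilon> k s)"
      by (simp add: b_def left_diff_distrib sum_subtractf sum_distrib_left)
    moreover have "real X * real (totient k) / real k ^ 3 = c / real k"
      by (simp add: c_def power3_eq_cube power2_eq_square)
    ultimately show ?thesis
      unfolding sum_arcs_eq_box_sum[of M, OF M] by (simp add: diff_divide_distrib)
  qed
  then have "\<bar>(\<Sum>a=1..X. M (int a)) - real X * real (totient k) / real k ^ 3 * (\<Sum>s=1..k. arc_gap \<epsilon> k s)\<bar>
      = \<bar>\<Sum>s=1..k. b s * arc_gap \<epsilon> k s\<bar> / real k" by (simp add: abs_divide)
  also have "\<dots> \<le> E * \<epsilon> / real k" using 1 by (intro divide_right_mono) auto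
  finally show ?thesis .
qed

lemma nat_floor_bounds:
  fixes y :: real
  assumes "0 \<le> y" shows "real (nat \<lfloor>y\<rfloor>) \<le> y" "y < real (nat \<lfloor>y\<rfloor>) + 1"
proof -
  have "real (nat \<lfloor>y\<rfloor>) = of_int \<lfloor>y\<rfloor>" using assms by simp
  then show "real (nat \<lfloor>y\<rfloor>) \<le> y" "y < real (nat \<lfloor>y\<rfloor>) + 1" by linarith+
qed

definition denominator_measure :: "real \<Rightarrow> nat \<Rightarrow> real \<Rightarrow> real" where
  "denominator_measure \<epsilon> k x = measure lborel {t \<in> {0..x}. first_denominator \<epsilon> t = k}"

lemma fmeasurable_bounded_borel:
  fixes A :: "real set"
  assumes "A \<in> sets borel" "A \<subseteq> {a..b}" shows "A \<in> fmeasurable lborel"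
proof (rule fmeasurableI)
  show "A \<in> sets lborel" using assms by simp
  have "emeasure lborel A \<le> emeasure lborel {a..b}" using assms by (intro emeasure_mono) auto
  also have "\<dots> < \<infinity>" by (cases "a \<le> b") auto
  finally show "emeasure lborel A < \<infinity>" .
qed

lemma right_arc_bounded: "k > 0 \<Longrightarrow> right_arc \<epsilon> k a \<subseteq> {of_int a / real k..(of_int a + \<epsilon>) / real k}"
  by (auto simp: right_arc_def field_simps)

lemma left_arc_bounded: "k > 0 \<Longrightarrow> left_arc \<epsilon> k a \<subseteq> {(of_int a - \<epsilon>) / real k..of_int a / real k}"
  by (auto simp: left_arc_def field_simps)

lemma measure_arcs_Union:
  assumes e: "\<epsilon> > 0" "\<epsilon> < 1/2" and k: "k > 0"
  defines "A \<equiv> \<lambda>a::nat. left_arc \<epsilon> k (int a) \<union> right_arc \<epsilon> k (int a)"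
  shows "(\<Union>a\<in>{1..X}. A a) \<in> fmeasurable lborel"
    and "measure lborel (\<Union>a\<in>{1..X}. A a) =
      (\<Sum>a=1..X. measure lborel (left_arc \<epsilon> k (int a))) + (\<Sum>a=1..X. measure lborel (right_arc \<epsilon> k (int a)))"
proof -
  have fL: "left_arc \<epsilon> k a \<in> fmeasurable lborel" and fR: "right_arc \<epsilon> k a \<in> fmeasurable lborel" for a
    using fmeasurable_bounded_borel[OF arcs_in_borel(2) left_arc_bounded[OF k]]
      fmeasurable_bounded_borel[OF arcs_in_borel(1) right_arc_bounded[OF k]] by blast+
  have fA: "A a \<in> fmeasurable lborel" for a unfolding A_def using fL fR by (rule fmeasurable.Un)
  then show "(\<Union>a\<in>{1..X}. A a) \<in> fmeasurable lborel" by (intro fmeasurable.finite_UN) auto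
  have "disjoint_family_on A {1..X}"
    unfolding disjoint_family_on_def
  proof (intro ballI impI, rule ccontr)
    fix a b assume "a \<noteq> b" "A a \<inter> A b \<noteq> {}"
    then obtain t where "t \<in> A a" "t \<in> A b" by blast
    then have "\<bar>real k * t - real a\<bar> \<le> \<epsilon>" "\<bar>real k * t - real b\<bar> \<le> \<epsilon>"
      using e by (auto simp: A_def left_arc_def right_arc_def)
    then have "\<bar>real a - real b\<bar> < 1" using e by linarith
    then show False using \<open>a \<noteq> b\<close> by linarith
  qed
  then have "measure lborel (\<Union>a\<in>{1..X}. A a) = (\<Sum>a=1..X. measure lborel (A a))"
    using fmeasurableD[OF fA] fmeasurableD2[OF fA] by (intro measure_finite_Union) auto
  also have "\<dots> = (\<Sum>a=1..X. measure lborel (left_arc \<epsilon> k (int a)) + measure lborel (right_arc \<epsilon> k (int a)))"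
  proof (intro sum.cong refl)
    fix a
    let ?L = "left_arc \<epsilon> k (int a)" and ?R = "right_arc \<epsilon> k (int a)"
    have "?L \<inter> ?R \<subseteq> {real a / real k}" using k by (auto simp: left_arc_def right_arc_def field_simps)
    then have "?L \<inter> ?R \<in> null_sets lborel"
      by (intro countable_imp_null_set_lborel countable_subset[OF \<open>?L \<inter> ?R \<subseteq> {real a / real k}\<close>]) auto
    then have 0: "measure lborel (?L \<inter> ?R) = 0" by (simp add: measure_def null_setsD1)
    have "measure lborel (?L \<union> ?R) = measure lborel ?L + measure lborel ?R - measure lborel (?L \<inter> ?R)"
      using measure_Un3[OF fL fR] .
    then show "measure lborel (A a) = measure lborel ?L + measure lborel ?R" unfolding A_def 0 by simp
  qed
  also have "\<dots> = (\<Sum>a=1..X. measure lborel (left_arc \<epsilon> k (int a))) + (\<Sum>a=1..X. measure lborel (right_arc \<epsilon> k (int a)))"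
    by (rule sum.distrib)
  finally show "measure lborel (\<Union>a\<in>{1..X}. A a) =
      (\<Sum>a=1..X. measure lborel (left_arc \<epsilon> k (int a))) + (\<Sum>a=1..X. measure lborel (right_arc \<epsilon> k (int a)))" .
qed

text \<open>
  Only the arcs around \<open>0\<close> and around \<open>x\<close> are cut off by the endpoints of \<open>[0, x]\<close>.
\<close>

lemma denominator_measure_near_arcs:
  assumes e: "\<epsilon> > 0" "\<epsilon> < 1/2" and k: "k > 0" and x: "0 \<le> x"
  defines "X \<equiv> nat \<lfloor>real k * x\<rfloor>"
  shows "\<bar>denominator_measure \<epsilon> k x -
      ((\<Sum>a=1..X. measure lborel (left_arc \<epsilon> k (int a))) + (\<Sum>a=1..X. measure lborel (right_arc \<epsilon> k (int a))))\<bar>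
    \<le> 2 * \<epsilon> / real k"
proof -
  define A where "A = (\<lambda>a::nat. left_arc \<epsilon> k (int a) \<union> right_arc \<epsilon> k (int a))"
  define U where "U = (\<Union>a\<in>{1..X}. A a)"
  define D where "D = {t \<in> {0..x}. first_denominator \<epsilon> t = k}"
  have U: "U \<in> fmeasurable lborel" and mU: "measure lborel U =
      (\<Sum>a=1..X. measure lborel (left_arc \<epsilon> k (int a))) + (\<Sum>a=1..X. measure lborel (right_arc \<epsilon> k (int a)))"
    unfolding U_def A_def using measure_arcs_Union[OF e k] by blast+
  have D_int: "D = {0..x} \<inter> {t. first_denominator \<epsilon> t = k}" by (auto simp: D_def)
  have "D \<in> sets borel" unfolding D_int by (intro sets.Int first_denominator_fibre_borel) auto
  then have D: "D \<in> fmeasurable lborel" by (rule fmeasurable_bounded_borel[of _ 0 x]) (auto simp: D_def)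
  define d where "d = \<epsilon> / real k"
  have d: "d > 0" using e k by (simp add: d_def)
  have I: "{u..v} \<in> fmeasurable lborel" for u v :: real by (rule fmeasurable_bounded_borel[of _ u v]) auto
  have kr: "real k > 0" using k by simp
  have X: "real X \<le> real k * x" "real k * x < real X + 1"
    unfolding X_def by (rule nat_floor_bounds, use x kr in simp)+
  have member: "t \<in> A a \<longleftrightarrow> \<bar>real k * t - real a\<bar> \<le> \<epsilon> \<and> first_denominator \<epsilon> t = k" for t a
    using e by (auto simp: A_def left_arc_def right_arc_def)
  have "D \<subseteq> (U \<union> {0..d}) \<union> {x - d..x}"
  proof
    fix t assume "t \<in> D"
    then have t: "0 \<le> t" "t \<le> x" "first_denominator \<epsilon> t = k" by (auto simp: D_def)
    obtain a :: int where a: "\<bar>real k * t - of_int a\<bar> \<le> \<epsilon>"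
      using first_denominator_props(2)[OF e(1), of t] t by auto
    have kt: "0 \<le> real k * t" using t by simp
    then have "real_of_int a > -1" using a e by linarith
    then have a0: "a \<ge> 0" by linarith
    show "t \<in> (U \<union> {0..d}) \<union> {x - d..x}"
    proof (cases "a = 0")
      case True
      then have "t \<le> d" using a kr by (simp add: d_def pos_le_divide_eq mult.commute)
      then show ?thesis using t by simp
    next
      case False
      show ?thesis
      proof (cases "nat a \<le> X")
        case True
        then have "t \<in> A (nat a)" using a t a0 by (simp add: member)
        then show ?thesis unfolding U_def using True False a0 by auto
      next
        case F: False
        then have "real X + 1 \<le> of_int a" using a0 by linarith
        then have "real k * x \<le> real k * t + \<epsilon>" using X a by linarith
        then have "x \<le> t + d" using kr by (simp add: d_def field_simps)
        then show ?thesis using t by simp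
      qed
    qed
  qed
  then have "measure lborel D \<le> measure lborel ((U \<union> {0..d}) \<union> {x - d..x})"
    using D U I by (intro measure_mono_fmeasurable fmeasurable.Un) (auto simp: fmeasurable_def)
  also have "\<dots> \<le> measure lborel U + measure lborel {0..d} + measure lborel {x - d..x}"
    using U I by (intro order_trans[OF measure_Un_le] add_mono measure_Un_le) (auto simp: fmeasurable_def)
  also have "\<dots> = measure lborel U + 2 * d" using d by simp
  finally have up: "measure lborel D \<le> measure lborel U + 2 * d" .
  have "U \<subseteq> D \<union> {x..x + d}"
  proof
    fix t assume "t \<in> U"
    then obtain a where a: "1 \<le> a" "a \<le> X" "t \<in> A a" by (auto simp: U_def)
    then have t: "\<bar>real k * t - real a\<bar> \<le> \<epsilon>" "first_denominator \<epsilon> t = k" by (simp_all add: member)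
    have "real a \<ge> 1" "real a \<le> real X" using a by auto
    then have "real k * t > 0" "real k * t \<le> real k * x + \<epsilon>" using t e X by linarith+
    then have "t > 0" "t \<le> x + d" using kr by (auto simp: zero_less_mult_iff d_def field_simps)
    then show "t \<in> D \<union> {x..x + d}" using t by (auto simp: D_def)
  qed
  then have "measure lborel U \<le> measure lborel (D \<union> {x..x + d})"
    using D U I by (intro measure_mono_fmeasurable fmeasurable.Un) (auto simp: fmeasurable_def)
  also have "\<dots> \<le> measure lborel D + measure lborel {x..x + d}"
    using D I by (intro measure_Un_le) (auto simp: fmeasurable_def)
  also have "\<dots> = measure lborel D + d" using d by simp
  finally have lo: "measure lborel U \<le> measure lborel D + d" .
  have "\<bar>measure lborel D - measure lborel U\<bar> \<le> 2 * d" using up lo d by linarith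
  then show ?thesis unfolding mU by (simp add: denominator_measure_def D_def d_def)
qed

lemma denominator_measure_asymp:
  obtains C where "C \<ge> 1"
    "\<And>\<epsilon> k x. 0 < \<epsilon> \<Longrightarrow> \<epsilon> < 1/2 \<Longrightarrow> k > 0 \<Longrightarrow> 0 \<le> x \<Longrightarrow> x \<le> 1 \<Longrightarrow>
      \<bar>denominator_measure \<epsilon> k x - 2 * x * (\<epsilon> * (real (totient k) / real k * denominator_density (\<epsilon> * real k)))\<bar>
        \<le> C * \<epsilon> * real k powr (-1/5)"
proof -
  obtain B where B: "B \<ge> 1"
    "\<And>k \<sigma> X Y. coprime \<sigma> (int k) \<Longrightarrow> k > 0 \<Longrightarrow> X \<le> k \<Longrightarrow> Y \<le> k \<Longrightarrow>
      \<bar>real (box_count k \<sigma> X Y) - real X * real Y * real (totient k) / real k ^ 2\<bar> \<le> B * real k powr (4/5)"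
    by (rule box_count_discrepancy_bound) blast
  show ?thesis
  proof (rule that[of "10 * B"])
    show "10 * B \<ge> 1" using B(1) by simp
    fix \<epsilon> x :: real and k :: nat
    assume e: "0 < \<epsilon>" "\<epsilon> < 1/2" and k: "k > 0" and x: "0 \<le> x" "x \<le> 1"
    define X where "X = nat \<lfloor>real k * x\<rfloor>"
    define S where "S = (\<Sum>s=1..k. arc_gap \<epsilon> k s)"
    define E where "E = B * real k powr (4/5)"
    define ph where "ph = real (totient k)"
    define dens where "dens = denominator_density (\<epsilon> * real k)"
    define mL where "mL = (\<Sum>a=1..X. measure lborel (left_arc \<epsilon> k (int a)))"
    define mR where "mR = (\<Sum>a=1..X. measure lborel (right_arc \<epsilon> k (int a)))"
    have kr: "real k \<ge> 1" "real k > 0" using k by auto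
    have X0: "real X \<le> real k * x" "real k * x < real X + 1"
      unfolding X_def by (rule nat_floor_bounds, use x kr in simp)+
    have "real k * x \<le> real k * 1" using x kr by (intro mult_left_mono) auto
    then have Xk: "X \<le> k" using X0 by linarith
    have ph: "0 \<le> ph" "ph \<le> real k" unfolding ph_def using totient_le[of k] by auto
    have S: "0 \<le> S" "S \<le> real k * \<epsilon>"
    proof -
      show "0 \<le> S" unfolding S_def by (intro sum_nonneg arc_gap_bounds e)
      have "S \<le> (\<Sum>s=1..k. \<epsilon>)" unfolding S_def by (intro sum_mono arc_gap_bounds e)
      then show "S \<le> real k * \<epsilon>" by simp
    qed
    have L: "\<bar>mL - real X * ph / real k ^ 3 * S\<bar> \<le> E * \<epsilon> / real k"
      unfolding mL_def ph_def S_def E_def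
      by (rule sum_arcs_asymp[where \<sigma> = 1])
         (use e k Xk B(2)[of 1 k X] measure_left_arc[OF e] in auto)
    have R: "\<bar>mR - real X * ph / real k ^ 3 * S\<bar> \<le> E * \<epsilon> / real k"
      unfolding mR_def ph_def S_def E_def
      by (rule sum_arcs_asymp[where \<sigma> = "-1"])
         (use e k Xk B(2)[of "-1" k X] measure_right_arc[OF e] in auto)
    have m: "\<bar>denominator_measure \<epsilon> k x - (mL + mR)\<bar> \<le> 2 * \<epsilon> / real k"
      unfolding mL_def mR_def X_def by (rule denominator_measure_near_arcs[OF e k x(1)])
    have mid: "\<bar>real X * ph / real k ^ 3 * S - x * ph / real k ^ 2 * S\<bar> \<le> \<epsilon> / real k"
    proof -
      have "real X * ph / real k ^ 3 * S - x * ph / real k ^ 2 * S = (real X - real k * x) * (ph / real k) * (S / real k) / real k"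
        using kr by (simp add: field_simps power2_eq_square power3_eq_cube)
      also have "\<bar>\<dots>\<bar> = \<bar>real X - real k * x\<bar> * (ph / real k) * (S / real k) / real k"
        using ph S kr by (simp add: abs_mult)
      also have "\<dots> \<le> 1 * 1 * \<epsilon> / real k"
        using X0 ph S kr by (intro divide_right_mono mult_mono) (auto simp: field_simps)
      finally show ?thesis by simp
    qed
    have "\<bar>x * ph / real k ^ 2 * S - x * (\<epsilon> * (ph / real k * dens))\<bar> \<le> 2 * \<epsilon> / real k"
    proof -
      have "x * ph / real k ^ 2 * S - x * (\<epsilon> * (ph / real k * dens)) = x * (ph / real k) * (S - \<epsilon> * real k * dens) / real k"
        using kr by (simp add: field_simps power2_eq_square)
      also have "\<bar>\<dots>\<bar> = x * (ph / real k) * \<bar>S - \<epsilon> * real k * dens\<bar> / real k"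
        using ph x kr by (simp add: abs_mult)
      also have "\<dots> \<le> 1 * 1 * (2 * \<epsilon>) / real k"
        using x ph kr sum_arc_gap_asymp[OF e(1) k] unfolding S_def dens_def
        by (intro divide_right_mono mult_mono) (auto simp: field_simps)
      finally show ?thesis by simp
    qed
    moreover have triangle: "\<bar>m - 2 * z\<bar> \<le> 2 * e1 + e2 + 2 * e3 + 2 * e4"
      if "\<bar>y - z\<bar> \<le> e4" "\<bar>a - w\<bar> \<le> e1" "\<bar>b - w\<bar> \<le> e1" "\<bar>m - (a + b)\<bar> \<le> e2" "\<bar>w - y\<bar> \<le> e3"
      for m z e1 e2 e3 e4 y a b w :: real
      using that by linarith
    ultimately have "\<bar>denominator_measure \<epsilon> k x - 2 * (x * (\<epsilon> * (ph / real k * dens)))\<bar> \<le> 2 * (E * \<epsilon> / real k) + 2 * \<epsilon> / real k + 2 * (\<epsilon> / real k) + 2 * (2 * \<epsilon> / real k)"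
      using triangle[OF _ L R m mid] by blast
    also have "\<dots> = (2 * E + 8) * (\<epsilon> / real k)"
      by (simp add: add_divide_distrib distrib_right)
    also have "\<dots> \<le> (10 * E) * (\<epsilon> / real k)"
    proof (rule mult_right_mono)
      have "1 * 1 \<le> E" unfolding E_def using B(1) ge_one_powr_ge_zero[OF kr(1), of "4/5"] by (intro mult_mono) auto
      then show "2 * E + 8 \<le> 10 * E" by simp
    qed (use e in auto)
    also have "\<dots> = 10 * B * \<epsilon> * (real k powr (4/5) / real k powr 1)" using kr by (simp add: E_def)
    also have "real k powr (4/5) / real k powr 1 = real k powr (-1/5)"
      by (simp only: powr_diff[symmetric]) simp
    finally show "\<bar>denominator_measure \<epsilon> k x - 2 * x * (\<epsilon> * (real (totient k) / real k * denominator_density (\<epsilon> * real k)))\<bar>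
        \<le> 10 * B * \<epsilon> * real k powr (-1/5)" by (simp add: ph_def dens_def mult.assoc)
  qed
qed

lemma first_denominator_range:
  assumes e: "0 < \<epsilon>" "\<epsilon> < 1/2"
  shows "first_denominator \<epsilon> t \<in> {1..nat \<lfloor>1 / \<epsilon>\<rfloor>}"
proof -
  have "real (first_denominator \<epsilon> t) < 1 / \<epsilon>"
    using first_denominator_less[OF e, of t] e by (simp add: field_simps)
  then have "int (first_denominator \<epsilon> t) \<le> \<lfloor>1 / \<epsilon>\<rfloor>" by (simp add: le_floor_iff)
  then have "first_denominator \<epsilon> t \<le> nat \<lfloor>1 / \<epsilon>\<rfloor>" by linarith
  then show ?thesis using first_denominator_props(1)[OF e(1), of t] by simp
qed

lemma integral_first_denominator_powr:
  assumes e: "0 < \<epsilon>" "\<epsilon> < 1/2"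
  shows "set_integrable lborel {0..x} (\<lambda>t. real (first_denominator \<epsilon> t) powr p)"
    and "(LBINT t:{0..x}. real (first_denominator \<epsilon> t) powr p) =
      (\<Sum>k=1..nat \<lfloor>1 / \<epsilon>\<rfloor>. real k powr p * denominator_measure \<epsilon> k x)"
proof -
  let ?N = "nat \<lfloor>1 / \<epsilon>\<rfloor>"
  let ?D = "\<lambda>k. {t \<in> {0..x}. first_denominator \<epsilon> t = k}"
  have D_int: "?D k = {0..x} \<inter> {t. first_denominator \<epsilon> t = k}" for k by auto
  have Db: "?D k \<in> sets borel" for k
    unfolding D_int by (intro sets.Int first_denominator_fibre_borel) auto
  have D: "?D k \<in> fmeasurable lborel" for k
    using Db by (rule fmeasurable_bounded_borel[where a = 0 and b = x]) auto
  have eq: "indicator {0..x} t *\<^sub>R real (first_denominator \<epsilon> t) powr p =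
      (\<Sum>k=1..?N. real k powr p * indicator (?D k) t)" for t
  proof -
    have "(\<Sum>k=1..?N. real k powr p * indicator (?D k) t) =
        (\<Sum>k=1..?N. if k = first_denominator \<epsilon> t then indicator {0..x} t *\<^sub>R real (first_denominator \<epsilon> t) powr p else 0)"
      by (intro sum.cong refl) (auto simp: indicator_def)
    also have "\<dots> = indicator {0..x} t *\<^sub>R real (first_denominator \<epsilon> t) powr p"
      using first_denominator_range[OF e, of t] by (subst sum.delta) auto
    finally show ?thesis by simp
  qed
  have int: "integrable lborel (\<lambda>t. real k powr p * indicator (?D k) t)" for k
    using fmeasurableD[OF D] fmeasurableD2[OF D]
    by (intro integrable_mult_right) (simp add: integrable_indicator_iff less_top)
  show "set_integrable lborel {0..x} (\<lambda>t. real (first_denominator \<epsilon> t) powr p)"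
    unfolding set_integrable_def eq by (intro Bochner_Integration.integrable_sum int)
  have "(LBINT t:{0..x}. real (first_denominator \<epsilon> t) powr p) =
      (LBINT t. (\<Sum>k=1..?N. real k powr p * indicator (?D k) t))"
    unfolding set_lebesgue_integral_def eq ..
  also have "\<dots> = (\<Sum>k=1..?N. LBINT t. real k powr p * indicator (?D k) t)"
    by (rule Bochner_Integration.integral_sum) (rule int)
  also have "\<dots> = (\<Sum>k=1..?N. real k powr p * denominator_measure \<epsilon> k x)"
    using Db by (intro sum.cong refl) (simp add: denominator_measure_def)
  finally show "(LBINT t:{0..x}. real (first_denominator \<epsilon> t) powr p) =
      (\<Sum>k=1..?N. real k powr p * denominator_measure \<epsilon> k x)" .
qed

lemma sum_powr_floor_inverse_le:
  assumes "0 < \<epsilon>" "s > 0"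
  shows "\<epsilon> powr s * (\<Sum>k=1..nat \<lfloor>1 / \<epsilon>\<rfloor>. real k powr (s - 1)) \<le> 1 + 1 / s"
proof -
  define N where "N = nat \<lfloor>1 / \<epsilon>\<rfloor>"
  have "real N \<le> 1 / \<epsilon>" using nat_floor_bounds[of "1 / \<epsilon>"] assms by (simp add: N_def)
  then have N: "\<epsilon> * real N \<le> 1" using assms by (simp add: field_simps)
  have "\<epsilon> powr s * (\<Sum>k=1..N. real k powr (s - 1)) \<le> \<epsilon> powr s * ((1 + 1 / s) * real N powr s)"
    using assms by (intro mult_left_mono sum_powr_le) auto
  also have "\<dots> = (1 + 1 / s) * (\<epsilon> * real N) powr s"
    using assms by (simp add: powr_mult)
  also have "\<dots> \<le> (1 + 1 / s) * 1"
    using assms N by (intro mult_left_mono powr_le1) auto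
  finally show ?thesis by (simp add: N_def)
qed

lemma regroup_factors:
  fixes a b c d e :: real
  shows "a * b * (c * d * e) = c * (a * d) * (b * e)"
  by (simp only: ac_simps)

text \<open>
  The second estimate, for the exponent \<open>r - 1\<close>, controls the bounded difference between the
  number of reflections and \<open>q (1 + t)\<close>; for small \<open>r\<close> it would not do to bound \<open>q\<^sup>r\<^sup>-\<^sup>1\<close> by \<open>1\<close>.
\<close>

lemma first_denominator_moment_asymp:
  assumes r: "r > 0"
  obtains C where "C \<ge> 1"
    "\<And>\<epsilon> x. 0 < \<epsilon> \<Longrightarrow> \<epsilon> < 1/2 \<Longrightarrow> 0 \<le> x \<Longrightarrow> x \<le> 1 \<Longrightarrow>
      \<bar>\<epsilon> powr r * (LBINT t:{0..x}. real (first_denominator \<epsilon> t) powr r) - moment_const r * x\<bar> \<le> C * \<epsilon> powr (1/5)"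
    "\<And>\<epsilon>. 0 < \<epsilon> \<Longrightarrow> \<epsilon> < 1/2 \<Longrightarrow>
      \<epsilon> powr r * (LBINT t:{0..1}. real (first_denominator \<epsilon> t) powr (r - 1)) \<le> C * \<epsilon> powr (1/5)"
proof -
  obtain B where B: "B \<ge> 1"
    "\<And>\<epsilon> k x. 0 < \<epsilon> \<Longrightarrow> \<epsilon> < 1/2 \<Longrightarrow> k > 0 \<Longrightarrow> 0 \<le> x \<Longrightarrow> x \<le> 1 \<Longrightarrow>
      \<bar>denominator_measure \<epsilon> k x - 2 * x * (\<epsilon> * (real (totient k) / real k * denominator_density (\<epsilon> * real k)))\<bar>
        \<le> B * \<epsilon> * real k powr (-1/5)"
    by (rule denominator_measure_asymp) blast
  define s where "s = r + 4/5"
  have s: "s > 0" using r by (simp add: s_def)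
  define C where "C = max (B * (1 + 1 / s) + 406) ((B + 2) * (1 + 1 / r))"
  show ?thesis
  proof (rule that[of C])
    show "C \<ge> 1" using B(1) s by (auto simp: C_def intro!: max.coboundedI1 add_nonneg_pos)
  next
    fix \<epsilon> x :: real assume e: "0 < \<epsilon>" "\<epsilon> < 1/2" and x: "0 \<le> x" "x \<le> 1"
    define N where "N = nat \<lfloor>1 / \<epsilon>\<rfloor>"
    define T where "T = (\<lambda>k. \<epsilon> * (real (totient k) / real k * ((\<epsilon> * real k) powr r * denominator_density (\<epsilon> * real k))))"
    have N0: "real N \<le> 1 / \<epsilon>" "1 / \<epsilon> < real N + 1"
      unfolding N_def using e by (intro nat_floor_bounds; simp)+
    have "1 / \<epsilon> > 2" using e by (simp add: field_simps)
    then have "real N > 1" using N0 by linarith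
    then have N: "N > 0" "\<epsilon> * real N \<le> 1" "1 < \<epsilon> * real (Suc N)"
      using N0 e by (auto simp: field_simps)
    have e15: "\<epsilon> \<le> \<epsilon> powr (1/5)" using powr_mono'[of "1/5" 1 \<epsilon>] e by simp
    have main: "\<bar>(\<Sum>k=1..N. T k) - 6 / pi\<^sup>2 * density_moment r\<bar> \<le> 203 * \<epsilon> powr (1/5)"
    proof -
      have "\<epsilon> * real N powr (4/5) \<le> \<epsilon> * (1 / \<epsilon>) powr (4/5)"
        using N0 e by (intro mult_left_mono powr_mono2) auto
      also have "\<dots> = \<epsilon> powr 1 * \<epsilon> powr (-4/5)" using e by (simp add: powr_divide powr_minus_divide)
      also have "\<dots> = \<epsilon> powr (1/5)" by (simp only: powr_add[symmetric]) simp
      finally have "\<epsilon> * real N powr (4/5) \<le> \<epsilon> powr (1/5)" .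
      then show ?thesis
        using totient_weighted_density_sum[OF r e(1) N] e15 unfolding T_def by linarith
    qed
    have err: "\<bar>\<epsilon> powr r * (\<Sum>k=1..N. real k powr r * denominator_measure \<epsilon> k x) - 2 * x * (\<Sum>k=1..N. T k)\<bar>
        \<le> B * (1 + 1 / s) * \<epsilon> powr (1/5)"
    proof -
      have eq: "\<epsilon> powr r * (\<Sum>k=1..N. real k powr r * denominator_measure \<epsilon> k x) - 2 * x * (\<Sum>k=1..N. T k)
          = (\<Sum>k=1..N. \<epsilon> powr r * real k powr r *
             (denominator_measure \<epsilon> k x - 2 * x * (\<epsilon> * (real (totient k) / real k * denominator_density (\<epsilon> * real k)))))"
        unfolding sum_distrib_left sum_subtractf[symmetric]
        using e by (intro sum.cong refl) (simp add: T_def powr_mult right_diff_distrib)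
      have "\<bar>\<epsilon> powr r * (\<Sum>k=1..N. real k powr r * denominator_measure \<epsilon> k x) - 2 * x * (\<Sum>k=1..N. T k)\<bar>
          \<le> (\<Sum>k=1..N. \<epsilon> powr r * real k powr r * (B * \<epsilon> * real k powr (-1/5)))"
        unfolding eq
      proof (rule order_trans[OF sum_abs sum_mono])
        fix k assume "k \<in> {1..N}"
        then have "k > 0" by simp
        have "\<bar>\<epsilon> powr r * real k powr r * d\<bar> = \<epsilon> powr r * real k powr r * \<bar>d\<bar>" for d
          by (simp add: abs_mult)
        then show "\<bar>\<epsilon> powr r * real k powr r *
             (denominator_measure \<epsilon> k x - 2 * x * (\<epsilon> * (real (totient k) / real k * denominator_density (\<epsilon> * real k))))\<bar>
          \<le> \<epsilon> powr r * real k powr r * (B * \<epsilon> * real k powr (-1/5))"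
          using mult_left_mono[OF B(2)[OF e \<open>k > 0\<close> x], of "\<epsilon> powr r * real k powr r"] by simp
      qed
      also have "\<dots> = (\<Sum>k=1..N. B * (\<epsilon> powr r * \<epsilon>) * real k powr (s - 1))"
      proof (rule sum.cong[OF refl])
        fix k
        have "r + (-1/5) = s - 1" by (simp add: s_def)
        then have "real k powr r * real k powr (-1/5) = real k powr (s - 1)"
          by (simp only: powr_add[symmetric])
        then show "\<epsilon> powr r * real k powr r * (B * \<epsilon> * real k powr (-1/5)) = B * (\<epsilon> powr r * \<epsilon>) * real k powr (s - 1)"
          by (simp only: regroup_factors)
      qed
      also have "\<dots> = B * (\<epsilon> powr r * \<epsilon>) * (\<Sum>k=1..N. real k powr (s - 1))"
        by (rule sum_distrib_left[symmetric])
      also have "\<epsilon> powr r * \<epsilon> = \<epsilon> powr (1/5) * \<epsilon> powr s"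
      proof -
        have "r + 1 = 1/5 + s" by (simp add: s_def)
        then have "\<epsilon> powr r * \<epsilon> powr 1 = \<epsilon> powr (1/5) * \<epsilon> powr s"
          by (simp only: powr_add[symmetric])
        then show ?thesis using e by simp
      qed
      also have "B * (\<epsilon> powr (1/5) * \<epsilon> powr s) * (\<Sum>k=1..N. real k powr (s - 1)) =
          B * \<epsilon> powr (1/5) * (\<epsilon> powr s * (\<Sum>k=1..N. real k powr (s - 1)))" by simp
      also have "\<dots> \<le> B * \<epsilon> powr (1/5) * (1 + 1 / s)"
        using sum_powr_floor_inverse_le[OF e(1) s] B(1) unfolding N_def by (intro mult_left_mono) auto
      finally show ?thesis by (simp add: mult_ac)
    qed
    have "2 * x * \<bar>(\<Sum>k=1..N. T k) - 6 / pi\<^sup>2 * density_moment r\<bar> \<le> 2 * 1 * (203 * \<epsilon> powr (1/5))"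
      using main x by (intro mult_mono) auto
    moreover have "2 * x * (\<Sum>k=1..N. T k) - moment_const r * x = 2 * x * ((\<Sum>k=1..N. T k) - 6 / pi\<^sup>2 * density_moment r)"
      unfolding moment_const_eq_density_moment[OF r] by (simp add: right_diff_distrib)
    moreover have "\<bar>2 * x * z\<bar> = 2 * x * \<bar>z\<bar>" for z using x by (simp add: abs_mult)
    ultimately have "\<bar>2 * x * (\<Sum>k=1..N. T k) - moment_const r * x\<bar> \<le> 406 * \<epsilon> powr (1/5)" by simp
    then have "\<bar>\<epsilon> powr r * (\<Sum>k=1..N. real k powr r * denominator_measure \<epsilon> k x) - moment_const r * x\<bar>
        \<le> B * (1 + 1 / s) * \<epsilon> powr (1/5) + 406 * \<epsilon> powr (1/5)"
      using err by linarith
    also have "\<dots> = (B * (1 + 1 / s) + 406) * \<epsilon> powr (1/5)" by (simp add: distrib_right)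
    also have "\<dots> \<le> C * \<epsilon> powr (1/5)" by (intro mult_right_mono) (auto simp: C_def)
    finally show "\<bar>\<epsilon> powr r * (LBINT t:{0..x}. real (first_denominator \<epsilon> t) powr r) - moment_const r * x\<bar> \<le> C * \<epsilon> powr (1/5)"
      unfolding integral_first_denominator_powr(2)[OF e] N_def .
  next
    fix \<epsilon> :: real assume e: "0 < \<epsilon>" "\<epsilon> < 1/2"
    have m: "denominator_measure \<epsilon> k 1 \<le> (B + 2) * \<epsilon>" if "k > 0" for k
    proof -
      have d: "0 \<le> denominator_density (\<epsilon> * real k)" "denominator_density (\<epsilon> * real k) \<le> 1"
        using e by (auto intro: denominator_density_bounds)
      have "real (totient k) / real k \<le> 1" using totient_le[of k] that by (simp add: divide_le_eq_1)
      then have "real (totient k) / real k * denominator_density (\<epsilon> * real k) \<le> 1 * 1"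
        using d by (intro mult_mono) auto
      then have "\<epsilon> * (real (totient k) / real k * denominator_density (\<epsilon> * real k)) \<le> \<epsilon> * 1"
        using e by (intro mult_left_mono) auto
      moreover have "B * \<epsilon> * real k powr (-1/5) \<le> B * \<epsilon> * 1"
        using B(1) e that by (intro mult_left_mono) (auto simp: powr_minus_divide divide_le_eq_1 ge_one_powr_ge_zero)
      ultimately show ?thesis using B(2)[OF e that, of 1] by (simp add: distrib_right)
    qed
    let ?S = "\<Sum>k=1..nat \<lfloor>1 / \<epsilon>\<rfloor>. real k powr (r - 1)"
    have "\<epsilon> powr r * (LBINT t:{0..1}. real (first_denominator \<epsilon> t) powr (r - 1)) \<le>
        \<epsilon> powr r * (\<Sum>k=1..nat \<lfloor>1 / \<epsilon>\<rfloor>. real k powr (r - 1) * ((B + 2) * \<epsilon>))"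
      unfolding integral_first_denominator_powr(2)[OF e]
      using m by (intro mult_left_mono sum_mono) auto
    also have "\<dots> = (B + 2) * \<epsilon> * (\<epsilon> powr r * ?S)" by (simp add: sum_distrib_right[symmetric])
    also have "\<dots> \<le> (B + 2) * \<epsilon> * (1 + 1 / r)"
      using sum_powr_floor_inverse_le[OF e(1) r] B(1) e by (intro mult_left_mono) auto
    also have "\<dots> = (B + 2) * (1 + 1 / r) * \<epsilon>" by simp
    also have "\<dots> \<le> (B + 2) * (1 + 1 / r) * \<epsilon> powr (1/5)"
      using powr_mono'[of "1/5" 1 \<epsilon>] e B(1) r by (intro mult_left_mono) auto
    also have "\<dots> \<le> C * \<epsilon> powr (1/5)" by (intro mult_right_mono) (auto simp: C_def)
    finally show "\<epsilon> powr r * (LBINT t:{0..1}. real (first_denominator \<epsilon> t) powr (r - 1)) \<le> C * \<epsilon> powr (1/5)" .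
  qed
qed

section \<open>Counting reflections\<close>

text \<open>
  The particle stops at the scatterer \<open>(q, a)\<close>: on the vertical bar, at abscissa \<open>q\<close>, unless it
  passes above the centre and so low that it meets the horizontal bar just before, at \<open>a/t\<close>. For
  \<open>a = 0\<close> the horizontal bar lies on the axis through the origin and is not met.
\<close>

definition stopping_abscissa :: "real \<Rightarrow> real \<Rightarrow> real" where
  "stopping_abscissa \<epsilon> t =
     (let q = real (first_denominator \<epsilon> t); a = of_int (round (t * q))
      in if 1 \<le> a \<and> a < t * q \<and> t * q - a \<le> \<epsilon> * t then a / t else q)"

lemma round_eq_of_close:
  fixes x :: real and a :: int
  assumes "\<bar>x - of_int a\<bar> \<le> \<epsilon>" "\<epsilon> < 1/2" shows "round x = a"
  by (rule round_unique') (use assms in linarith)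

lemma mem_scatterers_iff:
  "(x, y) \<in> scatterers \<epsilon> \<longleftrightarrow> (\<exists>(m::int) (n::int). (m, n) \<noteq> (0, 0) \<and>
     (x = of_int m \<and> \<bar>y - of_int n\<bar> \<le> \<epsilon> \<or> \<bar>x - of_int m\<bar> \<le> \<epsilon> \<and> y = of_int n))"
proof
  assume "(x, y) \<in> scatterers \<epsilon>"
  then obtain p and m n :: int where p: "(x, y) = p + (of_int m, of_int n)" "p \<in> cross_scatterer \<epsilon>" "(m, n) \<noteq> (0, 0)"
    by (auto simp: scatterers_def)
  obtain u v where uv: "p = (u, v)" by (cases p)
  have "x = u + of_int m" "y = v + of_int n" using p(1) uv by auto
  moreover have "u = 0 \<and> \<bar>v\<bar> \<le> \<epsilon> \<or> \<bar>u\<bar> \<le> \<epsilon> \<and> v = 0"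
    using p(2) uv by (auto simp: cross_scatterer_def)
  ultimately show "\<exists>(m::int) (n::int). (m, n) \<noteq> (0, 0) \<and>
     (x = of_int m \<and> \<bar>y - of_int n\<bar> \<le> \<epsilon> \<or> \<bar>x - of_int m\<bar> \<le> \<epsilon> \<and> y = of_int n)"
    using p(3) by (intro exI[of _ m] exI[of _ n]) auto
next
  assume "\<exists>(m::int) (n::int). (m, n) \<noteq> (0, 0) \<and>
     (x = of_int m \<and> \<bar>y - of_int n\<bar> \<le> \<epsilon> \<or> \<bar>x - of_int m\<bar> \<le> \<epsilon> \<and> y = of_int n)"
  then obtain m n :: int where mn: "(m, n) \<noteq> (0, 0)"
    "x = of_int m \<and> \<bar>y - of_int n\<bar> \<le> \<epsilon> \<or> \<bar>x - of_int m\<bar> \<le> \<epsilon> \<and> y = of_int n" by blast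
  have "(x - of_int m, y - of_int n) \<in> cross_scatterer \<epsilon>"
    using mn(2) by (auto simp: cross_scatterer_def abs_le_iff)
  moreover have "(x, y) = (x - of_int m, y - of_int n) + (of_int m, of_int n)" by simp
  ultimately show "(x, y) \<in> scatterers \<epsilon>" unfolding scatterers_def using mn(1) by blast
qed

lemma stopping_abscissa_bounds:
  assumes e: "0 < \<epsilon>" "\<epsilon> < 1/2" and t: "0 < t" "t \<le> 1"
  defines "q \<equiv> real (first_denominator \<epsilon> t)"
  shows "q - 1 < stopping_abscissa \<epsilon> t" "stopping_abscissa \<epsilon> t \<le> q"
    "t * q - \<epsilon> \<le> t * stopping_abscissa \<epsilon> t" "0 < stopping_abscissa \<epsilon> t"
proof -
  define a where "a = real_of_int (round (t * q))"
  have X: "stopping_abscissa \<epsilon> t = (if 1 \<le> a \<and> a < t * q \<and> t * q - a \<le> \<epsilon> * t then a / t else q)"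
    by (simp add: stopping_abscissa_def q_def a_def Let_def)
  have q1: "q \<ge> 1" using first_denominator_props(1)[OF e(1), of t] by (simp add: q_def)
  have et: "\<epsilon> * t \<le> \<epsilon>" using e t by (simp add: mult_left_le)
  show up: "stopping_abscissa \<epsilon> t \<le> q" using t by (auto simp: X divide_le_eq mult.commute)
  have "t * q - \<epsilon> * t \<le> t * stopping_abscissa \<epsilon> t" using t e by (auto simp: X)
  then show "t * q - \<epsilon> \<le> t * stopping_abscissa \<epsilon> t" using et by linarith
  have "t * (q - \<epsilon>) \<le> t * stopping_abscissa \<epsilon> t"
    using \<open>t * q - \<epsilon> * t \<le> t * stopping_abscissa \<epsilon> t\<close> by (simp add: algebra_simps)
  then have "q - \<epsilon> \<le> stopping_abscissa \<epsilon> t" using t by simp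
  then show "q - 1 < stopping_abscissa \<epsilon> t" "0 < stopping_abscissa \<epsilon> t" using e q1 by linarith+
qed

text \<open>
  Since \<open>t \<le> 1\<close>, hitting the horizontal bar at \<open>(m, n)\<close> also forces \<open>\<bar>m t - n\<bar> \<le> \<epsilon>\<close>. Hence every
  scatterer that is hit has \<open>m \<ge> q\<close>, and those with \<open>m > q\<close> lie further to the right than \<open>q\<close>.
\<close>

lemma stopping_abscissa_hit:
  assumes e: "0 < \<epsilon>" "\<epsilon> < 1/2" and t: "0 < t" "t \<le> 1"
  shows "(stopping_abscissa \<epsilon> t, t * stopping_abscissa \<epsilon> t) \<in> scatterers \<epsilon>"
    and "\<And>x. 0 < x \<Longrightarrow> (x, t * x) \<in> scatterers \<epsilon> \<Longrightarrow> stopping_abscissa \<epsilon> t \<le> x"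
proof -
  define k where "k = first_denominator \<epsilon> t"
  define q where "q = real k"
  obtain a :: int where a: "\<bar>q * t - of_int a\<bar> \<le> \<epsilon>"
    using first_denominator_props(2)[OF e(1), of t] by (auto simp: q_def k_def)
  have ra: "round (t * q) = a" using round_eq_of_close[OF a e(2)] by (simp add: mult.commute)
  have k1: "k \<ge> 1" using first_denominator_props(1)[OF e(1), of t] by (simp add: k_def)
  have X: "stopping_abscissa \<epsilon> t =
      (if 1 \<le> real_of_int a \<and> of_int a < t * q \<and> t * q - of_int a \<le> \<epsilon> * t then of_int a / t else q)"
    by (simp add: stopping_abscissa_def q_def k_def[symmetric] ra[unfolded q_def] Let_def)
  have Xq: "stopping_abscissa \<epsilon> t \<le> q"
    using stopping_abscissa_bounds(2)[OF e t] by (simp add: q_def k_def)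
  show "(stopping_abscissa \<epsilon> t, t * stopping_abscissa \<epsilon> t) \<in> scatterers \<epsilon>"
  proof (cases "1 \<le> real_of_int a \<and> of_int a < t * q \<and> t * q - of_int a \<le> \<epsilon> * t")
    case True
    then have "\<bar>of_int a / t - q\<bar> \<le> \<epsilon>" using t by (auto simp: abs_le_iff field_simps)
    then show ?thesis unfolding X mem_scatterers_iff using True t k1
      by (intro exI[of _ "int k"] exI[of _ a]) (simp add: q_def)
  next
    case False
    then have "stopping_abscissa \<epsilon> t = q" unfolding X by (simp only: if_False)
    then show ?thesis unfolding mem_scatterers_iff using a k1
      by (intro exI[of _ "int k"] exI[of _ a]) (simp add: q_def mult.commute)
  qed
  fix x :: real assume x: "0 < x" "(x, t * x) \<in> scatterers \<epsilon>"
  then obtain m n :: int where mn: "x = of_int m \<and> \<bar>t * x - of_int n\<bar> \<le> \<epsilon> \<or> \<bar>x - of_int m\<bar> \<le> \<epsilon> \<and> t * x = of_int n"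
    unfolding mem_scatterers_iff by blast
  show "stopping_abscissa \<epsilon> t \<le> x"
  proof (cases "x = of_int m \<and> \<bar>t * x - of_int n\<bar> \<le> \<epsilon>")
    case True
    then have m: "m \<ge> 1" using x(1) by simp
    then have "k \<le> nat m" unfolding k_def using True
      by (intro first_denominator_props(3)[OF e(1), of _ _ n]) (auto simp: mult.commute)
    then have "q \<le> x" using True m by (simp add: q_def)
    then show ?thesis using Xq by linarith
  next
    case False
    then have h: "\<bar>x - of_int m\<bar> \<le> \<epsilon>" "t * x = of_int n" using mn by auto
    have "t * x > 0" using t x by simp
    then have n1: "n \<ge> 1" using h by simp
    have "t * x \<le> 1 * x" using t x by (intro mult_right_mono) auto
    then have "x \<ge> 1" using n1 h by linarith
    then have m: "m \<ge> 1" using h e by linarith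
    have "t * of_int m - of_int n = t * (of_int m - x)" using h by (simp add: algebra_simps)
    then have tm: "\<bar>t * of_int m - of_int n\<bar> = t * \<bar>x - of_int m\<bar>" using t by (simp add: abs_mult abs_minus_commute)
    also have "\<dots> \<le> 1 * \<epsilon>" using t h by (intro mult_mono) auto
    finally have close: "\<bar>t * of_int m - of_int n\<bar> \<le> \<epsilon>" by simp
    then have "k \<le> nat m" unfolding k_def using m
      by (intro first_denominator_props(3)[OF e(1), of _ _ n]) (auto simp: mult.commute)
    then have km: "int k \<le> m" using m by linarith
    show ?thesis
    proof (cases "m = int k")
      case True
      then have "a = n" using close a e(2) round_eq_of_close[of "t * q" n \<epsilon>] ra by (simp add: q_def)
      have xa: "x = of_int a / t" using h(2) t \<open>a = n\<close> by (simp add: field_simps)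
      show ?thesis
      proof (cases "of_int a < t * q")
        case lt: True
        have "t * q - of_int a = t * (q - x)" using h \<open>a = n\<close> by (simp add: algebra_simps)
        also have "\<dots> \<le> t * \<epsilon>" using h(1) True t by (intro mult_left_mono) (auto simp: q_def)
        finally have "t * q - of_int a \<le> \<epsilon> * t" by (simp add: mult.commute)
        then have "stopping_abscissa \<epsilon> t = of_int a / t" using lt n1 \<open>a = n\<close> by (simp add: X)
        then show ?thesis using xa by simp
      next
        case False
        then have "t * q \<le> t * x" using h(2) \<open>a = n\<close> by simp
        then have "q \<le> x" using t by simp
        then show ?thesis using Xq by linarith
      qed
    next
      case False
      then have "q + 1 \<le> real_of_int m" using km by (simp add: q_def)
      then show ?thesis using Xq h e by linarith
    qed
  qed
qed

lemma card_integer_multiples: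
  fixes c L :: real
  assumes "c > 0"
  shows "card {\<tau> \<in> {0<..<L}. \<tau> * c \<in> \<int>} = nat (\<lceil>L * c\<rceil> - 1)"
proof -
  have "{\<tau> \<in> {0<..<L}. \<tau> * c \<in> \<int>} = (\<lambda>n::int. of_int n / c) ` {1..\<lceil>L * c\<rceil> - 1}"
  proof (intro equalityI subsetI)
    fix \<tau> assume "\<tau> \<in> {\<tau> \<in> {0<..<L}. \<tau> * c \<in> \<int>}"
    then obtain n where n: "\<tau> * c = of_int n" and r: "0 < \<tau>" "\<tau> < L" by (auto elim: Ints_cases)
    have "0 < \<tau> * c" "\<tau> * c < L * c" using r assms by auto
    then have "0 < n" "n < \<lceil>L * c\<rceil>" unfolding n by (auto simp: less_ceiling_iff)
    moreover have "\<tau> = of_int n / c" using n assms by (simp add: field_simps)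
    ultimately show "\<tau> \<in> (\<lambda>n::int. of_int n / c) ` {1..\<lceil>L * c\<rceil> - 1}" by (intro image_eqI[of _ _ n]) auto
  next
    fix \<tau> assume "\<tau> \<in> (\<lambda>n::int. of_int n / c) ` {1..\<lceil>L * c\<rceil> - 1}"
    then obtain n where "\<tau> = of_int n / c" "n \<in> {1..\<lceil>L * c\<rceil> - 1}" by (rule imageE)
    then have n: "\<tau> = of_int n / c" "1 \<le> n" "n < \<lceil>L * c\<rceil>" by auto
    then have "of_int n < L * c" by (simp add: less_ceiling_iff)
    then show "\<tau> \<in> {\<tau> \<in> {0<..<L}. \<tau> * c \<in> \<int>}" 
    proof -
      have "\<tau> * c = of_int n" using n(1) assms by simp
      then have "\<tau> * c \<in> \<int>" "0 * c < \<tau> * c" "\<tau> * c < L * c" using n(2) \<open>of_int n < L * c\<close> by auto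
      then show ?thesis using assms by (simp only: mult_less_cancel_right_pos) simp
    qed
  qed
  moreover have "inj_on (\<lambda>n::int. of_int n / c) {1..\<lceil>L * c\<rceil> - 1}" using assms by (auto simp: inj_on_def)
  ultimately show ?thesis by (simp add: card_image)
qed

definition reflections_of_slope :: "real \<Rightarrow> real \<Rightarrow> nat" where
  "reflections_of_slope \<epsilon> t =
     nat (\<lceil>stopping_abscissa \<epsilon> t\<rceil> - 1) + nat (\<lceil>t * stopping_abscissa \<epsilon> t\<rceil> - 1)"

lemma tan_range:
  assumes "0 < \<omega>" "\<omega> \<le> pi/4"
  shows "0 < cos \<omega>" "0 < sin \<omega>" "sin \<omega> = tan \<omega> * cos \<omega>" "0 < tan \<omega>" "tan \<omega> \<le> 1"
proof -
  show c: "0 < cos \<omega>" "0 < sin \<omega>" using assms by (intro cos_gt_zero sin_gt_zero; simp)+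
  then show "sin \<omega> = tan \<omega> * cos \<omega>" "0 < tan \<omega>" by (auto simp: tan_def)
  have "tan \<omega> \<le> tan (pi/4)" using assms by (intro tan_mono_le) auto
  then show "tan \<omega> \<le> 1" by (simp add: tan_45)
qed

lemma num_reflections_eq:
  assumes e: "0 < \<epsilon>" "\<epsilon> < 1/2" and w: "0 < \<omega>" "\<omega> \<le> pi/4"
  shows "num_reflections \<epsilon> \<omega> = reflections_of_slope \<epsilon> (tan \<omega>)"
proof -
  define t where "t = tan \<omega>"
  define X where "X = stopping_abscissa \<epsilon> t"
  note tr = tan_range[OF w]
  have t: "0 < t" "t \<le> 1" using tr by (auto simp: t_def)
  have sin: "sin \<omega> = t * cos \<omega>" using tr by (simp add: t_def)
  have X0: "X > 0" unfolding X_def by (rule stopping_abscissa_bounds(4)[OF e t])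
  have "free_path_length \<epsilon> \<omega> = X / cos \<omega>"
    unfolding free_path_length_def
  proof (rule cInf_eq_minimum)
    show "X / cos \<omega> \<in> {\<tau>. \<tau> > 0 \<and> (\<tau> * cos \<omega>, \<tau> * sin \<omega>) \<in> scatterers \<epsilon>}"
      using stopping_abscissa_hit(1)[OF e t] X0 tr(1) by (simp add: sin X_def mult.commute)
    fix \<tau> assume "\<tau> \<in> {\<tau>. \<tau> > 0 \<and> (\<tau> * cos \<omega>, \<tau> * sin \<omega>) \<in> scatterers \<epsilon>}"
    then have "0 < \<tau> * cos \<omega>" "(\<tau> * cos \<omega>, t * (\<tau> * cos \<omega>)) \<in> scatterers \<epsilon>"
      using tr(1) by (auto simp: sin mult_ac)
    then have "X \<le> \<tau> * cos \<omega>" unfolding X_def by (rule stopping_abscissa_hit(2)[OF e t])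
    then show "X / cos \<omega> \<le> \<tau>" using tr(1) by (simp add: divide_le_eq)
  qed
  then have L: "free_path_length \<epsilon> \<omega> * cos \<omega> = X" "free_path_length \<epsilon> \<omega> * sin \<omega> = t * X"
    using tr(1) by (auto simp: sin)
  show ?thesis
    unfolding num_reflections_def card_integer_multiples[OF tr(1)] card_integer_multiples[OF tr(2)] L
    by (simp add: reflections_of_slope_def X_def t_def)
qed

lemma reflections_of_slope_approx:
  assumes e: "0 < \<epsilon>" "\<epsilon> < 1/2" and t: "0 < t" "t \<le> 1"
  shows "\<bar>real (first_denominator \<epsilon> t) * (1 + t) - real (reflections_of_slope \<epsilon> t)\<bar> \<le> 3"
proof -
  define q where "q = real (first_denominator \<epsilon> t)"
  define X where "X = stopping_abscissa \<epsilon> t"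
  have X: "q - 1 < X" "X \<le> q" "t * q - \<epsilon> \<le> t * X" "0 < X"
    unfolding q_def X_def using stopping_abscissa_bounds[OF e t] by auto
  have tX: "0 < t * X" "t * X \<le> t * q" using X t by auto
  have n: "real (nat (\<lceil>z\<rceil> - 1)) = of_int \<lceil>z\<rceil> - 1" if "z > 0" for z :: real
  proof -
    have "\<lceil>z\<rceil> \<ge> 1" using that by (simp add: one_le_ceiling)
    then show ?thesis by simp
  qed
  have "real (reflections_of_slope \<epsilon> t) = of_int \<lceil>X\<rceil> - 1 + (of_int \<lceil>t * X\<rceil> - 1)"
    unfolding reflections_of_slope_def X_def[symmetric] of_nat_add n[OF X(4)] n[OF tX(1)] ..
  moreover have "q \<le> of_int \<lceil>X\<rceil>"
  proof -
    have "int (first_denominator \<epsilon> t) \<le> \<lceil>X\<rceil>" using X(1) by (simp add: le_ceiling_iff q_def)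
    then show ?thesis unfolding q_def by linarith
  qed
  moreover have "of_int \<lceil>X\<rceil> < X + 1" "t * X \<le> of_int \<lceil>t * X\<rceil>" "of_int \<lceil>t * X\<rceil> < t * X + 1"
    by linarith+
  moreover have "q * (1 + t) = q + t * q" by (simp add: algebra_simps)
  moreover have "\<bar>A - R\<bar> \<le> 3" if "R = c - 1 + (d - 1)" "q \<le> c" "c < x + 1" "y \<le> d" "d < y + 1"
    "A = q + z" "x \<le> q" "z - \<epsilon> \<le> y" "y \<le> z" for A R c d x y z
    using that e by linarith
  ultimately show ?thesis using X(2,3) tX(2) unfolding q_def[symmetric] by blast
qed

lemma real_first_denominator_measurable [measurable]:
  "(\<lambda>t. real (first_denominator \<epsilon> t)) \<in> borel_measurable borel"
  using measurable_compose[OF first_denominator_measurable, of real borel] by simp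

lemma reflections_of_slope_measurable [measurable]:
  "(\<lambda>t. real (reflections_of_slope \<epsilon> t)) \<in> borel_measurable borel"
proof -
  have fl: "(\<lambda>t. real_of_int (round (f t))) \<in> borel_measurable borel"
    if "f \<in> borel_measurable borel" for f :: "real \<Rightarrow> real"
    unfolding round_def using that by measurable
  have "(\<lambda>t. real_of_int (round (t * real (first_denominator \<epsilon> t)))) \<in> borel_measurable borel"
    by (rule fl) measurable
  note this [measurable]
  have "(\<lambda>t. stopping_abscissa \<epsilon> t) \<in> borel_measurable borel"
    unfolding stopping_abscissa_def Let_def by measurable
  note this [measurable]
  have ce: "(\<lambda>t. real (nat (\<lceil>f t\<rceil> - 1))) \<in> borel_measurable borel"
    if [measurable]: "f \<in> borel_measurable borel" for f :: "real \<Rightarrow> real"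
  proof -
    have "real (nat (\<lceil>f t\<rceil> - 1)) = max 0 (real_of_int \<lceil>f t\<rceil> - 1)" for t by auto
    then show ?thesis by simp
  qed
  show ?thesis unfolding reflections_of_slope_def of_nat_add
    by (intro borel_measurable_add ce) measurable
qed

section \<open>Weights and the change of variables\<close>

text \<open>
  By the second mean value theorem, a monotone weight changes the bound for the integrals over
  subintervals by a constant factor only.
\<close>

lemma weighted_integral_bound:
  fixes f g :: "real \<Rightarrow> real"
  assumes f: "f integrable_on {a..b}" and ab: "a \<le> b"
    and g: "\<And>x y. a \<le> x \<Longrightarrow> x \<le> y \<Longrightarrow> y \<le> b \<Longrightarrow> g x \<le> g y"
    and G: "\<bar>g a\<bar> \<le> G" "\<bar>g b\<bar> \<le> G"
    and M: "\<And>u v. a \<le> u \<Longrightarrow> u \<le> v \<Longrightarrow> v \<le> b \<Longrightarrow> \<bar>integral {u..v} f\<bar> \<le> M"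
  shows "\<bar>integral {a..b} (\<lambda>x. g x * f x)\<bar> \<le> 2 * G * M"
proof -
  obtain c where c: "c \<in> {a..b}" "integral {a..b} (\<lambda>x. g x * f x) = g a * integral {a..c} f + g b * integral {c..b} f"
    by (rule second_mean_value_theorem[OF f ab g])
  have G0: "G \<ge> 0" using G by linarith
  have "\<bar>g a * integral {a..c} f\<bar> \<le> G * M" "\<bar>g b * integral {c..b} f\<bar> \<le> G * M"
    unfolding abs_mult using G G0 M[of a c] M[of c b] c(1) by (auto intro!: mult_mono)
  then show ?thesis unfolding c(2) by linarith
qed

lemma set_integrable_bounded_interval:
  fixes f :: "real \<Rightarrow> real"
  assumes "f \<in> borel_measurable borel" "\<And>x. x \<in> {a..b} \<Longrightarrow> \<bar>f x\<bar> \<le> M"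
  shows "set_integrable lborel {a..b} f"
proof (rule set_integrable_bound[of _ _ "\<lambda>_. M"])
  show "set_integrable lborel {a..b} (\<lambda>_. M)"
    unfolding set_integrable_def by (cases "a \<le> b") auto
  show "set_borel_measurable lborel {a..b} f"
    unfolding set_borel_measurable_def using assms(1) by measurable
qed (use assms(2) in \<open>auto intro: order_trans[OF _ abs_ge_self]\<close>)

lemma tan_substitution:
  fixes f :: "real \<Rightarrow> real"
  assumes uv: "0 \<le> u" "u \<le> v" "v \<le> pi/4" and f: "set_integrable lborel {tan u..tan v} f"
  shows "set_integrable lborel {u..v} (\<lambda>x. f (tan x) * (1 + (tan x)\<^sup>2))"
    and "(LBINT t:{tan u..tan v}. f t) = (LBINT x:{u..v}. f (tan x) * (1 + (tan x)\<^sup>2))"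
proof -
  have c: "cos x > 0" if "x \<in> {u..v}" for x
  proof -
    have "0 \<le> x" "x \<le> pi/4" using that uv by auto
    then show ?thesis using pi_gt_zero by (intro cos_gt_zero_pi) linarith+
  qed
  have d: "(tan has_real_derivative 1 + (tan x)\<^sup>2) (at x)" if "x \<in> {u..v}" for x
  proof -
    have "1 + (tan x)\<^sup>2 = inverse ((cos x)\<^sup>2)"
      using c[OF that] tan_sec[of x] by (simp add: power_inverse)
    then show ?thesis using DERIV_tan[of x] c[OF that] by simp
  qed
  have cont: "continuous_on {u..v} (\<lambda>x. 1 + (tan x)\<^sup>2)"
    by (intro continuous_intros) (use c less_irrefl in metis)
  show "set_integrable lborel {u..v} (\<lambda>x. f (tan x) * (1 + (tan x)\<^sup>2))"
    by (rule integral_substitution(1)[OF f d cont _ uv(2)]) auto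
  have "(LBINT t. f t * indicator {tan u..tan v} t) = (LBINT x. f (tan x) * (1 + (tan x)\<^sup>2) * indicator {u..v} x)"
    by (rule integral_substitution(2)[OF f d cont _ uv(2)]) auto
  then show "(LBINT t:{tan u..tan v}. f t) = (LBINT x:{u..v}. f (tan x) * (1 + (tan x)\<^sup>2))"
    by (simp add: set_lebesgue_integral_def mult.commute)
qed

text \<open>
  For \<open>A \<ge> 6\<close> also \<open>B\<close> is comparable to \<open>A\<close> and the mean value theorem applies; for smaller \<open>A\<close> both
  powers are at most \<open>9\<^sup>r\<close>, and \<open>A\<^sup>r\<^sup>-\<^sup>1 \<ge> 1/6\<close>.
\<close>

lemma powr_perturbation:
  fixes r :: real
  assumes r: "r > 0" and A: "A \<ge> 1" and B: "B \<ge> 0" "\<bar>A - B\<bar> \<le> 3"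
  shows "\<bar>A powr r - B powr r\<bar> \<le> (6 * 9 powr r + 3 * r * (2 + 2 powr r)) * A powr (r - 1)"
proof (cases "A < 6")
  case True
  have "A powr r \<le> 9 powr r" "B powr r \<le> 9 powr r" "0 \<le> A powr r" "0 \<le> B powr r"
    using A B True r by (auto intro!: powr_mono2)
  then have 1: "\<bar>A powr r - B powr r\<bar> \<le> 9 powr r" by linarith
  have "1 \<le> 6 * A powr (r - 1)"
  proof (cases "r \<ge> 1")
    case True
    then show ?thesis using ge_one_powr_ge_zero[OF A, of "r - 1"] by simp
  next
    case False
    have "6 powr (-1) \<le> (6::real) powr (r - 1)" using r by (intro powr_mono) auto
    also have "\<dots> \<le> A powr (r - 1)" using A True False by (intro powr_mono2') auto
    finally show ?thesis by (simp add: powr_minus_divide)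
  qed
  then have "9 powr r * 1 \<le> 9 powr r * (6 * A powr (r - 1))" by (intro mult_left_mono) auto
  also have "\<dots> = 6 * 9 powr r * A powr (r - 1)" by simp
  finally have "\<bar>A powr r - B powr r\<bar> \<le> 6 * 9 powr r * A powr (r - 1)" using 1 by linarith
  also have "\<dots> \<le> (6 * 9 powr r + 3 * r * (2 + 2 powr r)) * A powr (r - 1)"
    using r by (intro mult_right_mono) (auto intro!: mult_nonneg_nonneg add_nonneg_nonneg)
  finally show ?thesis .
next
  case False
  have B2: "A / 2 \<le> B" "B \<le> 2 * A" using False B by linarith+
  have mvt: "\<exists>z>x. z < y \<and> y powr r - x powr r = (y - x) * (r * z powr (r - 1))" if "0 < x" "x < y" for x y :: real
    using that by (intro MVT2 has_real_derivative_powr) auto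
  have zb: "z powr (r - 1) \<le> (2 + 2 powr r) * A powr (r - 1)" if "A / 2 \<le> z" "z \<le> 2 * A" for z
  proof (cases "r \<ge> 1")
    case True
    have "z powr (r - 1) \<le> (2 * A) powr (r - 1)" using that A True by (intro powr_mono2) auto
    also have "\<dots> = 2 powr (r - 1) * A powr (r - 1)" using A by (simp add: powr_mult)
    also have "\<dots> \<le> (2 + 2 powr r) * A powr (r - 1)"
    proof (rule mult_right_mono)
      have "(2::real) powr (r - 1) \<le> 2 powr r" by (intro powr_mono) auto
      then show "2 powr (r - 1) \<le> 2 + 2 powr r" by linarith
    qed auto
    finally show ?thesis .
  next
    case False
    have "z powr (r - 1) \<le> (A / 2) powr (r - 1)" using that A False by (intro powr_mono2') auto
    also have "\<dots> = 1 / 2 powr (r - 1) * A powr (r - 1)"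
      using A by (simp add: powr_divide)
    also have "1 / 2 powr (r - 1) = (2::real) powr (1 - r)"
      using powr_minus_divide[of "2::real" "r - 1"] by simp
    also have "2 powr (1 - r) * A powr (r - 1) \<le> (2 + 2 powr r) * A powr (r - 1)"
    proof (rule mult_right_mono)
      have "(2::real) powr (1 - r) \<le> 2" using powr_mono[of "1 - r" 1 "2::real"] r by simp
      moreover have "(0::real) \<le> 2 powr r" by simp
      ultimately show "2 powr (1 - r) \<le> 2 + 2 powr r" by linarith
    qed auto
    finally show ?thesis .
  qed
  have "\<bar>A powr r - B powr r\<bar> \<le> 3 * (r * ((2 + 2 powr r) * A powr (r - 1)))"
  proof -
    consider "A = B" | "A < B" | "B < A" by linarith
    then show ?thesis
    proof cases
      case 1
      then show ?thesis using r by (auto intro!: mult_nonneg_nonneg add_nonneg_nonneg)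
    next
      case 2
      then obtain z where z: "z > A" "z < B" "B powr r - A powr r = (B - A) * (r * z powr (r - 1))"
        using mvt[of A B] A by auto
      have "\<bar>A powr r - B powr r\<bar> = \<bar>(B - A) * (r * z powr (r - 1))\<bar>" using z(3) by linarith
      also have "\<dots> = (B - A) * (r * z powr (r - 1))" using 2 r by simp
      also have "\<dots> \<le> 3 * (r * ((2 + 2 powr r) * A powr (r - 1)))"
        using 2 B r z B2 zb[of z] by (intro mult_mono mult_left_mono) auto
      finally show ?thesis .
    next
      case 3
      then obtain z where z: "z > B" "z < A" "A powr r - B powr r = (A - B) * (r * z powr (r - 1))"
        using mvt[of B A] A B2 by auto
      have "\<bar>A powr r - B powr r\<bar> = (A - B) * (r * z powr (r - 1))" using z(3) 3 r by simp
      also have "\<dots> \<le> 3 * (r * ((2 + 2 powr r) * A powr (r - 1)))"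
        using 3 B r z B2 zb[of z] by (intro mult_mono mult_left_mono) auto
      finally show ?thesis .
    qed
  qed
  also have "\<dots> = 3 * r * (2 + 2 powr r) * A powr (r - 1)" by simp
  also have "\<dots> \<le> (6 * 9 powr r + 3 * r * (2 + 2 powr r)) * A powr (r - 1)"
    by (intro mult_right_mono) auto
  finally show ?thesis .
qed

section \<open>Moments over intervals of directions\<close>

lemma tan_measurable [measurable]: "(tan :: real \<Rightarrow> real) \<in> borel_measurable borel"
  unfolding tan_def[abs_def] by measurable

lemma tan_range_closed:
  assumes "\<omega> \<in> {0..pi/4}"
  shows "0 \<le> tan \<omega>" "tan \<omega> \<le> 1"
  using assms tan_range(4,5)[of \<omega>] by (cases "\<omega> = 0"; fastforce)+

lemma reflections_of_slope_approx_closed: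
  assumes e: "0 < \<epsilon>" "\<epsilon> < 1/2" and t: "0 \<le> t" "t \<le> 1"
  shows "\<bar>real (first_denominator \<epsilon> t) * (1 + t) - real (reflections_of_slope \<epsilon> t)\<bar> \<le> 3"
proof (cases "t = 0")
  case True
  have "first_denominator \<epsilon> 0 = 1" by (rule first_denominator_eqI[of _ _ _ 0]) (use e in auto)
  then show ?thesis using True by (simp add: reflections_of_slope_def stopping_abscissa_def Let_def)
next
  case False
  then show ?thesis using reflections_of_slope_approx[OF e] t by simp
qed

lemma first_denominator_powr_le:
  assumes e: "0 < \<epsilon>" "\<epsilon> < 1/2"
  shows "real (first_denominator \<epsilon> t) powr p \<le> real (nat \<lfloor>1 / \<epsilon>\<rfloor>) powr \<bar>p\<bar>"
proof -
  have q: "1 \<le> real (first_denominator \<epsilon> t)" "real (first_denominator \<epsilon> t) \<le> real (nat \<lfloor>1 / \<epsilon>\<rfloor>)"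
    using first_denominator_range[OF e, of t] by (simp_all only: atLeastAtMost_iff of_nat_le_iff real_of_nat_ge_one_iff)
  have "real (first_denominator \<epsilon> t) powr p \<le> real (first_denominator \<epsilon> t) powr \<bar>p\<bar>"
    using q(1) by (intro powr_mono) auto
  also have "\<dots> \<le> real (nat \<lfloor>1 / \<epsilon>\<rfloor>) powr \<bar>p\<bar>" using q by (intro powr_mono2) auto
  finally show ?thesis .
qed

text \<open>
  Let \<open>G\<close> be the difference between \<open>\<epsilon>\<^sup>r q\<^sup>r\<close> and its mean value. Its integrals over intervals of
  slopes are small; they stay small after the weight \<open>1/(1 + t\<^sup>2)\<close>, which is the change to
  angles, and then after the weight \<open>(1 + tan \<omega>)\<^sup>r\<close>. Last, \<open>q (1 + t)\<close> is replaced by the number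
  of reflections.
\<close>

lemma angular_moment_asymp:
  assumes r: "r > 0"
  obtains C where "C \<ge> 1"
    "\<And>\<epsilon> a b. 0 < \<epsilon> \<Longrightarrow> \<epsilon> < 1/2 \<Longrightarrow> 0 \<le> a \<Longrightarrow> a \<le> b \<Longrightarrow> b \<le> pi/4 \<Longrightarrow>
      \<bar>\<epsilon> powr r * (LBINT \<omega>:{a..b}. real (reflections_of_slope \<epsilon> (tan \<omega>)) powr r)
        - moment_const r * (LBINT x:{a..b}. (1 + tan x) powr r)\<bar> \<le> C * \<epsilon> powr (1/5)"
proof -
  obtain C0 where C0: "C0 \<ge> 1"
    "\<And>\<epsilon> x. 0 < \<epsilon> \<Longrightarrow> \<epsilon> < 1/2 \<Longrightarrow> 0 \<le> x \<Longrightarrow> x \<le> 1 \<Longrightarrow>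
      \<bar>\<epsilon> powr r * (LBINT t:{0..x}. real (first_denominator \<epsilon> t) powr r) - moment_const r * x\<bar> \<le> C0 * \<epsilon> powr (1/5)"
    "\<And>\<epsilon>. 0 < \<epsilon> \<Longrightarrow> \<epsilon> < 1/2 \<Longrightarrow>
      \<epsilon> powr r * (LBINT t:{0..1}. real (first_denominator \<epsilon> t) powr (r - 1)) \<le> C0 * \<epsilon> powr (1/5)"
    using first_denominator_moment_asymp[OF r] by metis
  define K where "K = (6 * 9 powr r + 3 * r * (2 + 2 powr r)) * 2 powr r"
  have K: "K \<ge> 0" unfolding K_def using r by (intro mult_nonneg_nonneg add_nonneg_nonneg) auto
  define c where "c = moment_const r"
  show ?thesis
  proof (rule that[of "(8 * 2 powr r + K) * C0"])
    have "1 \<le> 8 * (2::real) powr r" using ge_one_powr_ge_zero[of 2 r] r by simp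
    then have "1 * 1 \<le> (8 * 2 powr r + K) * C0" using C0(1) K by (intro mult_mono) auto
    then show "1 \<le> (8 * 2 powr r + K) * C0" by simp
    fix \<epsilon> a b :: real
    assume e: "0 < \<epsilon>" "\<epsilon> < 1/2" and ab: "0 \<le> a" "a \<le> b" "b \<le> pi/4"
    define E0 where "E0 = C0 * \<epsilon> powr (1/5)"
    define N where "N = real (nat \<lfloor>1 / \<epsilon>\<rfloor>)"
    define q where "q = (\<lambda>t. real (first_denominator \<epsilon> t))"
    define G where "G = (\<lambda>t. \<epsilon> powr r * q t powr r - c)"
    have q1: "q t \<ge> 1" for t
      using first_denominator_props(1)[OF e(1), of t] by (simp add: q_def)
    have qN: "q t powr p \<le> N powr \<bar>p\<bar>" for t p
      unfolding q_def N_def by (rule first_denominator_powr_le[OF e])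
    have [measurable]: "q \<in> borel_measurable borel" unfolding q_def by measurable
    have [measurable]: "G \<in> borel_measurable borel" unfolding G_def by measurable
    have G_bound: "\<bar>G t\<bar> \<le> \<epsilon> powr r * N powr \<bar>r\<bar> + \<bar>c\<bar>" for t
    proof -
      have "\<epsilon> powr r * q t powr r \<le> \<epsilon> powr r * N powr \<bar>r\<bar>" by (intro mult_left_mono qN) auto
      then show ?thesis unfolding G_def
        using abs_triangle_ineq4[of "\<epsilon> powr r * q t powr r" c] by (simp add: abs_mult)
    qed
    have G_int: "G integrable_on {u..v}" for u v
      by (intro set_borel_integral_eq_integral(1) set_integrable_bounded_interval[OF _ G_bound]) measurable
    have G0: "\<bar>integral {0..x} G\<bar> \<le> E0" if "0 \<le> x" "x \<le> 1" for x
    proof -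
      have 1: "set_integrable lborel {0..x} (\<lambda>t. q t powr r)"
        unfolding q_def by (rule integral_first_denominator_powr(1)[OF e])
      then have "integral {0..x} (\<lambda>t. q t powr r) = (LBINT t:{0..x}. q t powr r)"
        by (simp add: set_borel_integral_eq_integral(2))
      moreover have "(\<lambda>t. q t powr r) integrable_on {0..x}"
        using 1 by (rule set_borel_integral_eq_integral(1))
      then have "integral {0..x} G = \<epsilon> powr r * integral {0..x} (\<lambda>t. q t powr r) - c * x"
        unfolding G_def using that
        by (subst Henstock_Kurzweil_Integration.integral_diff) (auto intro: integrable_on_mult_right)
      ultimately show ?thesis
        using C0(2)[OF e that] by (simp add: q_def E0_def c_def)
    qed
    have G1: "\<bar>integral {u..v} G\<bar> \<le> 2 * E0" if "0 \<le> u" "u \<le> v" "v \<le> 1" for u v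
      using G0[of u] G0[of v] that
        Henstock_Kurzweil_Integration.integral_combine[OF that(1,2) G_int] by auto
    \<comment> \<open>The sign makes the weight increasing.\<close>
    let ?h = "\<lambda>t::real. - 1 / (1 + t\<^sup>2)"
    have G2: "\<bar>integral {u..v} (\<lambda>t. ?h t * G t)\<bar> \<le> 4 * E0" if uv: "0 \<le> u" "u \<le> v" "v \<le> 1" for u v
    proof -
      have "\<bar>integral {u..v} (\<lambda>t. ?h t * G t)\<bar> \<le> 2 * 1 * (2 * E0)"
      proof (rule weighted_integral_bound[OF G_int uv(2)])
        fix x y assume xy: "u \<le> x" "x \<le> y" "y \<le> v"
        have "x\<^sup>2 \<le> y\<^sup>2" using xy uv by (intro power_mono) auto
        moreover have "0 < 1 + x\<^sup>2" by (rule add_pos_nonneg) auto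
        ultimately have "1 / (1 + y\<^sup>2) \<le> 1 / (1 + x\<^sup>2)" by (intro divide_left_mono mult_pos_pos) auto
        then show "?h x \<le> ?h y" by simp
      next
        have "1 / (1 + t\<^sup>2) \<le> 1" for t :: real by (simp add: divide_le_eq_1 add_pos_nonneg)
        then show "\<bar>?h u\<bar> \<le> 1" "\<bar>?h v\<bar> \<le> 1" by (simp_all add: abs_divide add_nonneg_nonneg)
      qed (use G1 uv in auto)
      then show ?thesis by simp
    qed
    have h_meas: "(\<lambda>t. ?h t * G t) \<in> borel_measurable borel" by measurable
    have h_bound: "\<bar>?h t * G t\<bar> \<le> \<epsilon> powr r * N powr \<bar>r\<bar> + \<bar>c\<bar>" for t
    proof -
      have "\<bar>?h t\<bar> \<le> 1" by (simp add: abs_divide add_nonneg_nonneg divide_le_eq_1 add_pos_nonneg)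
      then have "\<bar>?h t\<bar> * \<bar>G t\<bar> \<le> 1 * (\<epsilon> powr r * N powr \<bar>r\<bar> + \<bar>c\<bar>)"
        using G_bound[of t] by (intro mult_mono) auto
      then show ?thesis by (simp only: abs_mult mult_1)
    qed
    have tan01: "0 \<le> tan \<omega>" "tan \<omega> \<le> 1" if "0 \<le> \<omega>" "\<omega> \<le> pi/4" for \<omega>
      using tan_range_closed[of \<omega>] that by auto
    have tan_mono: "tan u \<le> tan v" if "0 \<le> u" "u \<le> v" "v \<le> pi/4" for u v
      by (rule tan_mono_le) (use that pi_gt_zero in linarith)+
    have Gt_int: "set_integrable lborel {u..v} (\<lambda>\<omega>. G (tan \<omega>))" for u v
      by (rule set_integrable_bounded_interval[OF _ G_bound]) measurable
    have G3: "\<bar>integral {u..v} (\<lambda>\<omega>. G (tan \<omega>))\<bar> \<le> 4 * E0" if uv: "0 \<le> u" "u \<le> v" "v \<le> pi/4" for u v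
    proof -
      have int: "set_integrable lborel {tan u..tan v} (\<lambda>t. ?h t * G t)"
        by (rule set_integrable_bounded_interval[OF h_meas h_bound])
      have "(LBINT t:{tan u..tan v}. ?h t * G t) = (LBINT x:{u..v}. ?h (tan x) * G (tan x) * (1 + (tan x)\<^sup>2))"
        by (rule tan_substitution(2)[OF uv int])
      also have "(\<lambda>x. ?h (tan x) * G (tan x) * (1 + (tan x)\<^sup>2)) = (\<lambda>x. - G (tan x))"
      proof
        fix x :: real
        have "1 + (tan x)\<^sup>2 \<noteq> 0" by (metis add_pos_nonneg less_irrefl zero_le_power2 zero_less_one)
        then show "?h (tan x) * G (tan x) * (1 + (tan x)\<^sup>2) = - G (tan x)" by (simp add: field_simps)
      qed
      finally have "(LBINT t:{tan u..tan v}. ?h t * G t) = - (LBINT x:{u..v}. G (tan x))"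
        by (simp add: set_lebesgue_integral_def)
      then have "integral {tan u..tan v} (\<lambda>t. ?h t * G t) = - integral {u..v} (\<lambda>x. G (tan x))"
        using set_borel_integral_eq_integral(2)[OF int] set_borel_integral_eq_integral(2)[OF Gt_int[of u v]] by simp
      then show ?thesis
        using G2[of "tan u" "tan v"] tan01[of u] tan01[of v] tan_mono[OF uv] uv by simp
    qed
    let ?w = "\<lambda>\<omega>. (1 + tan \<omega>) powr r"
    have G4: "\<bar>integral {a..b} (\<lambda>\<omega>. ?w \<omega> * G (tan \<omega>))\<bar> \<le> 2 * 2 powr r * (4 * E0)"
    proof (rule weighted_integral_bound[OF set_borel_integral_eq_integral(1)[OF Gt_int] ab(2)])
      fix x y assume xy: "a \<le> x" "x \<le> y" "y \<le> b"
      then show "?w x \<le> ?w y" using tan_mono[of x y] tan01[of x] ab r by (intro powr_mono2) auto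
    next
      show "\<bar>?w a\<bar> \<le> 2 powr r" using tan01[of a] ab r by (simp add: powr_mono2)
      show "\<bar>?w b\<bar> \<le> 2 powr r" using tan01[of b] ab r by (simp add: powr_mono2)
    qed (use G3 ab in auto)
    let ?f1 = "\<lambda>\<omega>. real (reflections_of_slope \<epsilon> (tan \<omega>)) powr r"
    let ?f2 = "\<lambda>\<omega>. (q (tan \<omega>) * (1 + tan \<omega>)) powr r"
    let ?f3 = "\<lambda>\<omega>. q (tan \<omega>) powr (r - 1)"
    have ab': "0 \<le> \<omega>" "\<omega> \<le> pi/4" "0 \<le> tan \<omega>" "tan \<omega> \<le> 1" if "\<omega> \<in> {a..b}" for \<omega>
      using that ab tan01[of \<omega>] by auto
    have close: "\<bar>?f2 \<omega> - ?f1 \<omega>\<bar> \<le> K * ?f3 \<omega>" if "\<omega> \<in> {a..b}" for \<omega>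
    proof -
      define t where "t = tan \<omega>"
      have t: "0 \<le> t" "t \<le> 1" using ab'[OF that] by (auto simp: t_def)
      have A1: "1 * 1 \<le> q t * (1 + t)" using q1[of t] t by (intro mult_mono) auto
      have "\<bar>(q t * (1 + t)) powr r - real (reflections_of_slope \<epsilon> t) powr r\<bar>
          \<le> (6 * 9 powr r + 3 * r * (2 + 2 powr r)) * (q t * (1 + t)) powr (r - 1)"
        by (rule powr_perturbation[OF r])
           (use A1 reflections_of_slope_approx_closed[OF e t] in \<open>auto simp: q_def\<close>)
      also have "\<dots> \<le> (6 * 9 powr r + 3 * r * (2 + 2 powr r)) * (q t powr (r - 1) * 2 powr r)"
      proof (rule mult_left_mono)
        have "(1 + t) powr (r - 1) \<le> (1 + t) powr r" using t by (intro powr_mono) auto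
        also have "\<dots> \<le> 2 powr r" using t r by (intro powr_mono2) auto
        finally have "q t powr (r - 1) * (1 + t) powr (r - 1) \<le> q t powr (r - 1) * 2 powr r"
          by (intro mult_left_mono) auto
        then show "(q t * (1 + t)) powr (r - 1) \<le> q t powr (r - 1) * 2 powr r"
          using q1[of t] t by (simp add: powr_mult)
      qed (use r in \<open>auto intro!: mult_nonneg_nonneg add_nonneg_nonneg\<close>)
      finally show ?thesis by (simp add: K_def t_def mult_ac)
    qed
    have f2_bound: "\<bar>?f2 \<omega>\<bar> \<le> N powr \<bar>r\<bar> * 2 powr r" if "\<omega> \<in> {a..b}" for \<omega>
    proof -
      have "?f2 \<omega> = q (tan \<omega>) powr r * (1 + tan \<omega>) powr r"
        using q1[of "tan \<omega>"] ab'[OF that] by (simp add: powr_mult)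
      also have "\<dots> \<le> N powr \<bar>r\<bar> * 2 powr r"
        using ab'[OF that] r by (intro mult_mono qN powr_mono2) auto
      finally show ?thesis by simp
    qed
    have f3_bound: "\<bar>?f3 \<omega>\<bar> \<le> N powr \<bar>r - 1\<bar>" for \<omega> using qN[of "tan \<omega>" "r - 1"] by simp
    have f1_bound: "\<bar>?f1 \<omega>\<bar> \<le> N powr \<bar>r\<bar> * 2 powr r + K * N powr \<bar>r - 1\<bar>" if "\<omega> \<in> {a..b}" for \<omega>
    proof -
      have "K * ?f3 \<omega> \<le> K * N powr \<bar>r - 1\<bar>" using f3_bound[of \<omega>] K by (intro mult_left_mono) auto
      then show ?thesis using close[OF that] f2_bound[OF that] by linarith
    qed
    have w_bound: "\<bar>?w \<omega>\<bar> \<le> 2 powr r" if "\<omega> \<in> {a..b}" for \<omega>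
      using ab'[OF that] r by (simp add: powr_mono2)
    have s1: "set_integrable lborel {a..b} ?f1"
      by (rule set_integrable_bounded_interval[OF _ f1_bound]) measurable
    have s2: "set_integrable lborel {a..b} ?f2"
      by (rule set_integrable_bounded_interval[OF _ f2_bound]) measurable
    have s3: "set_integrable lborel {u..v} ?f3" for u v
      by (rule set_integrable_bounded_interval[OF _ f3_bound]) measurable
    have sw: "set_integrable lborel {a..b} ?w"
      by (rule set_integrable_bounded_interval[OF _ w_bound]) measurable
    note i1 = set_borel_integral_eq_integral(1)[OF s1] and i2 = set_borel_integral_eq_integral(1)[OF s2]
      and i3 = set_borel_integral_eq_integral(1)[OF s3] and iw = set_borel_integral_eq_integral(1)[OF sw]
    have main: "\<bar>\<epsilon> powr r * integral {a..b} ?f2 - c * integral {a..b} ?w\<bar> \<le> 8 * 2 powr r * E0"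
    proof -
      have "integral {a..b} (\<lambda>\<omega>. ?w \<omega> * G (tan \<omega>)) = integral {a..b} (\<lambda>\<omega>. \<epsilon> powr r * ?f2 \<omega> - c * ?w \<omega>)"
      proof (rule Henstock_Kurzweil_Integration.integral_cong)
        fix \<omega> assume "\<omega> \<in> {a..b}"
        then have "?f2 \<omega> = q (tan \<omega>) powr r * ?w \<omega>"
          using q1[of "tan \<omega>"] ab'[of \<omega>] by (simp add: powr_mult)
        then show "?w \<omega> * G (tan \<omega>) = \<epsilon> powr r * ?f2 \<omega> - c * ?w \<omega>"
          by (simp add: G_def algebra_simps)
      qed
      also have "\<dots> = \<epsilon> powr r * integral {a..b} ?f2 - c * integral {a..b} ?w"
        using i2 iw by (subst Henstock_Kurzweil_Integration.integral_diff) (auto intro: integrable_on_mult_right)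
      finally show ?thesis using G4 by simp
    qed
    have "\<bar>integral {a..b} ?f2 - integral {a..b} ?f1\<bar> \<le> integral {a..b} (\<lambda>\<omega>. K * ?f3 \<omega>)"
    proof -
      have "integral {a..b} ?f2 - integral {a..b} ?f1 = integral {a..b} (\<lambda>\<omega>. ?f2 \<omega> - ?f1 \<omega>)"
        using i1 i2 by (simp add: Henstock_Kurzweil_Integration.integral_diff)
      moreover have "norm (integral {a..b} (\<lambda>\<omega>. ?f2 \<omega> - ?f1 \<omega>)) \<le> integral {a..b} (\<lambda>\<omega>. K * ?f3 \<omega>)"
        by (rule integral_norm_bound_integral)
           (use i1 i2 i3 close in \<open>auto intro: integrable_diff integrable_on_mult_right\<close>)
      ultimately show ?thesis by simp
    qed
    also have "\<dots> = K * integral {a..b} ?f3" by simp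
    also have "\<dots> \<le> K * (LBINT t:{0..1}. q t powr (r - 1))"
    proof (rule mult_left_mono[OF _ K])
      have int1: "set_integrable lborel {tan 0..tan (pi/4)} (\<lambda>t. q t powr (r - 1))"
        unfolding q_def by (simp add: tan_45 integral_first_denominator_powr(1)[OF e])
      note sub = tan_substitution[OF order_refl _ order_refl int1]
      have si: "set_integrable lborel {0..pi/4} (\<lambda>\<omega>. ?f3 \<omega> * (1 + (tan \<omega>)\<^sup>2))" by (rule sub(1)) simp
      have "integral {a..b} ?f3 \<le> integral {0..pi/4} ?f3"
        by (rule integral_subset_le) (use i3 ab in auto)
      also have "\<dots> \<le> integral {0..pi/4} (\<lambda>\<omega>. ?f3 \<omega> * (1 + (tan \<omega>)\<^sup>2))"
      proof (rule integral_le[OF i3 set_borel_integral_eq_integral(1)[OF si]])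
        fix \<omega>
        have "?f3 \<omega> * 1 \<le> ?f3 \<omega> * (1 + (tan \<omega>)\<^sup>2)" by (intro mult_left_mono) auto
        then show "?f3 \<omega> \<le> ?f3 \<omega> * (1 + (tan \<omega>)\<^sup>2)" by simp
      qed
      also have "\<dots> = (LBINT t:{tan 0..tan (pi/4)}. q t powr (r - 1))"
        using sub(2) set_borel_integral_eq_integral(2)[OF si] by simp
      finally show "integral {a..b} ?f3 \<le> (LBINT t:{0..1}. q t powr (r - 1))" by (simp add: tan_45)
    qed
    finally have "\<epsilon> powr r * \<bar>integral {a..b} ?f2 - integral {a..b} ?f1\<bar>
        \<le> \<epsilon> powr r * (K * (LBINT t:{0..1}. q t powr (r - 1)))"
      by (intro mult_left_mono) auto
    also have "\<dots> = K * (\<epsilon> powr r * (LBINT t:{0..1}. q t powr (r - 1)))" by simp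
    also have "\<dots> \<le> K * E0"
      using C0(3)[OF e] K unfolding E0_def q_def by (intro mult_left_mono) auto
    finally have pert: "\<bar>\<epsilon> powr r * integral {a..b} ?f2 - \<epsilon> powr r * integral {a..b} ?f1\<bar> \<le> K * E0"
      by (simp only: right_diff_distrib[symmetric] abs_mult) simp
    have "\<bar>\<epsilon> powr r * integral {a..b} ?f1 - c * integral {a..b} ?w\<bar> \<le> 8 * 2 powr r * E0 + K * E0"
      using main pert by linarith
    also have "\<dots> = (8 * 2 powr r + K) * C0 * \<epsilon> powr (1/5)" by (simp add: E0_def algebra_simps)
    finally show "\<bar>\<epsilon> powr r * (LBINT \<omega>:{a..b}. ?f1 \<omega>) - moment_const r * (LBINT x:{a..b}. ?w x)\<bar>
        \<le> (8 * 2 powr r + K) * C0 * \<epsilon> powr (1/5)"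
      unfolding set_borel_integral_eq_integral(2)[OF s1] set_borel_integral_eq_integral(2)[OF sw] c_def .
  qed
qed

lemma interval_between_endpoints:
  fixes I :: "real set"
  assumes I: "is_interval I" and b: "I \<subseteq> {u..v}" and ne: "I \<noteq> {}"
  obtains a b where "a \<le> b" "u \<le> a" "b \<le> v" "{a<..<b} \<subseteq> I" "I \<subseteq> {a..b}"
proof -
  have bd: "bdd_below I" "bdd_above I" using b by (auto intro: bdd_below_mono bdd_above_mono)
  have sub: "I \<subseteq> {Inf I..Sup I}" using bd by (auto intro: cInf_lower cSup_upper)
  show ?thesis
  proof (rule that)
    show "I \<subseteq> {Inf I..Sup I}" by (rule sub)
    then show "Inf I \<le> Sup I" using ne by fastforce
    show "u \<le> Inf I" "Sup I \<le> v" using b ne by (auto intro!: cInf_greatest cSup_least)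
    show "{Inf I<..<Sup I} \<subseteq> I"
    proof
      fix x assume x: "x \<in> {Inf I<..<Sup I}"
      then obtain y z where "y \<in> I" "y < x" "z \<in> I" "x < z"
        using cInf_lessD[OF ne, of x] less_cSupD[OF ne, of x] by auto
      then show "x \<in> I" using mem_is_interval_1_I[OF I, of y z x] by simp
    qed
  qed
qed

lemma set_integral_eq_except_countable:
  fixes f g :: "real \<Rightarrow> real"
  assumes "countable X" "\<And>x. x \<notin> X \<Longrightarrow> x \<in> A \<longleftrightarrow> x \<in> B" "\<And>x. x \<notin> X \<Longrightarrow> x \<in> A \<Longrightarrow> f x = g x"
  shows "(LBINT x:A. f x) = (LBINT x:B. g x)"
  unfolding set_lebesgue_integral_def
  by (rule integral_discrete_difference[of X]) (use assms in \<open>auto simp: indicator_def\<close>)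

theorem theorem1p5:
  fixes r \<delta> :: real
  assumes "r > 0" and "\<delta> > 0"
  shows "\<exists>C::real. \<forall>(I :: real set) (\<alpha> :: real).
    is_interval I \<and> I \<subseteq> {0..pi/4} \<and> \<alpha> > 0 \<longrightarrow>
    (\<forall>\<^sub>F \<epsilon> in at_right 0.
      \<bar>\<epsilon> powr r * (LBINT \<omega>:I. real (num_reflections \<epsilon> \<omega>) powr r)
        - moment_const r * (LBINT x:I. (1 + tan x) powr r)\<bar>
      \<le> C * (\<epsilon> powr (1/2 - 2 * \<alpha> - \<delta>) + measure lborel I * \<epsilon> powr \<alpha>))"
proof -
  obtain C where C: "C \<ge> 1"
    "\<And>\<epsilon> a b. 0 < \<epsilon> \<Longrightarrow> \<epsilon> < 1/2 \<Longrightarrow> 0 \<le> a \<Longrightarrow> a \<le> b \<Longrightarrow> b \<le> pi/4 \<Longrightarrow>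
      \<bar>\<epsilon> powr r * (LBINT \<omega>:{a..b}. real (reflections_of_slope \<epsilon> (tan \<omega>)) powr r)
        - moment_const r * (LBINT x:{a..b}. (1 + tan x) powr r)\<bar> \<le> C * \<epsilon> powr (1/5)"
    using angular_moment_asymp[OF assms(1)] by metis
  show ?thesis
  proof (intro exI[of _ C] allI impI)
    fix I :: "real set" and \<alpha> :: real
    assume "is_interval I \<and> I \<subseteq> {0..pi/4} \<and> \<alpha> > 0"
    then have I: "is_interval I" "I \<subseteq> {0..pi/4}" and \<alpha>: "\<alpha> > 0" by auto
    let ?L = "\<lambda>\<epsilon>. \<bar>\<epsilon> powr r * (LBINT \<omega>:I. real (num_reflections \<epsilon> \<omega>) powr r)
        - moment_const r * (LBINT x:I. (1 + tan x) powr r)\<bar>"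
    let ?R = "\<lambda>\<epsilon>. C * (\<epsilon> powr (1/2 - 2 * \<alpha> - \<delta>) + measure lborel I * \<epsilon> powr \<alpha>)"
    have R0: "0 \<le> ?R \<epsilon>" for \<epsilon> using C(1) by (intro mult_nonneg_nonneg add_nonneg_nonneg) auto
    have small: "\<forall>\<^sub>F \<epsilon> in at_right 0. 0 < \<epsilon> \<and> \<epsilon> < (1/2::real)"
      using eventually_at_right_real[of 0 "1/2::real"] by simp
    show "\<forall>\<^sub>F \<epsilon> in at_right 0. ?L \<epsilon> \<le> ?R \<epsilon>"
    proof (cases "I = {}")
      case True
      then show ?thesis using R0 by (simp add: set_lebesgue_integral_def)
    next
      case False
      obtain a b where ab: "a \<le> b" "0 \<le> a" "b \<le> pi/4" "{a<..<b} \<subseteq> I" "I \<subseteq> {a..b}"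
        by (rule interval_between_endpoints[OF I False])
      have mem: "x \<in> I \<longleftrightarrow> x \<in> {a..b}" if "x \<notin> {0, a, b}" for x using that ab by auto
      have Iw: "(LBINT x:I. (1 + tan x) powr r) = (LBINT x:{a..b}. (1 + tan x) powr r)"
        by (rule set_integral_eq_except_countable[of "{0, a, b}"]) (use mem in auto)
      have IR: "(LBINT \<omega>:I. real (num_reflections \<epsilon> \<omega>) powr r) =
          (LBINT \<omega>:{a..b}. real (reflections_of_slope \<epsilon> (tan \<omega>)) powr r)"
        if "0 < \<epsilon>" "\<epsilon> < 1/2" for \<epsilon>
      proof (rule set_integral_eq_except_countable[of "{0, a, b}"])
        fix x assume "x \<notin> {0, a, b}" "x \<in> I"
        then have "0 < x" "x \<le> pi/4" using I(2) by force+
        then show "real (num_reflections \<epsilon> x) powr r = real (reflections_of_slope \<epsilon> (tan x)) powr r"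
          using num_reflections_eq[OF that] by simp
      qed (use mem in auto)
      have bound: "?L \<epsilon> \<le> C * \<epsilon> powr (1/5)" if "0 < \<epsilon>" "\<epsilon> < 1/2" for \<epsilon>
        unfolding Iw IR[OF that] using C(2)[OF that ab(2,1,3)] .
      show ?thesis
      proof (cases "a = b")
        case True
        have "(LBINT x:{a..b}. f x) = 0" for f :: "real \<Rightarrow> real"
          using set_integral_eq_except_countable[of "{a}" "{a..b}" "{}" f f] True
          by (simp add: set_lebesgue_integral_def)
        then have "?L \<epsilon> = 0" if "0 < \<epsilon>" "\<epsilon> < 1/2" for \<epsilon> unfolding Iw IR[OF that] by simp
        then show ?thesis by (intro eventually_mono[OF small]) (use R0 in auto)
      next
        case ab_ne: False
        have "finite (I - {a<..<b})" by (rule finite_subset[of _ "{a, b}"]) (use ab in auto)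
        then have "I - {a<..<b} \<in> sets borel" by (intro borel_closed finite_imp_closed)
        then have "{a<..<b} \<union> (I - {a<..<b}) \<in> sets borel" by (intro sets.Un) auto
        then have I_borel: "I \<in> sets borel" using ab(4) by (simp add: Un_absorb1 Un_Diff_cancel)
        have m: "measure lborel I > 0"
        proof -
          have "measure lborel {a<..<b} \<le> measure lborel I"
            using ab I_borel fmeasurable_bounded_borel[of I a b] by (intro measure_mono_fmeasurable) auto
          then show ?thesis using ab(1) ab_ne by simp
        qed
        show ?thesis
        proof (cases "\<alpha> < 1/5")
          case True
          have "((\<lambda>\<epsilon>::real. \<epsilon> powr (1/5 - \<alpha>)) \<longlongrightarrow> 0) (at_right 0)"
            using True by real_asymp
          then have "\<forall>\<^sub>F \<epsilon> in at_right 0. \<epsilon> powr (1/5 - \<alpha>) < measure lborel I"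
            using m by (rule order_tendstoD(2))
          with small show ?thesis
          proof eventually_elim
            case (elim \<epsilon>)
            have "\<epsilon> powr (1/5) = \<epsilon> powr (1/5 - \<alpha>) * \<epsilon> powr \<alpha>" by (simp add: powr_add[symmetric])
            also have "\<dots> \<le> measure lborel I * \<epsilon> powr \<alpha>" using elim by (intro mult_right_mono) auto
            finally have "C * \<epsilon> powr (1/5) \<le> ?R \<epsilon>"
              using C(1) by (intro mult_left_mono) (auto intro: add_increasing)
            then show ?case using bound elim by (meson order_trans)
          qed
        next
          case False
          show ?thesis
          proof (rule eventually_mono[OF small])
            fix \<epsilon> :: real assume e: "0 < \<epsilon> \<and> \<epsilon> < 1/2"
            have "\<epsilon> powr (1/5) \<le> \<epsilon> powr (1/2 - 2 * \<alpha> - \<delta>)"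
              using e False assms(2) by (intro powr_mono') auto
            then have "C * \<epsilon> powr (1/5) \<le> ?R \<epsilon>"
              using C(1) by (intro mult_left_mono) (auto intro: add_increasing2)
            then show "?L \<epsilon> \<le> ?R \<epsilon>" using bound e by (meson order_trans)
          qed
        qed
      qed
    qed
  qed
qed

end
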